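(* Let $n\ge 2$. There exist $v\in L^{\infty}(\mathbb{R}^n_x\times\mathbb{R}_t;\mathbb{R}^n)$ and $p\in L^{\infty}(\mathbb{R}^n_x\times\mathbb{R}_t)$ solving $$\partial_t v+\operatorname{div}(v\otimes v)+\nabla p=0,\qquad \operatorname{div} v=0$$ in the sense of distributions on $\mathbb{R}^n_x\times\mathbb{R}_t$, such that $v$ is not identically zero, $\operatorname{supp} v$ and $\operatorname{supp} p$ are compact in $\mathbb{R}^n_x\times\mathbb{R}_t$, and in addition: \begin{itemize} \item $\int_{\mathbb{R}^n} |v(x,t)|^2\,dx=1$ for almost every $t\in\,]-1,1[$; \item $v(x,t)=0$ for (almost every $(x,t)$ with) $|t|>1$. \end{itemize}
   Context: Here $\operatorname{div}$ and $\nabla$ are taken in the space variable $x\in\mathbb{R}^n$ only; $v\otimes v$ is the matrix with entries $v_iv_j$ and $(\operatorname{div}(v\otimes v))_i=\sum_j\partial_{x_j}(v_iv_j)$. *)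

theory Defs
  imports "HOL-Analysis.Analysis"
begin

text \<open>
  Elements of \<open>L\<^sup>\<infinity>\<close> are represented by Borel functions (every Lebesgue class contains one);
  statements about them are made up to null sets of \<open>lborel\<close>.
\<close>

definition Linfty :: "('a::euclidean_space \<Rightarrow> 'b::euclidean_space) \<Rightarrow> bool" where
  "Linfty f \<longleftrightarrow> f \<in> borel_measurable lborel \<and> (\<exists>C. AE z in lborel. norm (f z) \<le> C)"

text \<open>The complement of the largest open set on which \<open>f\<close> vanishes almost everywhere.\<close>

definition ess_supp :: "('a::euclidean_space \<Rightarrow> 'b::euclidean_space) \<Rightarrow> 'a set" where
  "ess_supp f = - \<Union>{U. open U \<and> (AE z in lborel. z \<in> U \<longrightarrow> f z = 0)}"

text \<open>
  \<open>C\<^sup>k\<close> on the whole space: all directional derivatives of order at most \<open>k\<close> exist (as values of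
  Frechet derivatives) and are continuous.
\<close>

primrec Ck :: "nat \<Rightarrow> ('a::euclidean_space \<Rightarrow> 'b::euclidean_space) \<Rightarrow> bool" where
  "Ck 0 f \<longleftrightarrow> continuous_on UNIV f"
| "Ck (Suc k) f \<longleftrightarrow>
     (\<forall>x. f differentiable (at x)) \<and> (\<forall>h. Ck k (\<lambda>x. frechet_derivative f (at x) h))"

definition test_function :: "('a::euclidean_space \<Rightarrow> real) \<Rightarrow> bool" where
  "test_function \<phi> \<longleftrightarrow> (\<forall>k. Ck k \<phi>) \<and> compact (closure {z. \<phi> z \<noteq> 0})"

text \<open>
  Distributions are represented by their action on test functions. The Bochner integral below is
  meaningful for locally integrable \<open>f\<close>, in particular for \<open>f\<close> in \<open>L\<^sup>\<infinity>\<close>.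
\<close>

type_synonym 'a distribution = "('a \<Rightarrow> real) \<Rightarrow> real"

definition distr_of :: "('a::euclidean_space \<Rightarrow> real) \<Rightarrow> 'a distribution" where
  "distr_of f \<phi> = (LINT z|lborel. f z * \<phi> z)"

definition distr_deriv :: "'a::euclidean_space \<Rightarrow> 'a distribution \<Rightarrow> 'a distribution" where
  "distr_deriv h T \<phi> = - T (\<lambda>z. frechet_derivative \<phi> (at z) h)"

text \<open>Space-time is \<open>(real^'n) \<times> real\<close>, with points \<open>(x, t)\<close>.\<close>

definition D_t :: "((real^'n) \<times> real) distribution \<Rightarrow> ((real^'n) \<times> real) distribution" where
  "D_t = distr_deriv (0, 1)"

definition D_x :: "'n \<Rightarrow> ((real^'n) \<times> real) distribution \<Rightarrow> ((real^'n) \<times> real) distribution" where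
  "D_x j = distr_deriv (axis j 1, 0)"

definition euler_distributional ::
    "((real^'n) \<times> real \<Rightarrow> real^'n) \<Rightarrow> ((real^'n) \<times> real \<Rightarrow> real) \<Rightarrow> bool" where
  "euler_distributional v p \<longleftrightarrow>
     (\<forall>\<phi>. test_function \<phi> \<longrightarrow>
        (\<forall>i. D_t (distr_of (\<lambda>z. v z $ i)) \<phi>
             + (\<Sum>j\<in>UNIV. D_x j (distr_of (\<lambda>z. v z $ i * v z $ j)) \<phi>)
             + D_x i (distr_of p) \<phi> = 0)
        \<and> (\<Sum>j\<in>UNIV. D_x j (distr_of (\<lambda>z. v z $ j)) \<phi>) = 0)"

end

theory Submission
  imports Defs
begin

text \<open>
  Direct convex integration, after De Lellis and Szekelyhidi. On \<open>\<Omega> = ]0,1[\<^sup>n \<times> ]-1,1[\<close> consider subsolutions: pairs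
  \<open>(v, s)\<close> with \<open>div v = 0\<close>, \<open>\<partial>\<^sub>t v + div s = 0\<close> and \<open>M = I/n - v \<otimes> v + s - (tr s / n) I\<close> positive definite, starting from
  \<open>(0, 0)\<close>. Since \<open>tr M = 1 - |v|\<^sup>2\<close>, a subsolution with \<open>|v| = 1\<close> has \<open>M = 0\<close> and solves the Euler equations with
  \<open>p = (tr s - 1) / n\<close>. Near each point one can add a fast plane wave, cut off to a small ball, whose amplitude is
  bounded below by a multiple of \<open>1 - |v|\<^sup>2\<close>; doing this on disjoint balls which almost fill \<open>\<Omega>\<close> (Vitali) raises
  \<open>\<integral>|v|\<^sup>2\<close> by a multiple of \<open>\<integral>(1 - |v|\<^sup>2)\<^sup>2\<close>, while the perturbation is almost orthogonal to all earlier stages. Hence the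
  iterates are Cauchy in \<open>L\<^sup>2\<close> and \<open>|v| = 1\<close> almost everywhere in the limit. The cut-off disturbs \<open>tr s\<close> only by a uniformly
  summable amount, so the pressures converge uniformly.
\<close>

section \<open>Compactly supported functions\<close>

text \<open>Everything is linear except the relation between \<open>v\<close> and \<open>s\<close>:
  both equations say that the space-time fields \<open>(v, 0)\<close> and \<open>(s_i, v_i)\<close>
  are divergence-free, on all of space-time because subsolutions vanish outside
  \<open>\<Omega>\<close>. They survive bounded almost everywhere limits. The nonlinearity enters
  only through the rows of \<open>M\<close>, whose squared norms are at most
  \<open>1 - |v|^2\<close> and so vanish as \<open>|v|\<close> tends to 1; this alone makes
  \<open>s\<close> converge. The constant \<open>I/n\<close> belongs to the interior of
  \<open>\<Omega>\<close>, and its jump at the boundary is put into the pressure as an indicator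
  function. Since \<open>|v| = 1\<close> on a cylinder over a unit cube, every slice energy is the
  volume 1. The obstacle is to find a wave whose size depends only on \<open>1 - |v|^2\<close>,
  although the lower bound for \<open>M\<close> shrinks at every stage. A row \<open>w\<close> of
  \<open>M\<close> with a large diagonal entry achieves this: \<open>w\<close> is at least of order
  \<open>1 - |v|^2\<close>, and by Cauchy-Schwarz for \<open>M\<close> a move along \<open>w\<close>
  destroys at most a fixed fraction of \<open>M\<close> itself.\<close>

definition C1c :: "('a::euclidean_space \<Rightarrow> real) \<Rightarrow> ('a \<Rightarrow> 'a \<Rightarrow> real) \<Rightarrow> bool" where
  "C1c f f' \<longleftrightarrow> (\<forall>z. (f has_derivative f' z) (at z)) \<and> (\<forall>h. continuous_on UNIV (\<lambda>z. f' z h))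
     \<and> (\<exists>R. \<forall>z. norm z > R \<longrightarrow> f z = 0)"

definition Cc :: "('a::euclidean_space \<Rightarrow> 'b::euclidean_space) \<Rightarrow> bool" where
  "Cc f \<longleftrightarrow> continuous_on UNIV f \<and> (\<exists>R. \<forall>z. norm z > R \<longrightarrow> f z = 0)"

lemma Cc_measurable: "Cc f \<Longrightarrow> f \<in> borel_measurable borel"
  unfolding Cc_def by (auto intro: borel_measurable_continuous_onI)

lemma Cc_integrable:
  assumes "Cc f" shows "integrable lborel f"
proof -
  obtain R where R: "\<And>z. norm z > R \<Longrightarrow> f z = 0" using assms by (auto simp: Cc_def)
  have "integrable lborel (\<lambda>x. indicator (cball 0 R) x *\<^sub>R f x)"
    using assms by (intro borel_integrable_compact) (auto simp: Cc_def intro: continuous_on_subset)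
  also have "(\<lambda>x. indicator (cball 0 R) x *\<^sub>R f x) = f"
    using R by (auto simp: indicator_def fun_eq_iff not_le)
  finally show ?thesis .
qed

lemma Cc_bounded:
  assumes "Cc f" obtains B where "B \<ge> 0" "\<And>z. norm (f z) \<le> B"
proof -
  obtain R where R: "\<And>z. norm z > R \<Longrightarrow> f z = 0" using assms by (auto simp: Cc_def)
  have "compact (f ` cball 0 R)"
    using assms by (intro compact_continuous_image) (auto simp: Cc_def intro: continuous_on_subset)
  then obtain B where B: "\<And>y. y \<in> f ` cball 0 R \<Longrightarrow> norm y \<le> B"
    using compact_imp_bounded bounded_iff by metis
  have "norm (f z) \<le> max B 0" for z
    using B[of "f z"] R[of z] by (cases "norm z \<le> R") (auto simp: le_max_iff_disj)
  then show ?thesis using that[of "max B 0"] by auto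
qed

text \<open>Heine-Cantor on \<open>cball 0 (R+1)\<close>. The extra unit settles the remaining
  pairs: if one of two points at distance less than 1 leaves that ball, both lie where
  \<open>f\<close> vanishes.\<close>

lemma Cc_uniformly_continuous:
  assumes "Cc f" "e > 0"
  shows "\<exists>d>0. \<forall>x y. dist x y < d \<longrightarrow> dist (f x) (f y) < e"
proof -
  obtain R where R: "\<And>z. norm z > R \<Longrightarrow> f z = 0" using assms by (auto simp: Cc_def)
  have "uniformly_continuous_on (cball 0 (R+1)) f"
    using assms by (intro compact_uniformly_continuous) (auto simp: Cc_def intro: continuous_on_subset)
  then obtain d where d: "d > 0" "\<And>x y. x \<in> cball 0 (R+1) \<Longrightarrow> y \<in> cball 0 (R+1) \<Longrightarrow> dist y x < d \<Longrightarrow> dist (f y) (f x) < e"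
    using \<open>e>0\<close> unfolding uniformly_continuous_on_def by metis
  have "dist (f x) (f y) < e" if xy: "dist x y < min d 1" for x y
  proof (cases "x \<in> cball 0 (R+1) \<and> y \<in> cball 0 (R+1)")
    case True then show ?thesis using d xy by auto
  next
    case False
    have "norm x \<le> norm y + dist x y" "norm y \<le> norm x + dist x y"
      by (metis add.commute dist_norm norm_triangle_sub, metis add.commute dist_commute dist_norm norm_triangle_sub)
    then have "norm x > R" "norm y > R" using False xy by auto
    then show ?thesis using R \<open>e > 0\<close> by auto
  qed
  then show ?thesis using d(1) by (intro exI[of _ "min d 1"]) auto
qed

lemma Cc_bounded_support:
  assumes "continuous_on UNIV f" "bounded \<Omega>" "\<And>z. z \<notin> \<Omega> \<Longrightarrow> f z = 0" shows "Cc f"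
proof -
  obtain R where "\<And>z. z \<in> \<Omega> \<Longrightarrow> norm z \<le> R" using assms(2) by (auto simp: bounded_iff)
  then have "\<forall>z. norm z > R \<longrightarrow> f z = 0" using assms(3) by (meson not_le)
  then show ?thesis using assms(1) unfolding Cc_def by blast
qed

lemma Cc_mult_continuous:
  fixes f :: "'a::euclidean_space \<Rightarrow> real"
  assumes "Cc f" "continuous_on UNIV g" shows "Cc (\<lambda>z. f z * g z)"
  using assms unfolding Cc_def by (auto intro!: continuous_intros)

lemma Cc_add:
  assumes "Cc F" "Cc H" shows "Cc (\<lambda>z. F z + H z)"
proof -
  obtain R R' where R: "\<And>z. norm z > R \<Longrightarrow> F z = 0" "\<And>z. norm z > R' \<Longrightarrow> H z = 0"
    using assms by (auto simp: Cc_def)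
  have "\<exists>R. \<forall>z. norm z > R \<longrightarrow> F z + H z = 0" by (rule exI[of _ "max R R'"]) (use R in auto)
  moreover have "continuous_on UNIV (\<lambda>z. F z + H z)" using assms by (auto simp: Cc_def intro: continuous_on_add)
  ultimately show ?thesis by (simp add: Cc_def)
qed

lemma C1c_linear: "C1c f f' \<Longrightarrow> linear (f' z)"
  unfolding C1c_def by (blast intro: has_derivative_linear)

lemma C1c_Cc: "C1c f f' \<Longrightarrow> Cc f"
  unfolding C1c_def Cc_def
  by (auto intro!: continuous_at_imp_continuous_on dest: has_derivative_continuous)

lemma C1c_deriv_Cc:
  assumes "C1c f f'" shows "Cc (\<lambda>z. f' z h)"
proof -
  obtain R where R: "\<And>z. norm z > R \<Longrightarrow> f z = 0" using assms by (auto simp: C1c_def)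
  have "f' z h = 0" if "norm z > R" for z
  proof -
    have "open {z::'a. norm z > R}" by (intro open_Collect_less continuous_intros)
    moreover have "((\<lambda>_. 0) has_derivative (\<lambda>_. 0)) (at z)" by simp
    ultimately have "(f has_derivative (\<lambda>_. 0)) (at z)"
      using has_derivative_transform_within_open[of "\<lambda>_. 0" "\<lambda>_. 0" z UNIV "{z. norm z > R}" f] that R by auto
    moreover have "(f has_derivative f' z) (at z)" using assms by (simp add: C1c_def)
    ultimately have "f' z = (\<lambda>_. 0)" using has_derivative_unique by blast
    then show ?thesis by simp
  qed
  then show ?thesis using assms unfolding Cc_def C1c_def by blast
qed

lemma C1c_deriv_continuous: "C1c f f' \<Longrightarrow> continuous_on UNIV (\<lambda>z. f' z h)"
  by (simp add: C1c_def)

lemma C1c_continuous: "C1c f f' \<Longrightarrow> continuous_on UNIV f"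
  using C1c_Cc Cc_def by blast

section \<open>Translations, difference quotients and integration by parts\<close>

lemma directional_line:
  fixes f :: "'a::euclidean_space \<Rightarrow> real"
  assumes "\<And>z. (f has_derivative f' z) (at z)"
  shows "((\<lambda>s. f (z + s *\<^sub>R b)) has_real_derivative f' (z + s *\<^sub>R b) b) (at s)"
proof -
  have "((\<lambda>s. z + s *\<^sub>R b) has_derivative (\<lambda>s. s *\<^sub>R b)) (at s)"
    by (auto intro!: derivative_eq_intros)
  from has_derivative_compose[OF this assms]
  have "((\<lambda>s. f (z + s *\<^sub>R b)) has_derivative (\<lambda>t. f' (z + s *\<^sub>R b) (t *\<^sub>R b))) (at s)" .
  moreover have "f' y (t *\<^sub>R b) = f' y b * t" for y t
    using linear_scale[OF has_derivative_linear[OF assms]] by simp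
  ultimately show ?thesis by (simp add: has_field_derivative_def)
qed

text \<open>Dominated convergence: the mean value theorem bounds the quotients by a bound of
  \<open>f' z b\<close>, and since the steps are at most 1, all quotients vanish outside
  \<open>cball 0 (R + norm b)\<close>.\<close>

lemma C1c_difference_quotient:
  fixes f :: "'a::euclidean_space \<Rightarrow> real"
  assumes f: "C1c f f'" and g: "continuous_on UNIV g" and gb: "\<And>z. \<bar>g z\<bar> \<le> G"
  shows "(\<lambda>k. LINT z|lborel. (f (z + (1 / real (Suc k)) *\<^sub>R b) - f z) / (1 / real (Suc k)) * g z)
          \<longlonglongrightarrow> (LINT z|lborel. f' z b * g z)"
proof -
  define s :: "nat \<Rightarrow> real" where "s k = 1 / real (Suc k)" for k
  have s: "s k > 0" "s k \<le> 1" for k by (auto simp: s_def field_simps)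
  have s0: "s \<longlonglongrightarrow> 0" unfolding s_def using LIMSEQ_inverse_real_of_nat by (simp add: inverse_eq_divide)
  have der: "\<And>z. (f has_derivative f' z) (at z)" using f by (auto simp: C1c_def)
  obtain R where R: "\<And>z. norm z > R \<Longrightarrow> f z = 0" using f by (auto simp: C1c_def)
  obtain C where C: "C \<ge> 0" "\<And>z. norm (f' z b) \<le> C" using Cc_bounded[OF C1c_deriv_Cc[OF f]] by metis
  have G0: "G \<ge> 0" using gb abs_ge_zero order_trans by blast
  have fm[measurable]: "f \<in> borel_measurable borel" by (rule Cc_measurable[OF C1c_Cc[OF f]])
  have f'm[measurable]: "(\<lambda>z. f' z b) \<in> borel_measurable borel" by (rule Cc_measurable[OF C1c_deriv_Cc[OF f]])
  have gm[measurable]: "g \<in> borel_measurable borel" by (rule borel_measurable_continuous_onI[OF g])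
  have "(\<lambda>k. LINT z|lborel. (f (z + s k *\<^sub>R b) - f z) / s k * g z) \<longlonglongrightarrow> (LINT z|lborel. f' z b * g z)"
  proof (rule integral_dominated_convergence[where w = "\<lambda>z. indicator (cball 0 (R + norm b)) z *\<^sub>R (C * G)"])
    show "integrable lborel (\<lambda>z. indicator (cball 0 (R + norm b)) z *\<^sub>R (C * G))"
      by (intro borel_integrable_compact) auto
    show "AE x in lborel. (\<lambda>k. (f (x + s k *\<^sub>R b) - f x) / s k * g x) \<longlonglongrightarrow> f' x b * g x"
    proof (intro AE_I2 tendsto_intros)
      fix x
      have "((\<lambda>t. f (x + t *\<^sub>R b)) has_real_derivative f' x b) (at 0)"
        using directional_line[OF der, of x b 0] by simp
      then have "((\<lambda>h. (f (x + h *\<^sub>R b) - f x) / h) \<longlongrightarrow> f' x b) (at 0)"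
        by (simp add: DERIV_def)
      moreover have "filterlim s (at 0) sequentially"
        using s0 s(1) by (auto simp: filterlim_at intro!: always_eventually) (metis less_irrefl)
      ultimately show "(\<lambda>k. (f (x + s k *\<^sub>R b) - f x) / s k) \<longlonglongrightarrow> f' x b"
        by (rule filterlim_compose)
    qed
    show "AE x in lborel. norm ((f (x + s k *\<^sub>R b) - f x) / s k * g x) \<le> indicator (cball 0 (R + norm b)) x *\<^sub>R (C * G)" for k
    proof (rule AE_I2)
      fix x
      show "norm ((f (x + s k *\<^sub>R b) - f x) / s k * g x) \<le> indicator (cball 0 (R + norm b)) x *\<^sub>R (C * G)"
      proof (cases "x \<in> cball 0 (R + norm b)")
        case True
        obtain t where "0 < t" "t < s k" and t: "f (x + s k *\<^sub>R b) - f (x + 0 *\<^sub>R b) = (s k - 0) * f' (x + t *\<^sub>R b) b"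
          using MVT2[of 0 "s k" "\<lambda>t. f (x + t *\<^sub>R b)", OF s(1) directional_line[OF der]] by blast
        have "(f (x + s k *\<^sub>R b) - f x) / s k = f' (x + t *\<^sub>R b) b"
          using t s(1)[of k] by simp
        then show ?thesis using True C gb[of x] G0 by (auto simp: abs_mult intro!: mult_mono)
      next
        case False
        then have n: "norm x > R + norm b" by simp
        have "norm (s k *\<^sub>R b) \<le> norm b" using s[of k] by (simp add: mult_left_le_one_le)
        moreover have "norm (x + s k *\<^sub>R b) \<ge> norm x - norm (s k *\<^sub>R b)"
          using norm_diff_ineq by blast
        ultimately have "norm (x + s k *\<^sub>R b) > R" "norm x > R" using n norm_ge_zero[of b] by linarith+
        then show ?thesis using R False by simp
      qed
    qed
  qed auto
  then show ?thesis by (simp add: s_def)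
qed

lemma lborel_integral_shift:
  fixes f :: "'a::euclidean_space \<Rightarrow> real"
  shows "(LINT z|lborel. f (z + c)) = (LINT z|lborel. f z)"
proof -
  show ?thesis
  proof (cases "f \<in> borel_measurable borel")
    case True
    then show ?thesis
      by (subst (2) lborel_distr_plus[of c, symmetric], subst integral_distr) (auto simp: add.commute)
  next
    case False
    \<comment> \<open>No measurability is assumed. If it fails for \<open>f\<close> it fails for the
      translate, and both integrals take the default value 0.\<close>
    have "(\<lambda>z. f (z + c)) \<notin> borel_measurable borel"
    proof
      assume "(\<lambda>z. f (z + c)) \<in> borel_measurable borel"
      then have "(\<lambda>z. f ((z - c) + c)) \<in> borel_measurable borel" by measurable
      with False show False by simp
    qed
    with False have "\<not> integrable lborel f" "\<not> integrable lborel (\<lambda>z. f (z + c))"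
      using borel_measurable_integrable by force+
    then show ?thesis by (simp add: not_integrable_integral_eq)
  qed
qed

lemma Cc_shift:
  assumes "Cc f" shows "Cc (\<lambda>z. f (z + c))"
proof -
  obtain R where R: "\<And>z. norm z > R \<Longrightarrow> f z = 0" using assms by (auto simp: Cc_def)
  have "f (z + c) = 0" if "norm z > R + norm c" for z
  proof (rule R)
    have "norm (z + c) \<ge> norm z - norm c" using norm_diff_ineq by blast
    then show "norm (z + c) > R" using that by linarith
  qed
  moreover have "continuous_on UNIV (\<lambda>z. f (z + c))"
    using assms continuous_on_compose2[of UNIV f UNIV "\<lambda>z. z + c"]
      continuous_on_add[OF continuous_on_id continuous_on_const] unfolding Cc_def by blast
  ultimately show ?thesis unfolding Cc_def by blast
qed

text \<open>Translation invariance makes the integral of every difference quotient zero, and these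
  integrals tend to that of the derivative.\<close>

lemma C1c_integral_deriv:
  assumes f: "C1c f f'" shows "(LINT z|lborel. f' z b) = 0"
proof -
  have z: "(LINT z|lborel. (f (z + s *\<^sub>R b) - f z) / s * 1) = 0" for s
  proof -
    have "(LINT z|lborel. (f (z + s *\<^sub>R b) - f z) / s * 1)
        = ((LINT z|lborel. f (z + s *\<^sub>R b)) - (LINT z|lborel. f z)) / s"
      by (simp add: Bochner_Integration.integral_diff[OF Cc_integrable[OF Cc_shift[OF C1c_Cc[OF f]]] Cc_integrable[OF C1c_Cc[OF f]]])
    then show ?thesis by (simp add: lborel_integral_shift)
  qed
  have "(\<lambda>k::nat. 0::real) \<longlonglongrightarrow> (LINT z|lborel. f' z b * 1)"
    using C1c_difference_quotient[OF f continuous_on_const, of 1 1 b, OF eq_refl[OF abs_one]] unfolding z .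
  then show ?thesis by (simp add: LIMSEQ_const_iff)
qed

lemma C1c_mult:
  assumes "C1c f f'" "C1c g g'" shows "C1c (\<lambda>z. f z * g z) (\<lambda>z h. f z * g' z h + f' z h * g z)"
proof -
  have "((\<lambda>z. f z * g z) has_derivative (\<lambda>h. f z * g' z h + f' z h * g z)) (at z)" for z
    using assms by (intro has_derivative_mult) (auto simp: C1c_def)
  moreover have "continuous_on UNIV (\<lambda>z. f z * g' z h + f' z h * g z)" for h
    using assms C1c_Cc[OF assms(1)] C1c_Cc[OF assms(2)]
    by (intro continuous_on_add continuous_on_mult) (auto simp: C1c_def Cc_def)
  moreover obtain R where "\<And>z. norm z > R \<Longrightarrow> f z = 0" using assms by (auto simp: C1c_def)
  ultimately show ?thesis by (auto simp: C1c_def intro!: exI[of _ R])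
qed

lemma C1c_by_parts:
  assumes f: "C1c f f'" and g: "C1c g g'"
  shows "(LINT z|lborel. f' z h * g z) = - (LINT z|lborel. f z * g' z h)"
proof -
  have i: "integrable lborel (\<lambda>z. f z * g' z h)" "integrable lborel (\<lambda>z. f' z h * g z)"
    by (intro Cc_integrable Cc_mult_continuous C1c_Cc[OF f] C1c_deriv_Cc[OF f] C1c_continuous[OF g] C1c_deriv_continuous[OF g])+
  show ?thesis using C1c_integral_deriv[OF C1c_mult[OF f g], of h] i by simp
qed

lemma C1c_shift: "C1c f f' \<Longrightarrow> C1c (\<lambda>z. f (z + c)) (\<lambda>z. f' (z + c))"
proof -
  assume f: "C1c f f'"
  have "((\<lambda>z. f (z + c)) has_derivative f' (z + c)) (at z)" for z
  proof (rule has_derivative_compose[of "\<lambda>z. z + c" "\<lambda>h. h"])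
    show "((\<lambda>z. z + c) has_derivative (\<lambda>h. h)) (at z)" by (auto intro!: derivative_eq_intros)
    show "(f has_derivative f' (z + c)) (at (z + c))" using f by (simp add: C1c_def)
  qed
  moreover have "Cc (\<lambda>z. f (z + c))" "\<And>h. Cc (\<lambda>z. f' (z + c) h)"
    using Cc_shift C1c_Cc[OF f] C1c_deriv_Cc[OF f] by blast+
  ultimately show ?thesis by (auto simp: C1c_def Cc_def)
qed

text \<open>
  Translations commute with derivatives, so both sides are the limit of the same difference quotients;
  in particular no equality of mixed second partial derivatives is needed.
\<close>

lemma C1c_swap:
  assumes f: "C1c f f'" and g: "C1c g g'"
  shows "(LINT z|lborel. f' z b * g' z c) = (LINT z|lborel. f' z c * g' z b)"
proof -
  let ?s = "\<lambda>k. 1 / real (Suc k)"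
  have cf: "continuous_on UNIV (\<lambda>z. f' z h)" "continuous_on UNIV f" 
   and cg: "continuous_on UNIV (\<lambda>z. g' z h)" "continuous_on UNIV g" for h
    using C1c_continuous C1c_deriv_continuous f g by blast+
  obtain B where B: "\<And>z. norm (f' z c) \<le> B" using Cc_bounded[OF C1c_deriv_Cc[OF f]] by metis
  obtain A where A: "\<And>z. norm (g' z c) \<le> A" using Cc_bounded[OF C1c_deriv_Cc[OF g]] by metis
  have l1: "(\<lambda>k. LINT z|lborel. (f (z + ?s k *\<^sub>R b) - f z) / ?s k * g' z c) \<longlonglongrightarrow> (LINT z|lborel. f' z b * g' z c)"
    by (rule C1c_difference_quotient[OF f cg(1) A[unfolded real_norm_def]])
  \<comment> \<open>Moving the translation from \<open>f\<close> to \<open>g\<close> reverses its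
    direction, so the quotients of \<open>g\<close> are taken along \<open>-b\<close>; linearity of
    \<open>g' z\<close> restores the sign at the end.\<close>
  have l2: "(\<lambda>k. LINT z|lborel. (g (z + ?s k *\<^sub>R (-b)) - g z) / ?s k * f' z c) \<longlonglongrightarrow> (LINT z|lborel. g' z (-b) * f' z c)"
    by (rule C1c_difference_quotient[OF g cf(1) B[unfolded real_norm_def]])
  have eq: "(LINT z|lborel. (f (z + s *\<^sub>R b) - f z) / s * g' z c)
      = - (LINT z|lborel. (g (z + s *\<^sub>R (-b)) - g z) / s * f' z c)" for s
  proof -
    have i1: "integrable lborel (\<lambda>z. f (z + s *\<^sub>R b) * g' z c)" "integrable lborel (\<lambda>z. f z * g' z c)"
             "integrable lborel (\<lambda>z. f' z c * g z)" "integrable lborel (\<lambda>z. f' z c * g (z + s *\<^sub>R (-b)))"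
      by (intro Cc_integrable Cc_mult_continuous C1c_Cc[OF f] C1c_deriv_Cc[OF f] Cc_shift cg
          C1c_continuous[OF C1c_shift[OF g]])+
    have "(LINT z|lborel. (f (z + s *\<^sub>R b) - f z) / s * g' z c)
       = ((LINT z|lborel. f (z + s *\<^sub>R b) * g' z c) - (LINT z|lborel. f z * g' z c)) / s"
      by (simp only: left_diff_distrib times_divide_eq_left Bochner_Integration.integral_divide_zero
          Bochner_Integration.integral_diff[OF i1(1) i1(2)])
    also have "(LINT z|lborel. f (z + s *\<^sub>R b) * g' z c) = - (LINT z|lborel. f' (z + s *\<^sub>R b) c * g z)"
      using C1c_by_parts[OF C1c_shift[OF f] g, of "s *\<^sub>R b" c] by simp
    also have "(LINT z|lborel. f' (z + s *\<^sub>R b) c * g z) = (LINT z|lborel. f' z c * g (z + s *\<^sub>R (-b)))"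
      using lborel_integral_shift[of "\<lambda>z. f' z c * g (z - s *\<^sub>R b)" "s *\<^sub>R b"] by simp
    also have "(LINT z|lborel. f z * g' z c) = - (LINT z|lborel. f' z c * g z)"
      using C1c_by_parts[OF f g, of c] by simp
    also have "(- (LINT z|lborel. f' z c * g (z + s *\<^sub>R (-b))) - - (LINT z|lborel. f' z c * g z)) / s
       = - (LINT z|lborel. (g (z + s *\<^sub>R (-b)) - g z) / s * f' z c)"
    proof -
      have "(LINT z|lborel. (g (z + s *\<^sub>R (-b)) - g z) / s * f' z c)
        = (LINT z|lborel. (f' z c * g (z + s *\<^sub>R (-b)) - f' z c * g z) / s)"
        by (intro Bochner_Integration.integral_cong refl)
          (simp only: right_diff_distrib times_divide_eq_right mult.commute[of _ "f' _ c"])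
      also have "\<dots> = ((LINT z|lborel. f' z c * g (z + s *\<^sub>R (-b))) - (LINT z|lborel. f' z c * g z)) / s"
        by (simp only: Bochner_Integration.integral_divide_zero Bochner_Integration.integral_diff[OF i1(4) i1(3)])
      finally show ?thesis by (simp add: diff_divide_distrib)
    qed
    finally show ?thesis .
  qed
  have "(LINT z|lborel. f' z b * g' z c) = - (LINT z|lborel. g' z (-b) * f' z c)"
    using l1 tendsto_minus[OF l2] unfolding eq by (rule LIMSEQ_unique)
  moreover have "g' z (-b) = - g' z b" for z
    by (rule linear_neg[OF C1c_linear[OF g]])
  ultimately show ?thesis by (simp add: mult.commute)
qed

lemma test_function_C1c:
  assumes "test_function \<phi>" shows "C1c \<phi> (\<lambda>z. frechet_derivative \<phi> (at z))"
proof -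
  have "Ck (Suc 0) \<phi>" "compact (closure {z. \<phi> z \<noteq> 0})" using assms by (simp_all only: test_function_def)
  then have C: "\<phi> differentiable (at z)" "continuous_on UNIV (\<lambda>z. frechet_derivative \<phi> (at z) h)"
    and c: "compact (closure {z. \<phi> z \<noteq> 0})" for z h
    by simp_all
  obtain R where "\<And>z. z \<in> closure {z. \<phi> z \<noteq> 0} \<Longrightarrow> norm z \<le> R"
    using compact_imp_bounded[OF c] unfolding bounded_iff by blast
  then have "\<phi> z = 0" if "norm z > R" for z
    using that closure_subset[of "{z. \<phi> z \<noteq> 0}"] by force
  moreover have "(\<phi> has_derivative frechet_derivative \<phi> (at z)) (at z)" for z
    using C(1) unfolding frechet_derivative_works .
  ultimately show ?thesis using C(2) unfolding C1c_def by blast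
qed

text \<open>Free of coordinates, so that it applies directly to space-time: \<open>(v, 0)\<close>
  encodes \<open>div v = 0\<close>, and \<open>(s_i, v_i)\<close> encodes row \<open>i\<close> of
  the momentum equation, with the time derivative as one more component.\<close>

definition weak_divfree :: "('a::euclidean_space \<Rightarrow> 'a) \<Rightarrow> bool" where
  "weak_divfree F \<longleftrightarrow> (\<forall>\<phi>. test_function \<phi> \<longrightarrow> (LINT z|lborel. frechet_derivative \<phi> (at z) (F z)) = 0)"

lemma frechet_apply_sum:
  assumes "C1c \<phi> \<phi>'" shows "\<phi>' z h = (\<Sum>b\<in>Basis. (h \<bullet> b) * \<phi>' z b)"
proof -
  have l: "linear (\<phi>' z)" by (rule C1c_linear[OF assms])
  have "\<phi>' z h = \<phi>' z (\<Sum>b\<in>Basis. (h \<bullet> b) *\<^sub>R b)" by (simp add: euclidean_representation)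
  also have "\<dots> = (\<Sum>b\<in>Basis. (h \<bullet> b) * \<phi>' z b)" by (simp add: linear_sum[OF l] linear_scale[OF l])
  finally show ?thesis .
qed

lemma integrable_pairing:
  assumes "C1c \<phi> \<phi>'" "Cc F" shows "integrable lborel (\<lambda>z. \<phi>' z (F z))"
proof -
  have "integrable lborel (\<lambda>z. \<Sum>b\<in>Basis. (F z \<bullet> b) * \<phi>' z b)"
  proof (intro Bochner_Integration.integrable_sum Cc_integrable Cc_mult_continuous)
    fix b :: 'a
    obtain R where "\<And>z. norm z > R \<Longrightarrow> F z = 0" using assms(2) by (auto simp: Cc_def)
    then show "Cc (\<lambda>z. F z \<bullet> b)"
      using assms(2) by (auto simp: Cc_def intro!: continuous_intros exI[of _ R])
    show "continuous_on UNIV (\<lambda>z. \<phi>' z b)" using assms(1) by (auto simp: C1c_def)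
  qed
  moreover have "(\<lambda>z. \<phi>' z (F z)) = (\<lambda>z. \<Sum>b\<in>Basis. (F z \<bullet> b) * \<phi>' z b)"
    by (rule ext, rule frechet_apply_sum[OF assms(1)])
  ultimately show ?thesis by (simp only:)
qed

lemma weak_divfree_add:
  assumes "weak_divfree F" "weak_divfree H" "Cc F" "Cc H"
  shows "weak_divfree (\<lambda>z. F z + H z)"
  unfolding weak_divfree_def
proof (intro allI impI)
  fix \<phi> :: "'a \<Rightarrow> real" assume t: "test_function \<phi>"
  have l: "linear (frechet_derivative \<phi> (at z))" for z
    by (rule C1c_linear[OF test_function_C1c[OF t]])
  show "(LINT z|lborel. frechet_derivative \<phi> (at z) (F z + H z)) = 0"
    using integrable_pairing[OF test_function_C1c[OF t]] assms t
    by (simp add: linear_add[OF l] weak_divfree_def)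
qed

lemma weak_divfree_scale:
  assumes "weak_divfree F" shows "weak_divfree (\<lambda>z. c *\<^sub>R F z)"
  unfolding weak_divfree_def
proof (intro allI impI)
  fix \<phi> :: "'a \<Rightarrow> real" assume t: "test_function \<phi>"
  have l: "linear (frechet_derivative \<phi> (at z))" for z
    by (rule C1c_linear[OF test_function_C1c[OF t]])
  show "(LINT z|lborel. frechet_derivative \<phi> (at z) (c *\<^sub>R F z)) = 0"
    using assms t by (simp add: linear_scale[OF l] weak_divfree_def)
qed

lemma weak_divfree_zero: "weak_divfree (\<lambda>z. 0)"
  unfolding weak_divfree_def
proof (intro allI impI)
  fix \<phi> :: "'a \<Rightarrow> real" assume t: "test_function \<phi>"
  have l: "linear (frechet_derivative \<phi> (at z))" for z
    by (rule C1c_linear[OF test_function_C1c[OF t]])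
  show "(LINT z|lborel. frechet_derivative \<phi> (at z) 0) = 0" by (simp add: linear_0[OF l])
qed

text \<open>The field is a rotated gradient in the plane of \<open>b\<close> and \<open>c\<close>.
  Pairing it with the derivative of a test function leaves exactly the two mixed integrals of
  \<open>C1c_swap\<close>. All perturbations are assembled from such fields.\<close>

lemma weak_divfree_curl:
  assumes f: "C1c f f'"
  shows "weak_divfree (\<lambda>z. f' z b *\<^sub>R c - f' z c *\<^sub>R b)"
  unfolding weak_divfree_def
proof (intro allI impI)
  fix \<phi> :: "'a \<Rightarrow> real" assume t: "test_function \<phi>"
  note g = test_function_C1c[OF t]
  have l: "linear (frechet_derivative \<phi> (at z))" for z
    by (rule C1c_linear[OF g])
  have i: "integrable lborel (\<lambda>z. f' z h * frechet_derivative \<phi> (at z) k)" for h k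
    by (intro Cc_integrable Cc_mult_continuous C1c_deriv_Cc[OF f] C1c_deriv_continuous[OF g])
  show "(LINT z|lborel. frechet_derivative \<phi> (at z) (f' z b *\<^sub>R c - f' z c *\<^sub>R b)) = 0"
    using i C1c_swap[OF f g, of b c] by (simp add: linear_diff[OF l] linear_scale[OF l])
qed

section \<open>Localized plane waves\<close>

text \<open>An exponent of at least two removes the corner of the positive part: at 0 the difference
  quotient is \<open>(max 0 h) ^ Suc k\<close>, which tends to 0.\<close>

lemma DERIV_pos_part_power:
  "((\<lambda>x::real. (max 0 x) ^ Suc (Suc k)) has_real_derivative real (Suc (Suc k)) * (max 0 x) ^ Suc k) (at x)"
proof -
  consider "x > 0" | "x < 0" | "x = 0" by linarith
  then show ?thesis
  proof cases
    case 1
    have "((\<lambda>x::real. x ^ Suc (Suc k)) has_real_derivative real (Suc (Suc k)) * (max 0 x) ^ Suc k) (at x)"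
      using DERIV_pow[of "Suc (Suc k)" x UNIV] 1 by simp
    then show ?thesis
      by (rule has_field_derivative_transform_within_open[of _ _ _ "{0<..}"]) (use 1 in auto)
  next
    case 2
    have "((\<lambda>x::real. 0) has_real_derivative real (Suc (Suc k)) * (max 0 x) ^ Suc k) (at x)"
      using 2 by auto
    then show ?thesis
      by (rule has_field_derivative_transform_within_open[of _ _ _ "{..<0}"]) (use 2 in auto)
  next
    case 3
    have "((\<lambda>h::real. (max 0 h) ^ Suc k) \<longlongrightarrow> (max 0 0) ^ Suc k) (at 0)"
      by (intro tendsto_intros)
    then have "((\<lambda>h::real. (max 0 h) ^ Suc k) \<longlongrightarrow> 0) (at 0)" by simp
    then have "((\<lambda>h::real. ((max 0 (0 + h)) ^ Suc (Suc k) - (max 0 0) ^ Suc (Suc k)) / h) \<longlongrightarrow> 0) (at 0)"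
      by (rule Lim_transform_eventually) (auto simp: eventually_at_filter max_def field_simps intro!: always_eventually)
    then show ?thesis using 3 by (simp add: DERIV_def)
  qed
qed

text \<open>A truncated paraboloid is merely Lipschitz, but its cube is C^2, which suffices for a
  potential whose second derivatives must be continuous. The derivatives of its powers are explicit,
  which keeps the error constants elementary.\<close>

definition bump :: "'a::euclidean_space \<Rightarrow> real \<Rightarrow> 'a \<Rightarrow> real" where
  "bump c r z = max 0 (1 - ((z - c) \<bullet> (z - c)) / r\<^sup>2)"

lemma bump_bounds: "0 \<le> bump c r z" "bump c r z \<le> 1"
  by (auto simp: bump_def)

lemma bump_zero: "r > 0 \<Longrightarrow> dist z c \<ge> r \<Longrightarrow> bump c r z = 0"
  by (simp add: bump_def dist_norm power2_norm_eq_inner[symmetric] field_simps power_mono)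

lemma continuous_bump: "continuous_on UNIV (bump c r)"
  unfolding bump_def by (cases "r = 0") (auto intro!: continuous_intros)

lemma bump_power_has_derivative:
  "((\<lambda>z. bump c r z ^ Suc (Suc k)) has_derivative
      (\<lambda>h. - (2 * real (Suc (Suc k)) / r\<^sup>2) * bump c r z ^ Suc k * ((z - c) \<bullet> h))) (at z)"
proof -
  let ?g = "\<lambda>z. 1 - ((z - c) \<bullet> (z - c)) / r\<^sup>2"
  have g: "(?g has_derivative (\<lambda>h. - (2 / r\<^sup>2) * ((z - c) \<bullet> h))) (at z)"
  proof -
    have "((\<lambda>z. (z - c) \<bullet> (z - c)) has_derivative (\<lambda>h. 2 * ((z - c) \<bullet> h))) (at z)"
      by (auto intro!: derivative_eq_intros simp: inner_commute)
    from has_derivative_diff[OF has_derivative_const has_derivative_mult_right[OF this, of "1 / r\<^sup>2"]]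
    show ?thesis by simp
  qed
  have "((\<lambda>x::real. (max 0 x) ^ Suc (Suc k)) has_derivative
      (*) (real (Suc (Suc k)) * (max 0 (?g z)) ^ Suc k)) (at (?g z))"
    using DERIV_pos_part_power unfolding has_field_derivative_def .
  from has_derivative_compose[OF g this]
  have "((\<lambda>z. bump c r z ^ Suc (Suc k)) has_derivative
      (\<lambda>h. real (Suc (Suc k)) * bump c r z ^ Suc k * (- (2 / r\<^sup>2) * ((z - c) \<bullet> h)))) (at z)"
    unfolding bump_def .
  also have "(\<lambda>h. real (Suc (Suc k)) * bump c r z ^ Suc k * (- (2 / r\<^sup>2) * ((z - c) \<bullet> h)))
      = (\<lambda>h. - (2 * real (Suc (Suc k)) / r\<^sup>2) * bump c r z ^ Suc k * ((z - c) \<bullet> h))"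
    by (simp only: fun_eq_iff minus_mult_left[symmetric] minus_mult_right[symmetric] times_divide_eq_left times_divide_eq_right mult_ac simp_thms)
  finally show ?thesis .
qed

text \<open>On the ball of half the radius the bump is at least 3/4, and
  \<open>(3/4) ^ 6 \<ge> 1/8\<close>; halving the radius costs the factor
  \<open>2 ^ DIM('a)\<close>.\<close>

lemma bump_square_integral:
  fixes c :: "'a::euclidean_space"
  assumes "r > 0"
  shows "integrable lborel (\<lambda>z. (bump c r z ^ 3)\<^sup>2)"
    "(LINT z|lborel. (bump c r z ^ 3)\<^sup>2) \<ge> measure lborel (ball c r) / (8 * 2 ^ DIM('a))"
proof -
  have z: "bump c r z = 0" if "norm z > norm c + r" for z
  proof (rule bump_zero[OF assms])
    have "norm z \<le> norm c + dist z c" by (metis add.commute dist_norm norm_triangle_sub)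
    then show "dist z c \<ge> r" using that by linarith
  qed
  then have "Cc (\<lambda>z. (bump c r z ^ 3)\<^sup>2)"
    using continuous_bump unfolding Cc_def
    by (intro conjI continuous_intros exI[of _ "norm c + r"]) auto
  then show i: "integrable lborel (\<lambda>z. (bump c r z ^ 3)\<^sup>2)" by (rule Cc_integrable)
  have "measure lborel (ball c r) / (8 * 2 ^ DIM('a)) = measure lborel (ball c (r/2)) / 8"
    using assms by (simp add: content_ball power_divide)
  also have "\<dots> = (LINT z|lborel. indicator (ball c (r/2)) z / 8)" by simp
  also have "\<dots> \<le> (LINT z|lborel. (bump c r z ^ 3)\<^sup>2)"
  proof (intro integral_mono i)
    show "integrable lborel (\<lambda>z. indicat_real (ball c (r/2)) z / 8)"
      using emeasure_lborel_ball_finite[of c "r/2"]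
      by (intro integrable_divide integrable_real_indicator) (auto simp: top.not_eq_extremum infinity_ennreal_def)
    fix z
    show "indicator (ball c (r/2)) z / 8 \<le> (bump c r z ^ 3)\<^sup>2"
    proof (cases "z \<in> ball c (r/2)")
      case True
      then have "norm (z - c) < r/2" by (simp add: dist_norm norm_minus_commute)
      then have "(norm (z - c))\<^sup>2 \<le> (r/2)\<^sup>2" by (intro power_mono) auto
      then have "((z - c) \<bullet> (z - c)) / r\<^sup>2 \<le> 1/4"
        using assms by (simp add: power2_norm_eq_inner field_simps)
      then have "3/4 \<le> 1 - ((z - c) \<bullet> (z - c)) / r\<^sup>2" by linarith
      then have "bump c r z \<ge> 3/4" unfolding bump_def by (rule max.coboundedI2)
      then have "(3/4) ^ 6 \<le> bump c r z ^ 6" by (intro power_mono) auto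
      then have "1/8 \<le> bump c r z ^ 6" by (simp add: power_divide)
      then show ?thesis using True by (simp add: power_mult[symmetric])
    qed simp
  qed
  finally show "(LINT z|lborel. (bump c r z ^ 3)\<^sup>2) \<ge> measure lborel (ball c r) / (8 * 2 ^ DIM('a))" .
qed

text \<open>Replaces an averaging argument for fast oscillations. The phases 0 and
  \<open>-(pi/2)\<close> give cosine and sine, whose squares add up to 1, so one of them retains
  half of the integral, with a bound independent of \<open>\<omega>\<close>.\<close>

lemma exists_phase:
  fixes c :: "'a::euclidean_space" and \<omega> :: 'a
  assumes "r > 0"
  obtains a where "(LINT z|lborel. (bump c r z ^ 3 * cos (z \<bullet> \<omega> + a))\<^sup>2) \<ge> measure lborel (ball c r) / (16 * 2 ^ DIM('a))"
proof -
  let ?I = "\<lambda>a. LINT z|lborel. (bump c r z ^ 3 * cos (z \<bullet> \<omega> + a))\<^sup>2"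
  have i: "integrable lborel (\<lambda>z. (bump c r z ^ 3 * cos (z \<bullet> \<omega> + a))\<^sup>2)" for a
  proof (rule Bochner_Integration.integrable_bound[OF bump_square_integral(1)[OF assms, of c]])
    show "(\<lambda>z. (bump c r z ^ 3 * cos (z \<bullet> \<omega> + a))\<^sup>2) \<in> borel_measurable lborel"
      using continuous_bump by (auto intro!: borel_measurable_continuous_onI continuous_intros)
    show "AE z in lborel. norm ((bump c r z ^ 3 * cos (z \<bullet> \<omega> + a))\<^sup>2) \<le> norm ((bump c r z ^ 3)\<^sup>2)"
      by (intro AE_I2) (auto simp: power_mult_distrib abs_square_le_1 intro!: mult_left_le)
  qed
  have "?I 0 + ?I (-(pi/2)) = (LINT z|lborel. (bump c r z ^ 3 * cos (z \<bullet> \<omega> + 0))\<^sup>2 + (bump c r z ^ 3 * cos (z \<bullet> \<omega> + - (pi/2)))\<^sup>2)"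
    using i by (intro Bochner_Integration.integral_add[symmetric])
  also have "\<dots> = (LINT z|lborel. (bump c r z ^ 3)\<^sup>2)"
  proof (intro Bochner_Integration.integral_cong refl)
    fix z
    have "cos (z \<bullet> \<omega> + - (pi/2)) = sin (z \<bullet> \<omega>)" by (simp add: cos_diff)
    then show "(bump c r z ^ 3 * cos (z \<bullet> \<omega> + 0))\<^sup>2 + (bump c r z ^ 3 * cos (z \<bullet> \<omega> + - (pi/2)))\<^sup>2 = (bump c r z ^ 3)\<^sup>2"
      by (simp only: power_mult_distrib distrib_left[symmetric] add_0_right sin_cos_squared_add2 mult_1_right)
  qed
  finally have "?I 0 + ?I (-(pi/2)) \<ge> measure lborel (ball c r) / (8 * 2 ^ DIM('a))"
    using bump_square_integral(2)[OF assms, of c] by simp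
  then have "?I 0 \<ge> measure lborel (ball c r) / (16 * 2 ^ DIM('a)) \<or> ?I (-(pi/2)) \<ge> measure lborel (ball c r) / (16 * 2 ^ DIM('a))"
    by (rule contrapos_pp) (simp add: not_le field_simps)
  then show ?thesis using that by blast
qed

text \<open>
  \<open>P z a b\<close> is the second derivative of \<open>- \<epsilon>\<^sup>2 \<chi>(z) cos (z \<bullet> \<zeta> / \<epsilon> + \<alpha>)\<close> in the directions \<open>a\<close>, \<open>b\<close>,
  where \<open>\<chi>\<close> is a \<open>C\<^sup>2\<close> cutoff function; for small \<open>\<epsilon>\<close> it is close to the plane wave times the cutoff.
\<close>

lemma localized_wave:
  fixes c \<zeta> :: "'a::euclidean_space"
  assumes r: "r > 0" and \<tau>: "\<tau> > 0"
  obtains s :: "'a \<Rightarrow> real" and P :: "'a \<Rightarrow> 'a \<Rightarrow> 'a \<Rightarrow> real"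
  where "\<And>a. \<exists>f. C1c f (\<lambda>z. P z a)"
    "\<And>z a b. P z a b = P z b a"
    "\<And>z a b. dist z c \<ge> r \<Longrightarrow> P z a b = 0"
    "\<And>z. dist z c \<ge> r \<Longrightarrow> s z = 0"
    "\<And>z a b. \<bar>P z a b - s z * (\<zeta> \<bullet> a) * (\<zeta> \<bullet> b)\<bar> \<le> \<tau> * norm a * norm b"
    "\<And>z. \<bar>s z\<bar> \<le> 1" "continuous_on UNIV s"
    "(LINT z|lborel. (s z)\<^sup>2) \<ge> measure lborel (ball c r) / (16 * 2 ^ DIM('a))"
proof -
  \<comment> \<open>The 30 is 24 + 6 from the second derivative of the cutoff; the 12 is twice the 6
    of its first derivative, for the two mixed terms. As \<open>\<epsilon> \<le> 1\<close>, the
    error is at most \<open>\<epsilon> * K\<close> times the norms of \<open>a\<close> and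
    \<open>b\<close>.\<close>
  define K where "K = 30 / r\<^sup>2 + 12 * norm \<zeta> / r"
  have K: "K \<ge> 0" using r by (simp add: K_def)
  define \<epsilon> where "\<epsilon> = min 1 (\<tau> / (K + 1))"
  have \<epsilon>: "\<epsilon> > 0" "\<epsilon> \<le> 1" using \<tau> K by (auto simp: \<epsilon>_def)
  have \<epsilon>K: "\<epsilon> * K \<le> \<tau>"
  proof -
    have "\<epsilon> * K \<le> \<tau> / (K + 1) * K" using K by (intro mult_right_mono) (auto simp: \<epsilon>_def)
    also have "\<dots> \<le> \<tau>" using K \<tau> by (simp add: field_simps)
    finally show ?thesis .
  qed
  obtain \<alpha> where \<alpha>: "(LINT z|lborel. (bump c r z ^ 3 * cos (z \<bullet> (\<zeta> /\<^sub>R \<epsilon>) + \<alpha>))\<^sup>2) \<ge> measure lborel (ball c r) / (16 * 2 ^ DIM('a))"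
    by (rule exists_phase[OF r])
  define u where "u = bump c r"
  define co where "co z = cos (z \<bullet> (\<zeta> /\<^sub>R \<epsilon>) + \<alpha>)" for z
  define si where "si z = sin (z \<bullet> (\<zeta> /\<^sub>R \<epsilon>) + \<alpha>)" for z
  \<comment> \<open>\<open>X1\<close> and \<open>X2\<close> are the first and second derivatives of
    the cutoff \<open>u ^ 3\<close>, and \<open>f a\<close> is the derivative of the potential in
    the direction \<open>a\<close>.\<close>
  define X1 where "X1 z h = - (6 / r\<^sup>2) * u z ^ 2 * ((z - c) \<bullet> h)" for z h
  define X2 where "X2 z h k = (24 / r ^ 4) * u z * ((z - c) \<bullet> h) * ((z - c) \<bullet> k) - (6 / r\<^sup>2) * u z ^ 2 * (h \<bullet> k)" for z h k
  define f where "f a z = \<epsilon> * (u z ^ 3 * (\<zeta> \<bullet> a) * si z) - \<epsilon>\<^sup>2 * (X1 z a * co z)" for a z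
  define P where "P z a b = u z ^ 3 * (\<zeta> \<bullet> a) * (\<zeta> \<bullet> b) * co z
      + \<epsilon> * (X1 z b * (\<zeta> \<bullet> a) * si z + X1 z a * (\<zeta> \<bullet> b) * si z) - \<epsilon>\<^sup>2 * (X2 z a b * co z)" for z a b
  have u0: "u z = 0" if "dist z c \<ge> r" for z using bump_zero[OF r that] by (simp add: u_def)
  have d3: "((\<lambda>z. u z ^ 3) has_derivative X1 z) (at z)" for z
    using bump_power_has_derivative[of c r 1 z] unfolding X1_def u_def
    by (simp add: numeral_eq_Suc)
  have d2: "((\<lambda>z. u z ^ 2) has_derivative (\<lambda>h. - (4 / r\<^sup>2) * u z * ((z - c) \<bullet> h))) (at z)" for z
    using bump_power_has_derivative[of c r 0 z] unfolding u_def
    by (simp add: numeral_eq_Suc)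
  have dX1: "((\<lambda>z. X1 z h) has_derivative X2 z h) (at z)" for z h
    unfolding X1_def X2_def
    by (rule derivative_eq_intros d2 refl | simp)+
      (use r in \<open>auto simp: fun_eq_iff field_simps power2_eq_square power4_eq_xxxx inner_commute\<close>)
  have dco: "(co has_derivative (\<lambda>h. - si z * (\<zeta> \<bullet> h) / \<epsilon>)) (at z)" for z
    unfolding co_def si_def using \<epsilon>
    by (auto intro!: derivative_eq_intros simp: inner_commute field_simps)
  have dsi: "(si has_derivative (\<lambda>h. co z * (\<zeta> \<bullet> h) / \<epsilon>)) (at z)" for z
    unfolding co_def si_def using \<epsilon>
    by (auto intro!: derivative_eq_intros simp: inner_commute field_simps)
  have df: "(f a has_derivative P z a) (at z)" for a z
    unfolding f_def P_def
    by (rule derivative_eq_intros d3 dX1 dco dsi refl | simp)+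
      (use \<epsilon> in \<open>auto simp: fun_eq_iff field_simps power2_eq_square\<close>)
  have cu: "continuous_on UNIV u" unfolding u_def by (rule continuous_bump)
  have cc: "continuous_on UNIV co" "continuous_on UNIV si"
    unfolding co_def si_def by (intro continuous_intros)+
  have cP: "continuous_on UNIV (\<lambda>z. P z a b)" for a b
    unfolding P_def X1_def X2_def by (intro continuous_intros cu cc)
  have "f a z = 0" if "norm z > norm c + r" for a z
  proof -
    have "norm z \<le> norm c + dist z c" by (metis add.commute dist_norm norm_triangle_sub)
    then have "u z = 0" using that by (intro u0) linarith
    then show ?thesis by (simp add: f_def X1_def)
  qed
  then have 1: "C1c (f a) (\<lambda>z. P z a)" for a
    using df cP unfolding C1c_def by blast
  have X1b: "\<bar>X1 z h\<bar> \<le> 6 / r * norm h" for z h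
  proof (cases "dist z c \<ge> r")
    case True then show ?thesis using u0 r by (simp add: X1_def)
  next
    case False
    have "\<bar>(z - c) \<bullet> h\<bar> \<le> norm (z - c) * norm h" by (rule Cauchy_Schwarz_ineq2)
    also have "\<dots> \<le> r * norm h" using False by (intro mult_right_mono) (auto simp: dist_norm)
    finally have "u z ^ 2 * \<bar>(z - c) \<bullet> h\<bar> \<le> 1 * (r * norm h)"
      using bump_bounds[of c r z] by (intro mult_mono) (auto simp: u_def power_le_one)
    then have "6 / r\<^sup>2 * (u z ^ 2 * \<bar>(z - c) \<bullet> h\<bar>) \<le> 6 / r\<^sup>2 * (1 * (r * norm h))"
      by (intro mult_left_mono) auto
    then show ?thesis using r by (simp add: X1_def abs_mult power2_eq_square)
  qed
  have X2b: "\<bar>X2 z h k\<bar> \<le> 30 / r\<^sup>2 * (norm h * norm k)" for z h k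
  proof (cases "dist z c \<ge> r")
    case True then show ?thesis using u0 r by (simp add: X2_def)
  next
    case False
    have *: "\<bar>(z - c) \<bullet> h\<bar> \<le> r * norm h" for h
      using Cauchy_Schwarz_ineq2[of "z - c" h] mult_right_mono[of "norm (z - c)" r "norm h"] False
      by (auto simp: dist_norm)
    have "\<bar>u z * ((z - c) \<bullet> h) * ((z - c) \<bullet> k)\<bar> \<le> 1 * (r * norm h) * (r * norm k)"
      unfolding abs_mult using bump_bounds[of c r z] r by (intro mult_mono * ) (auto simp: u_def)
    moreover have "\<bar>u z ^ 2 * (h \<bullet> k)\<bar> \<le> 1 * (norm h * norm k)"
      unfolding abs_mult using bump_bounds[of c r z] Cauchy_Schwarz_ineq2[of h k]
      by (intro mult_mono) (auto simp: u_def power_le_one)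
    ultimately have "24 / r ^ 4 * \<bar>u z * ((z - c) \<bullet> h) * ((z - c) \<bullet> k)\<bar> + 6 / r\<^sup>2 * \<bar>u z ^ 2 * (h \<bullet> k)\<bar>
        \<le> 24 / r ^ 4 * (1 * (r * norm h) * (r * norm k)) + 6 / r\<^sup>2 * (1 * (norm h * norm k))"
      by (intro add_mono mult_left_mono) auto
    also have "\<dots> = 30 / r\<^sup>2 * (norm h * norm k)" using r by (simp add: field_simps power4_eq_xxxx power2_eq_square)
    finally have "24 / r ^ 4 * \<bar>u z * ((z - c) \<bullet> h) * ((z - c) \<bullet> k)\<bar> + 6 / r\<^sup>2 * \<bar>u z ^ 2 * (h \<bullet> k)\<bar> \<le> 30 / r\<^sup>2 * (norm h * norm k)" .
    moreover have "X2 z h k = 24 / r ^ 4 * (u z * ((z - c) \<bullet> h) * ((z - c) \<bullet> k)) - 6 / r\<^sup>2 * (u z ^ 2 * (h \<bullet> k))"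
      by (simp add: X2_def mult.assoc)
    then have "\<bar>X2 z h k\<bar> \<le> \<bar>24 / r ^ 4 * (u z * ((z - c) \<bullet> h) * ((z - c) \<bullet> k))\<bar> + \<bar>6 / r\<^sup>2 * (u z ^ 2 * (h \<bullet> k))\<bar>"
      by (simp only: abs_triangle_ineq4)
    ultimately show ?thesis by (simp only: abs_mult) simp
  qed
  have bc: "\<bar>co z\<bar> \<le> 1" "\<bar>si z\<bar> \<le> 1" for z by (auto simp: co_def si_def)
  have err: "\<bar>P z a b - (u z ^ 3 * co z) * (\<zeta> \<bullet> a) * (\<zeta> \<bullet> b)\<bar> \<le> \<tau> * norm a * norm b" for z a b
  proof -
    have t: "\<bar>X1 z b * (\<zeta> \<bullet> a) * si z\<bar> \<le> 6 * norm \<zeta> / r * (norm a * norm b)" for a b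
    proof -
      have "\<bar>X1 z b * (\<zeta> \<bullet> a) * si z\<bar> \<le> (6 / r * norm b) * (norm \<zeta> * norm a) * 1"
        unfolding abs_mult using r by (intro mult_mono X1b Cauchy_Schwarz_ineq2 bc) auto
      then show ?thesis by (simp add: mult_ac)
    qed
    have t2: "\<bar>X2 z a b * co z\<bar> \<le> 30 / r\<^sup>2 * (norm a * norm b) * 1"
      unfolding abs_mult using r by (intro mult_mono X2b bc) auto
    have "P z a b - (u z ^ 3 * co z) * (\<zeta> \<bullet> a) * (\<zeta> \<bullet> b)
       = \<epsilon> * (X1 z b * (\<zeta> \<bullet> a) * si z + X1 z a * (\<zeta> \<bullet> b) * si z - \<epsilon> * (X2 z a b * co z))"
      unfolding P_def by (simp add: algebra_simps power2_eq_square)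
    also have "\<bar>\<dots>\<bar> = \<epsilon> * \<bar>X1 z b * (\<zeta> \<bullet> a) * si z + X1 z a * (\<zeta> \<bullet> b) * si z - \<epsilon> * (X2 z a b * co z)\<bar>"
      using \<epsilon> by (simp add: abs_mult)
    also have "\<dots> \<le> \<epsilon> * (6 * norm \<zeta> / r * (norm a * norm b) + 6 * norm \<zeta> / r * (norm b * norm a) + 30 / r\<^sup>2 * (norm a * norm b))"
    proof (intro mult_left_mono)
      have "\<bar>\<epsilon> * (X2 z a b * co z)\<bar> \<le> 1 * (30 / r\<^sup>2 * (norm a * norm b) * 1)"
        unfolding abs_mult[of \<epsilon>] using \<epsilon> t2 by (intro mult_mono) auto
      then show "\<bar>X1 z b * (\<zeta> \<bullet> a) * si z + X1 z a * (\<zeta> \<bullet> b) * si z - \<epsilon> * (X2 z a b * co z)\<bar>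
        \<le> 6 * norm \<zeta> / r * (norm a * norm b) + 6 * norm \<zeta> / r * (norm b * norm a) + 30 / r\<^sup>2 * (norm a * norm b)"
        using t[of b a] t[of a b] by linarith
    qed (use \<epsilon> in simp)
    also have "\<dots> = (\<epsilon> * K) * (norm a * norm b)" unfolding K_def by (simp add: algebra_simps)
    also have "\<dots> \<le> \<tau> * (norm a * norm b)" using \<epsilon>K by (intro mult_right_mono) auto
    finally show ?thesis by (simp add: mult.assoc)
  qed
  show ?thesis
  proof (rule that[of P "\<lambda>z. u z ^ 3 * co z"])
    show "P z a b = P z b a" for z a b unfolding P_def X2_def by (simp add: inner_commute algebra_simps)
    show "\<bar>u z ^ 3 * co z\<bar> \<le> 1" for z
      unfolding abs_mult using bump_bounds[of c r z] bc
      by (intro mult_le_one) (auto simp: u_def power_le_one)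
    show "continuous_on UNIV (\<lambda>z. u z ^ 3 * co z)" by (intro continuous_intros cu cc)
  qed (use 1 u0 err \<alpha> in \<open>auto simp: P_def X1_def X2_def u_def co_def\<close>)
qed

section \<open>The relaxed constraint\<close>

definition outer :: "real^'n \<Rightarrow> real^'n \<Rightarrow> real^'n^'n" where
  "outer a b = (\<chi> i j. a $ i * b $ j)"

lemma outer_row: "outer a b $ i = a $ i *\<^sub>R b"
  by (simp add: outer_def vec_eq_iff)

lemma trace_outer: "trace (outer a b) = a \<bullet> b"
  by (simp add: trace_def outer_def inner_vec_def)

lemma norm_outer: "norm (outer a b) = norm a * norm b"
  unfolding norm_vec_def[of "outer a b"] outer_row norm_scaleR
  by (simp add: L2_set_left_distrib[symmetric] norm_vec_def[of a])

lemma inner_outer: "s \<bullet> outer x y = (\<Sum>i\<in>UNIV. x $ i * (s $ i \<bullet> y))"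
  by (simp add: inner_vec_def[of s] outer_row)

lemma outer_inner_outer: "outer a b \<bullet> outer x y = (a \<bullet> x) * (b \<bullet> y)"
  by (simp add: inner_outer outer_row inner_vec_def[of a] sum_distrib_left sum_distrib_right mult_ac)

lemma trace_scaleR: "trace (c *\<^sub>R A) = c * trace (A :: real^'n^'n)"
  by (simp add: trace_def sum_distrib_left)

lemma abs_trace_le: "\<bar>trace (A :: real^'n^'n)\<bar> \<le> real CARD('n) * norm A"
proof -
  have "\<bar>A $ i $ i\<bar> \<le> norm A" for i
    using component_le_norm_cart[of "A $ i" i] Finite_Cartesian_Product.norm_nth_le[of A i] by simp
  then have "(\<Sum>i\<in>UNIV. \<bar>A $ i $ i\<bar>) \<le> (\<Sum>i\<in>(UNIV::'n set). norm A)" by (intro sum_mono)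
  then show ?thesis unfolding trace_def by (intro order_trans[OF sum_abs]) simp
qed

text \<open>
  The quadratic form of \<open>I/n - v \<otimes> v + s - (tr s / n) I\<close>, whose trace is \<open>1 - |v|\<^sup>2\<close>. A positive definite
  form is a strict subsolution; a form that vanishes identically solves the Euler equations
  with pressure \<open>tr s / n - 1/n\<close>.
\<close>

definition gap :: "real^'n \<Rightarrow> real^'n^'n \<Rightarrow> real^'n \<Rightarrow> real" where
  "gap v s x = (x \<bullet> x) / real CARD('n) - (v \<bullet> x)\<^sup>2 + s \<bullet> outer x x - trace s / real CARD('n) * (x \<bullet> x)"

text \<open>For symmetric \<open>s\<close>, row \<open>i\<close> of the matrix of
  \<open>gap\<close>. Read backwards: \<open>s $ i\<close> is this row plus \<open>v $ i\<close>
  times \<open>v\<close> plus \<open>(trace s - 1) / n\<close> times the unit vector, so the row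
  measures how far \<open>s\<close> is from an Euler flux.\<close>

definition gap_row :: "real^'n \<Rightarrow> real^'n^'n \<Rightarrow> 'n \<Rightarrow> real^'n" where
  "gap_row v s i = ((1 - trace s) / real CARD('n)) *\<^sub>R axis i 1 - (v $ i) *\<^sub>R v + s $ i"

definition symmetric :: "real^'n^'n \<Rightarrow> bool" where
  "symmetric s \<longleftrightarrow> (\<forall>i j. s $ i $ j = s $ j $ i)"

lemma gap_row_nth:
  "gap_row v s i $ j = (if i = j then (1 - trace s) / real CARD('n) else 0) - v $ i * v $ j + s $ i $ j"
  for v :: "real^'n"
  by (simp add: gap_row_def axis_def)

lemma gap_axis: "gap v s (axis i 1) = gap_row v s i $ i" for v :: "real^'n"
proof -
  have "s \<bullet> outer (axis i 1) (axis i 1) = (\<Sum>k\<in>UNIV. if k = i then s $ k $ i else 0)"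
    unfolding inner_outer by (intro sum.cong) (auto simp: axis_def inner_axis[unfolded axis_def])
  then show ?thesis
    by (simp add: gap_def gap_row_nth inner_axis inner_axis_axis diff_divide_distrib power2_eq_square)
qed

text \<open>Polarization: for symmetric \<open>s\<close> the two cross terms agree, and the row
  represents the bilinear form of \<open>gap\<close> with \<open>axis i 1\<close> in one
  slot.\<close>

lemma gap_add_axis:
  fixes v :: "real^'n"
  assumes "symmetric s"
  shows "gap v s (x + t *\<^sub>R axis i 1) = gap v s x + 2 * t * (gap_row v s i \<bullet> x) + t\<^sup>2 * gap v s (axis i 1)"
proof -
  let ?e = "axis i 1 :: real^'n"
  have 1: "s \<bullet> outer ?e x = s $ i \<bullet> x"
  proof -
    have "s \<bullet> outer ?e x = (\<Sum>k\<in>UNIV. if k = i then s $ k \<bullet> x else 0)"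
      unfolding inner_outer by (intro sum.cong) (auto simp: axis_def)
    then show ?thesis by simp
  qed
  have 2: "s \<bullet> outer x ?e = s $ i \<bullet> x"
    unfolding inner_outer inner_axis using assms
    by (simp add: symmetric_def inner_vec_def[of "s $ i"] mult.commute)
  have 3: "outer (x + t *\<^sub>R ?e) (x + t *\<^sub>R ?e) = outer x x + t *\<^sub>R outer ?e x + t *\<^sub>R outer x ?e + t\<^sup>2 *\<^sub>R outer ?e ?e"
    by (simp add: outer_def vec_eq_iff algebra_simps power2_eq_square)
  have 4: "gap_row v s i \<bullet> x = (1 - trace s) / real CARD('n) * (x $ i) - v $ i * (v \<bullet> x) + s $ i \<bullet> x"
    by (simp add: gap_row_def inner_add_left inner_diff_left inner_axis' )
  have 5: "(x + t *\<^sub>R ?e) \<bullet> (x + t *\<^sub>R ?e) = x \<bullet> x + 2 * t * x $ i + t\<^sup>2" "?e \<bullet> ?e = 1"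
    by (simp_all add: inner_add_left inner_add_right inner_axis inner_axis' inner_axis_axis power2_eq_square distrib_left)
  have 6: "v \<bullet> (x + t *\<^sub>R ?e) = v \<bullet> x + t * v $ i" "v \<bullet> ?e = v $ i"
    by (simp_all add: inner_add_right inner_axis)
  show ?thesis
    unfolding gap_def 3 4 5 6 inner_add_right inner_scaleR_right 1 2
    by (simp add: inner_axis inner_axis' diff_divide_distrib add_divide_distrib algebra_simps power2_eq_square)
qed

lemma gap_cauchy_schwarz:
  fixes v :: "real^'n"
  assumes "symmetric s" "\<And>x. gap v s x \<ge> 0" "gap v s (axis i 1) > 0"
  shows "(gap_row v s i \<bullet> x)\<^sup>2 \<le> gap v s (axis i 1) * gap v s x"
proof -
  let ?l = "gap v s (axis i 1)" and ?b = "gap_row v s i \<bullet> x"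
  \<comment> \<open>\<open>- ?b / ?l\<close> minimizes the quadratic polynomial in \<open>t\<close>
    of \<open>gap_add_axis\<close>; nonnegativity of its minimum is the claim.\<close>
  have "0 \<le> gap v s x + 2 * (- ?b / ?l) * ?b + (- ?b / ?l)\<^sup>2 * ?l"
    using assms(2)[of "x + (- ?b / ?l) *\<^sub>R axis i 1"] unfolding gap_add_axis[OF assms(1)] .
  also have "\<dots> = gap v s x - ?b\<^sup>2 / ?l" using assms(3) by (simp add: field_simps power2_eq_square)
  finally show ?thesis using assms(3) by (simp add: field_simps)
qed

lemma sum_gap_axis: "(\<Sum>i\<in>UNIV. gap v s (axis i 1)) = 1 - (norm v)\<^sup>2" for v :: "real^'n"
proof -
  have "(\<Sum>i\<in>UNIV. gap v s (axis i 1)) = (\<Sum>i\<in>(UNIV::'n set). (1 - trace s) / real CARD('n)) - v \<bullet> v + trace s"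
    unfolding gap_axis gap_row_nth trace_def inner_vec_def by (simp add: sum.distrib sum_subtractf)
  then show ?thesis by (simp add: power2_norm_eq_inner)
qed

lemma gap_norm_le:
  fixes v :: "real^'n"
  assumes "\<And>x. gap v s x \<ge> 0" shows "norm v \<le> 1"
proof -
  have "(norm v)\<^sup>2 \<le> 1" using sum_gap_axis[of v s] sum_nonneg[of UNIV "\<lambda>i. gap v s (axis i 1)"] assms by simp
  then show ?thesis by (simp add: abs_square_le_1)
qed

text \<open>Cauchy-Schwarz bounds each squared entry of the row by a product of two diagonal
  entries. The first is at most 1, the second sums to the trace. This forces the rows to vanish as
  \<open>norm v\<close> tends to 1.\<close>

lemma gap_row_norm_le:
  fixes v :: "real^'n"
  assumes s: "symmetric s" and \<gamma>: "\<gamma> > 0" "\<And>x. gap v s x \<ge> \<gamma> * (x \<bullet> x)"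
  shows "(norm (gap_row v s i))\<^sup>2 \<le> 1 - (norm v)\<^sup>2"
proof -
  have g0: "gap v s x \<ge> 0" for x using \<gamma> by (meson inner_ge_zero less_imp_le mult_nonneg_nonneg order_trans)
  have ge: "gap v s (axis i 1) > 0" using \<gamma>(2)[of "axis i 1"] \<gamma>(1) by (simp add: inner_axis_axis)
  let ?l = "gap v s (axis i 1)" and ?w = "gap_row v s i"
  have tot: "(\<Sum>j\<in>UNIV. gap v s (axis j 1)) \<le> 1" by (simp add: sum_gap_axis)
  then have l1: "?l \<le> 1" using member_le_sum[of i UNIV "\<lambda>i. gap v s (axis i 1)"] g0 by (auto intro: order_trans)
  have "(?w $ j)\<^sup>2 \<le> 1 * gap v s (axis j 1)" for j
  proof -
    have "(?w $ j)\<^sup>2 \<le> ?l * gap v s (axis j 1)"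
      using gap_cauchy_schwarz[OF s g0 ge, of "axis j 1"] by (simp add: inner_axis)
    also have "\<dots> \<le> 1 * gap v s (axis j 1)" using l1 g0 by (intro mult_right_mono)
    finally show ?thesis .
  qed
  then have "(\<Sum>j\<in>UNIV. (?w $ j)\<^sup>2) \<le> (\<Sum>j\<in>UNIV. gap v s (axis j 1))" by (intro sum_mono) simp
  also have "(\<Sum>j\<in>UNIV. (?w $ j)\<^sup>2) = (norm ?w)\<^sup>2"
    unfolding power2_norm_eq_inner inner_vec_def by (simp add: power2_eq_square)
  finally show ?thesis by (simp add: sum_gap_axis)
qed

text \<open>The added matrix has trace \<open>2 * t * (m \<bullet> d) = 0\<close>, so the trace term
  of \<open>gap\<close> does not move.\<close>

lemma gap_perturb:
  fixes v :: "real^'n"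
  assumes "m \<bullet> d = 0"
  shows "gap (v + t *\<^sub>R d) (s + t *\<^sub>R (outer m d + outer d m)) x
     = gap v s x - t\<^sup>2 * (d \<bullet> x)\<^sup>2 + 2 * t * ((m - v) \<bullet> x) * (d \<bullet> x)"
  using assms unfolding gap_def
  by (simp add: inner_add_left inner_diff_left outer_inner_outer trace_add trace_scaleR trace_outer
      inner_commute[of d m] algebra_simps power2_eq_square)

text \<open>\<open>norm (s' - s)\<close> is counted twice, once for the matrix term and once for the
  trace, where the factor \<open>CARD('n)\<close> of \<open>abs_trace_le\<close> cancels. This is
  how errors small against \<open>\<gamma>\<close> are absorbed.\<close>

lemma gap_lipschitz:
  fixes v :: "real^'n"
  shows "gap v' s' x \<ge> gap v s x - (norm (v' - v) * (norm v + norm v') + 2 * norm (s' - s)) * (x \<bullet> x)"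
proof -
  have xx: "norm x * norm x = x \<bullet> x" by (metis power2_norm_eq_inner power2_eq_square)
  have n: "real CARD('n) > 0" by simp
  have "(v' \<bullet> x)\<^sup>2 - (v \<bullet> x)\<^sup>2 = ((v' - v) \<bullet> x) * ((v + v') \<bullet> x)"
    by (simp add: algebra_simps inner_add_left inner_diff_left power2_eq_square)
  also have "\<dots> \<le> \<bar>(v' - v) \<bullet> x\<bar> * \<bar>(v + v') \<bullet> x\<bar>" by (metis abs_ge_self abs_mult)
  also have "\<dots> \<le> (norm (v' - v) * norm x) * (norm (v + v') * norm x)"
    by (intro mult_mono Cauchy_Schwarz_ineq2) auto
  also have "\<dots> \<le> (norm (v' - v) * norm x) * ((norm v + norm v') * norm x)"
    by (intro mult_left_mono mult_right_mono norm_triangle_ineq) auto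
  finally have 1: "(v' \<bullet> x)\<^sup>2 - (v \<bullet> x)\<^sup>2 \<le> norm (v' - v) * (norm v + norm v') * (x \<bullet> x)"
    by (simp add: xx[symmetric] mult_ac)
  have "\<bar>(s' - s) \<bullet> outer x x\<bar> \<le> norm (s' - s) * (x \<bullet> x)"
    using Cauchy_Schwarz_ineq2[of "s' - s" "outer x x"] by (simp add: norm_outer xx)
  then have 2: "s' \<bullet> outer x x - s \<bullet> outer x x \<ge> - (norm (s' - s) * (x \<bullet> x))"
    by (simp add: inner_diff_left)
  have "\<bar>trace s' - trace s\<bar> \<le> real CARD('n) * norm (s' - s)"
    using abs_trace_le[of "s' - s"] by (simp add: trace_sub)
  then have "(trace s' - trace s) / real CARD('n) \<le> norm (s' - s)" using n by (simp add: field_simps)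
  then have 3: "(trace s' - trace s) / real CARD('n) * (x \<bullet> x) \<le> norm (s' - s) * (x \<bullet> x)"
    by (intro mult_right_mono) auto
  show ?thesis unfolding gap_def using 1 2 3 by (simp add: algebra_simps diff_divide_distrib)
qed

text \<open>
  With \<open>w\<close> a row of the matrix \<open>M\<close> of the form, Cauchy-Schwarz gives \<open>M \<ge> w \<otimes> w / M\<^sub>i\<^sub>i\<close>. As \<open>m\<close> is the projection of \<open>v\<close>
  orthogonal to \<open>d = w/4\<close>, moving along \<open>(d, m \<otimes> d + d \<otimes> m)\<close> changes \<open>M\<close> only by a multiple of \<open>w \<otimes> w\<close>.
\<close>

lemma gap_direction:
  fixes v :: "real^'n"
  assumes s: "symmetric s" and \<gamma>: "\<gamma> > 0" and g: "\<And>x. gap v s x \<ge> \<gamma> * (x \<bullet> x)"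
  obtains m d where "m \<bullet> d = 0" "norm d \<le> 1/4" "d \<noteq> 0" "norm m \<le> norm v"
    "(1 - (norm v)\<^sup>2) \<le> 4 * real CARD('n) * norm d"
    "\<And>t x. \<bar>t\<bar> \<le> 1 \<Longrightarrow> gap (v + t *\<^sub>R d) (s + t *\<^sub>R (outer m d + outer d m)) x \<ge> (7/16) * \<gamma> * (x \<bullet> x)"
proof -
  let ?e = "\<lambda>i. axis i 1 :: real^'n"
  have g0: "gap v s x \<ge> 0" for x using g[of x] \<gamma> by (simp add: order_trans[OF _ g[of x]])
  have ge: "gap v s (?e i) > 0" for i using g[of "?e i"] \<gamma> by (simp add: inner_axis_axis)
  have tot: "(\<Sum>i\<in>UNIV. gap v s (?e i)) \<le> 1" by (simp add: sum_gap_axis)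
  have nv: "norm v \<le> 1" by (rule gap_norm_le[OF g0])
  \<comment> \<open>The diagonal entries have mean \<open>(1 - |v|^2) / n\<close>, so one of them
    reaches it; its row gives the direction of motion.\<close>
  obtain i where i: "(1 - (norm v)\<^sup>2) / real CARD('n) \<le> gap v s (?e i)"
  proof (rule ccontr)
    assume "\<not> thesis"
    then have "gap v s (?e i) < (1 - (norm v)\<^sup>2) / real CARD('n)" for i using that not_le by blast
    then have "(\<Sum>i\<in>UNIV. gap v s (?e i)) < (\<Sum>i\<in>(UNIV::'n set). (1 - (norm v)\<^sup>2) / real CARD('n))"
      by (intro sum_strict_mono) auto
    then show False by (simp add: sum_gap_axis)
  qed
  define l where "l = gap v s (?e i)"
  define w where "w = gap_row v s i"
  have l: "l > 0" "l \<le> 1"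
    using ge member_le_sum[of i UNIV "\<lambda>i. gap v s (?e i)"] g0 tot by (auto simp: l_def intro: order_trans)
  have cs: "(w \<bullet> x)\<^sup>2 \<le> l * gap v s x" for x
    unfolding w_def l_def by (rule gap_cauchy_schwarz[OF s g0 ge])
  have "(norm w)\<^sup>2 \<le> 1 - (norm v)\<^sup>2" unfolding w_def by (rule gap_row_norm_le[OF s \<gamma> g])
  then have "(norm w)\<^sup>2 \<le> 1" using zero_le_power2[of "norm v"] by linarith
  then have nw: "norm w \<le> 1" by (simp add: abs_square_le_1)
  have wl: "l \<le> norm w" using component_le_norm_cart[of w i] by (simp add: w_def l_def gap_axis)
  then have w0: "w \<noteq> 0" using l by auto
  \<comment> \<open>The factor 1/4 makes the loss at most
    \<open>(l + 2 * |\<mu>| * l) / 16 \<le> 9/16\<close> of the gap, since \<open>l \<le> 1\<close>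
    and \<open>|\<mu>| * l \<le> 4\<close>; this leaves the 7/16 of the conclusion.\<close>
  define d where "d = (1/4) *\<^sub>R w"
  have d0: "d \<noteq> 0" using w0 by (simp add: d_def)
  define \<mu> where "\<mu> = (v \<bullet> d) / (d \<bullet> d)"
  define m where "m = v - \<mu> *\<^sub>R d"
  have md: "m \<bullet> d = 0" using d0 by (simp add: m_def \<mu>_def inner_diff_left)
  \<comment> \<open>The coefficient \<open>\<mu>\<close> may be large, as \<open>d\<close> can be
    tiny. Only its product with \<open>l\<close> matters: \<open>|\<mu>| \<le> 1 / norm d\<close>,
    while \<open>l\<close> is a component of \<open>w = 4 d\<close>.\<close>
  have \<mu>: "\<bar>\<mu>\<bar> * l \<le> 4"
  proof -
    have "\<bar>v \<bullet> d\<bar> \<le> 1 * norm d" using Cauchy_Schwarz_ineq2[of v d] nv mult_right_mono[of "norm v" 1 "norm d"] by auto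
    then have "\<bar>\<mu>\<bar> * (norm d)\<^sup>2 \<le> norm d" using d0 by (simp add: \<mu>_def power2_norm_eq_inner abs_mult)
    then have "\<bar>\<mu>\<bar> * norm d \<le> 1" using d0 by (simp add: power2_eq_square)
    moreover have "l \<le> 4 * norm d" using wl by (simp add: d_def)
    then have "\<bar>\<mu>\<bar> * l \<le> \<bar>\<mu>\<bar> * (4 * norm d)" by (intro mult_left_mono) auto
    ultimately show ?thesis by linarith
  qed
  show ?thesis
  proof (rule that[OF md])
    show "norm d \<le> 1/4" using nw by (simp add: d_def)
    show "d \<noteq> 0" by (rule d0)
    show "norm m \<le> norm v"
    proof -
      have "(norm m)\<^sup>2 = v \<bullet> m" using md unfolding power2_norm_eq_inner
        by (metis add_0_right diff_add_cancel inner_add_left inner_commute inner_scaleR_left m_def mult_zero_right)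
      also have "\<dots> \<le> norm v * norm m" by (rule norm_cauchy_schwarz)
      finally show ?thesis by (cases "m = 0") (auto simp: power2_eq_square)
    qed
    show "(1 - (norm v)\<^sup>2) \<le> 4 * real CARD('n) * norm d"
    proof -
      have "1 - (norm v)\<^sup>2 \<le> l * real CARD('n)" using i by (simp add: l_def field_simps)
      also have "\<dots> \<le> norm w * real CARD('n)" using wl by (intro mult_right_mono) auto
      finally show ?thesis by (simp add: d_def mult.commute)
    qed
    fix t :: real and x assume t: "\<bar>t\<bar> \<le> 1"
    have eq: "gap (v + t *\<^sub>R d) (s + t *\<^sub>R (outer m d + outer d m)) x = gap v s x - (t\<^sup>2 + 2 * t * \<mu>) * (d \<bullet> x)\<^sup>2"
      unfolding gap_perturb[OF md] by (simp add: m_def inner_diff_left algebra_simps power2_eq_square)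
    have "(t\<^sup>2 + 2 * t * \<mu>) * (d \<bullet> x)\<^sup>2 \<le> (1 + 2 * \<bar>\<mu>\<bar>) * (d \<bullet> x)\<^sup>2"
    proof (intro mult_right_mono add_mono)
      show "t\<^sup>2 \<le> 1" using t by (simp add: abs_square_le_1)
      have "t * \<mu> \<le> \<bar>t\<bar> * \<bar>\<mu>\<bar>" by (metis abs_ge_self abs_mult)
      also have "\<dots> \<le> 1 * \<bar>\<mu>\<bar>" using t by (intro mult_right_mono) auto
      finally show "2 * t * \<mu> \<le> 2 * \<bar>\<mu>\<bar>" by simp
    qed auto
    also have "\<dots> = (1 + 2 * \<bar>\<mu>\<bar>) / 16 * (w \<bullet> x)\<^sup>2" by (simp add: d_def power_mult_distrib power2_eq_square)
    also have "\<dots> \<le> (1 + 2 * \<bar>\<mu>\<bar>) / 16 * (l * gap v s x)" by (intro mult_left_mono cs) auto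
    also have "\<dots> = (l + 2 * (\<bar>\<mu>\<bar> * l)) / 16 * gap v s x" by (simp add: algebra_simps)
    also have "\<dots> \<le> 9/16 * gap v s x" using l \<mu> by (intro mult_right_mono g0) auto
    finally have "gap (v + t *\<^sub>R d) (s + t *\<^sub>R (outer m d + outer d m)) x \<ge> 7/16 * gap v s x"
      unfolding eq by linarith
    then show "gap (v + t *\<^sub>R d) (s + t *\<^sub>R (outer m d + outer d m)) x \<ge> (7/16) * \<gamma> * (x \<bullet> x)"
      using g[of x] by linarith
  qed
qed


text \<open>
  The shear wave with profile \<open>d\<close> depends on \<open>\<eta> \<bullet> (x - m t)\<close> for a unit vector \<open>\<eta>\<close> orthogonal to \<open>d\<close>, so \<open>D = (m, 1)\<close> annihilates
  its phase. Both \<open>(V, 0)\<close> and the rows \<open>(S\<^sub>i, V\<^sub>i)\<close> are combinations of the divergence-free fields of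
  \<open>weak_divfree_curl\<close>; \<open>S\<close> is \<open>m \<otimes> V + V \<otimes> m\<close> up to terms containing a derivative along \<open>D\<close>, which are small.
\<close>

lemma building_block:
  fixes c :: "(real^'n) \<times> real" and v :: "real^'n"
  assumes n: "CARD('n) \<ge> 2" and s: "symmetric s" and \<gamma>: "\<gamma> > 0"
    and g: "\<And>x. gap v s x \<ge> \<gamma> * (x \<bullet> x)" and r: "r > 0" and \<tau>: "0 < \<tau>" "\<tau> \<le> 1"
  obtains V :: "(real^'n) \<times> real \<Rightarrow> real^'n" and S :: "(real^'n) \<times> real \<Rightarrow> real^'n^'n"
  where "continuous_on UNIV V" "continuous_on UNIV S"
    "\<And>z. dist z c \<ge> r \<Longrightarrow> V z = 0" "\<And>z. dist z c \<ge> r \<Longrightarrow> S z = 0"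
    "\<And>z. symmetric (S z)" "weak_divfree (\<lambda>z. (V z, 0))" "\<And>i. weak_divfree (\<lambda>z. (S z $ i, V z $ i))"
    "\<And>a. (LINT z|lborel. a \<bullet> V z) = 0" "\<And>z. \<bar>trace (S z)\<bar> \<le> \<tau>" "\<And>z. norm (V z) \<le> 2"
    "\<And>z. \<exists>v' s'. norm (v + V z - v') \<le> \<tau> \<and> norm (s + S z - s') \<le> \<tau> \<and> norm v' \<le> 2
        \<and> (\<forall>x. gap v' s' x \<ge> (7/16) * \<gamma> * (x \<bullet> x))"
    "measure lborel (ball c r) * (1 - (norm v)\<^sup>2)\<^sup>2
      \<le> 512 * (real CARD('n))\<^sup>2 * 2 ^ DIM((real^'n) \<times> real)
          * ((LINT z|lborel. (norm (V z))\<^sup>2) + \<tau>\<^sup>2 * measure lborel (ball c r))"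
proof -
  obtain m d where md: "m \<bullet> d = 0" and d: "norm d \<le> 1/4" "d \<noteq> 0" and mv: "norm m \<le> norm v"
    and dl: "(1 - (norm v)\<^sup>2) \<le> 4 * real CARD('n) * norm d"
    and gp: "\<And>t x. \<bar>t\<bar> \<le> 1 \<Longrightarrow> gap (v + t *\<^sub>R d) (s + t *\<^sub>R (outer m d + outer d m)) x \<ge> (7/16) * \<gamma> * (x \<bullet> x)"
    by (rule gap_direction[OF s \<gamma> g]) (rule that; blast)
  have ge0: "gap v s x \<ge> 0" for x using g[of x] \<gamma> by (simp add: order_trans[OF _ g[of x]])
  have nv: "norm v \<le> 1" by (rule gap_norm_le[OF ge0])
  then have nv2: "(norm v)\<^sup>2 \<le> 1" by (simp add: abs_square_le_1)
  have nm: "norm m \<le> 1" using mv nv by simp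
  \<comment> \<open>Dimension at least two provides a direction orthogonal to \<open>d\<close>; the
    wave varies along it and points along \<open>d\<close>.\<close>
  obtain y where y: "y \<noteq> 0" "orthogonal d y"
    using orthogonal_to_vector_exists[of d] n by auto
  define \<eta> where "\<eta> = (1 / norm y) *\<^sub>R y"
  have \<eta>: "norm \<eta> = 1" "d \<bullet> \<eta> = 0" "\<eta> \<bullet> \<eta> = 1"
    using y by (auto simp: \<eta>_def orthogonal_def power2_norm_eq_inner[symmetric])
  define h where "h = (\<eta>, 0::real)"
  define e where "e = (d, 0::real)"
  define D where "D = (m, 1::real)"
  \<comment> \<open>\<open>\<zeta>\<close> takes the values 1, 0, 0 on \<open>h\<close>,
    \<open>e\<close>, \<open>D\<close>. So \<open>P z h h\<close> is the wave up to a small error,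
    and all other entries of \<open>P\<close> on these vectors are small.\<close>
  define \<zeta> where "\<zeta> = (\<eta>, - (m \<bullet> \<eta>))"
  have \<zeta>: "\<zeta> \<bullet> h = 1" "\<zeta> \<bullet> e = 0" "\<zeta> \<bullet> D = 0"
    using \<eta> by (simp_all add: \<zeta>_def h_def e_def D_def inner_Pair inner_commute)
  have nrm: "norm h = 1" "norm e = norm d" "norm D \<le> 2"
    using \<eta> nm norm_Pair_le[of m "1::real"] by (simp_all add: h_def e_def D_def norm_Pair)
  \<comment> \<open>With precision \<open>\<tau>/8\<close> the accumulated errors of
    \<open>V\<close>, of \<open>S\<close> and of the trace each stay below
    \<open>\<tau>\<close>.\<close>
  have \<tau>8: "\<tau>/8 > 0" using \<tau> by simp
  obtain \<sigma> P where P: "\<And>a. \<exists>f. C1c f (\<lambda>z. P z a)"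
    "\<And>z a b. P z a b = P z b a"
    "\<And>z a b. dist z c \<ge> r \<Longrightarrow> P z a b = 0"
    "\<And>z. dist z c \<ge> r \<Longrightarrow> \<sigma> z = 0"
    "\<And>z a b. \<bar>P z a b - \<sigma> z * (\<zeta> \<bullet> a) * (\<zeta> \<bullet> b)\<bar> \<le> \<tau>/8 * norm a * norm b"
    and \<sigma>: "\<And>z. \<bar>\<sigma> z\<bar> \<le> 1" "continuous_on UNIV \<sigma>"
    "(LINT z|lborel. (\<sigma> z)\<^sup>2) \<ge> measure lborel (ball c r) / (16 * 2 ^ DIM((real^'n) \<times> real))"
    apply (rule localized_wave[OF r \<tau>8, where c = c and \<zeta> = \<zeta>])
    subgoal for s P by (rule that[of P s]; blast)
    done
  define V where "V z = P z h h *\<^sub>R d - P z e h *\<^sub>R \<eta>" for z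
  define S where "S z = P z h h *\<^sub>R (outer m d + outer d m) - P z e h *\<^sub>R (outer m \<eta> + outer \<eta> m)
     - P z D h *\<^sub>R (outer d \<eta> + outer \<eta> d) + (2 * P z e D) *\<^sub>R outer \<eta> \<eta>" for z
  have cP: "continuous_on UNIV (\<lambda>z. P z a b)" for a b
    using P(1)[of a] C1c_deriv_continuous by blast
  have e1: "\<bar>P z h h - \<sigma> z\<bar> \<le> \<tau>/8" for z using P(5)[of z h h] \<zeta> nrm by simp
  have e2: "\<bar>P z e h\<bar> \<le> \<tau>/8" for z
  proof -
    have "\<bar>P z e h\<bar> \<le> \<tau>/8 * norm d" using P(5)[of z e h] \<zeta> nrm by simp
    also have "\<dots> \<le> \<tau>/8 * 1" using \<tau> d by (intro mult_left_mono) auto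
    finally show ?thesis by simp
  qed
  have e3: "\<bar>P z D h\<bar> \<le> \<tau>/4" for z
  proof -
    have "\<bar>P z D h\<bar> \<le> \<tau>/8 * norm D" using P(5)[of z D h] \<zeta> nrm by simp
    also have "\<dots> \<le> \<tau>/8 * 2" using \<tau> nrm by (intro mult_left_mono) auto
    finally show ?thesis by simp
  qed
  have e4: "\<bar>P z e D\<bar> \<le> \<tau>/16" for z
  proof -
    have "\<bar>P z e D\<bar> \<le> \<tau>/8 * (norm d * norm D)" using P(5)[of z e D] \<zeta> nrm by (simp add: mult.assoc)
    also have "\<dots> \<le> \<tau>/8 * (1/4 * 2)" using \<tau> nrm d by (intro mult_left_mono mult_mono) auto
    finally show ?thesis by simp
  qed
  have errV: "norm (V z - \<sigma> z *\<^sub>R d) \<le> \<tau>/4" for z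
  proof -
    have "V z - \<sigma> z *\<^sub>R d = (P z h h - \<sigma> z) *\<^sub>R d - P z e h *\<^sub>R \<eta>" by (simp add: V_def algebra_simps)
    also have "norm \<dots> \<le> \<bar>P z h h - \<sigma> z\<bar> * norm d + \<bar>P z e h\<bar>"
      using norm_triangle_ineq4[of "(P z h h - \<sigma> z) *\<^sub>R d" "P z e h *\<^sub>R \<eta>"] \<eta> by simp
    also have "\<dots> \<le> \<tau>/8 * 1 + \<tau>/8" using e1[of z] e2[of z] d \<tau> by (intro add_mono mult_mono) auto
    finally show ?thesis by simp
  qed
  have nV: "norm (V z) \<le> 2" for z
  proof -
    have "norm (V z) \<le> norm (V z - \<sigma> z *\<^sub>R d) + norm (\<sigma> z *\<^sub>R d)" by (metis add.commute norm_triangle_sub)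
    also have "\<dots> \<le> \<tau>/4 + 1 * (1/4)" unfolding norm_scaleR using errV \<sigma> d by (intro add_mono mult_mono) auto
    finally show ?thesis using \<tau> by simp
  qed
  have no: "norm (outer a b + outer b a) \<le> 2 * (norm a * norm b)" for a b :: "real^'n"
    using norm_triangle_ineq[of "outer a b" "outer b a"] by (simp add: norm_outer mult.commute)
  have errS: "norm (S z - \<sigma> z *\<^sub>R (outer m d + outer d m)) \<le> \<tau>" for z
  proof -
    have "S z - \<sigma> z *\<^sub>R (outer m d + outer d m) = (P z h h - \<sigma> z) *\<^sub>R (outer m d + outer d m)
       - P z e h *\<^sub>R (outer m \<eta> + outer \<eta> m) - P z D h *\<^sub>R (outer d \<eta> + outer \<eta> d) + (2 * P z e D) *\<^sub>R outer \<eta> \<eta>"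
      (is "_ = ?A - ?B - ?C + ?E") by (simp add: S_def algebra_simps)
    moreover have "norm (?A - ?B - ?C + ?E) \<le> norm ?A + norm ?B + norm ?C + norm ?E"
      using norm_triangle_ineq[of "?A - ?B - ?C" ?E] norm_triangle_ineq4[of "?A - ?B" ?C] norm_triangle_ineq4[of ?A ?B]
      by linarith
    moreover have "norm ?A \<le> \<tau>/8 * (2 * (1 * (1/4)))"
      unfolding norm_scaleR using e1[of z] nm d \<tau> by (intro mult_mono order_trans[OF no]) auto
    moreover have "norm ?B \<le> \<tau>/8 * (2 * (1 * 1))"
      unfolding norm_scaleR using e2[of z] nm \<eta> \<tau> by (intro mult_mono order_trans[OF no]) auto
    moreover have "norm ?C \<le> \<tau>/4 * (2 * ((1/4) * 1))"
      unfolding norm_scaleR using e3[of z] d \<eta> \<tau> by (intro mult_mono order_trans[OF no]) auto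
    moreover have "norm ?E \<le> 2 * (\<tau>/16)"
      using e4[of z] \<eta> by (simp add: norm_outer)
    ultimately show ?thesis using \<tau> by simp
  qed
  have trS: "\<bar>trace (S z)\<bar> \<le> \<tau>" for z
  proof -
    have "trace (S z) = - (2 * (P z e h * (m \<bullet> \<eta>))) + 2 * P z e D"
      unfolding S_def using md \<eta> inner_commute[of d m] inner_commute[of \<eta> m] inner_commute[of \<eta> d]
      by (simp add: trace_add trace_sub trace_scaleR trace_outer)
    moreover have "\<bar>P z e h * (m \<bullet> \<eta>)\<bar> \<le> \<tau>/8 * (1 * 1)"
      unfolding abs_mult using e2[of z] nm \<eta> \<tau> Cauchy_Schwarz_ineq2[of m \<eta>] by (intro mult_mono) auto
    ultimately show ?thesis using e4[of z] \<tau> by linarith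
  qed
  show ?thesis
  proof (rule that[of V S])
    show "continuous_on UNIV V" "continuous_on UNIV S"
      unfolding V_def S_def by (intro continuous_intros cP)+
    show "V z = 0" "S z = 0" if "dist z c \<ge> r" for z using P(3)[OF that] by (simp_all add: V_def S_def)
    show "symmetric (S z)" for z by (simp add: symmetric_def S_def outer_def algebra_simps)
    have curl: "weak_divfree (\<lambda>z. P z a b *\<^sub>R k - P z a k *\<^sub>R b)" for a b k
      using P(1)[of a] weak_divfree_curl by blast
    have Ccurl: "Cc (\<lambda>z. q *\<^sub>R (P z a b *\<^sub>R k - P z a k *\<^sub>R b))" for a b k q
    proof -
      have "norm z > norm c + r \<Longrightarrow> dist z c \<ge> r" for z
        using norm_triangle_sub[of z c] by (simp add: dist_norm)
      then show ?thesis unfolding Cc_def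
        by (intro conjI continuous_intros cP exI[of _ "norm c + r"]) (auto simp: P(3))
    qed
    have "(\<lambda>z. (V z, 0)) = (\<lambda>z. P z h h *\<^sub>R e - P z h e *\<^sub>R h)"
      by (auto simp: V_def h_def e_def P(2)[of _ "(d, 0)" "(\<eta>, 0)"] fun_eq_iff)
    then show "weak_divfree (\<lambda>z. (V z, 0))" using curl by simp
    show "weak_divfree (\<lambda>z. (S z $ i, V z $ i))" for i
    proof -
      \<comment> \<open>Only \<open>D\<close> has a time component, so the time part is
        \<open>d_i P_hh - \<eta>_i P_eh\<close>, that is \<open>V_i\<close>. The two curls with
        factor \<open>\<eta>_i\<close> are what makes \<open>S\<close> symmetric.\<close>
      have "(S z $ i, V z $ i) = (m $ i) *\<^sub>R (P z h h *\<^sub>R e - P z h e *\<^sub>R h) + ((d $ i) *\<^sub>R (P z h h *\<^sub>R D - P z h D *\<^sub>R h)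
          + ((\<eta> $ i) *\<^sub>R (P z e D *\<^sub>R h - P z e h *\<^sub>R D) + (\<eta> $ i) *\<^sub>R (P z D e *\<^sub>R h - P z D h *\<^sub>R e)))" for z
        unfolding V_def S_def P(2)[of z h e] P(2)[of z h D] P(2)[of z D e]
        by (simp add: h_def e_def D_def outer_row vec_eq_iff algebra_simps)
      moreover have "weak_divfree (\<lambda>z. (m $ i) *\<^sub>R (P z h h *\<^sub>R e - P z h e *\<^sub>R h) + ((d $ i) *\<^sub>R (P z h h *\<^sub>R D - P z h D *\<^sub>R h)
          + ((\<eta> $ i) *\<^sub>R (P z e D *\<^sub>R h - P z e h *\<^sub>R D) + (\<eta> $ i) *\<^sub>R (P z D e *\<^sub>R h - P z D h *\<^sub>R e))))"
        by (intro weak_divfree_add weak_divfree_scale curl Ccurl Cc_add)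
      ultimately show ?thesis by simp
    qed
    show "(LINT z|lborel. a \<bullet> V z) = 0" for a
    proof -
      have i: "integrable lborel (\<lambda>z. P z k l)" "(LINT z|lborel. P z k l) = 0" for k l
        using P(1)[of k] C1c_deriv_Cc Cc_integrable C1c_integral_deriv by blast+
      show ?thesis unfolding V_def by (simp add: inner_diff_right i)
    qed
    show "\<bar>trace (S z)\<bar> \<le> \<tau>" "norm (V z) \<le> 2" for z by (rule trS, rule nV)
    show "\<exists>v' s'. norm (v + V z - v') \<le> \<tau> \<and> norm (s + S z - s') \<le> \<tau> \<and> norm v' \<le> 2
        \<and> (\<forall>x. gap v' s' x \<ge> (7/16) * \<gamma> * (x \<bullet> x))" for z
    proof (intro exI conjI allI)
      \<comment> \<open>The comparison state is the exact plane wave value, with parameter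
        \<open>\<sigma> z\<close> in [-1, 1] as \<open>gap_direction\<close> requires.\<close>
      show "norm (v + V z - (v + \<sigma> z *\<^sub>R d)) \<le> \<tau>" using errV[of z] \<tau> by simp
      show "norm (s + S z - (s + \<sigma> z *\<^sub>R (outer m d + outer d m))) \<le> \<tau>" using errS[of z] by simp
      have "norm (v + \<sigma> z *\<^sub>R d) \<le> norm v + \<bar>\<sigma> z\<bar> * norm d" using norm_triangle_ineq[of v "\<sigma> z *\<^sub>R d"] by simp
      also have "\<dots> \<le> 1 + 1 * (1/4)" using nv \<sigma> d by (intro add_mono mult_mono) auto
      finally show "norm (v + \<sigma> z *\<^sub>R d) \<le> 2" by simp
      show "gap (v + \<sigma> z *\<^sub>R d) (s + \<sigma> z *\<^sub>R (outer m d + outer d m)) x \<ge> (7/16) * \<gamma> * (x \<bullet> x)" for x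
        by (rule gp[OF \<sigma>(1)])
    qed
    let ?B = "measure lborel (ball c r)" and ?N = "real CARD('n)" and ?K = "2 ^ DIM((real^'n) \<times> real) :: real"
    have supp: "norm z > norm c + r \<Longrightarrow> dist z c \<ge> r" for z
      using norm_triangle_sub[of z c] by (simp add: dist_norm)
    have i1: "integrable lborel (\<lambda>z. (norm (V z))\<^sup>2)" "integrable lborel (\<lambda>z. (\<sigma> z)\<^sup>2)"
    proof -
      have "V z = 0 \<and> \<sigma> z = 0" if "norm z > norm c + r" for z
        using P(3,4)[OF supp[OF that]] by (simp add: V_def)
      moreover have "continuous_on UNIV V" unfolding V_def by (intro continuous_intros cP)
      ultimately have "Cc (\<lambda>z. (norm (V z))\<^sup>2)" "Cc (\<lambda>z. (\<sigma> z)\<^sup>2)"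
        using \<sigma>(2) unfolding Cc_def
        by (intro conjI continuous_intros exI[of _ "norm c + r"]; simp)+
      then show "integrable lborel (\<lambda>z. (norm (V z))\<^sup>2)" "integrable lborel (\<lambda>z. (\<sigma> z)\<^sup>2)"
        by (blast intro: Cc_integrable)+
    qed
    have iB: "integrable lborel (indicat_real (ball c r))"
      using emeasure_lborel_ball_finite[of c r] by (intro integrable_real_indicator) (auto simp: infinity_ennreal_def)
    then have i2: "integrable lborel (\<lambda>z. \<tau>\<^sup>2 * indicator (ball c r) z)" by (rule integrable_mult_right)
    have "(norm d)\<^sup>2 * (LINT z|lborel. (\<sigma> z)\<^sup>2) = (LINT z|lborel. (norm d)\<^sup>2 * (\<sigma> z)\<^sup>2)" by simp
    also have "\<dots> \<le> (LINT z|lborel. 2 * (norm (V z))\<^sup>2 + 2 * (\<tau>\<^sup>2 * indicator (ball c r) z))"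
    proof (intro integral_mono Bochner_Integration.integrable_add integrable_mult_right i1 iB)
      fix z
      show "(norm d)\<^sup>2 * (\<sigma> z)\<^sup>2 \<le> 2 * (norm (V z))\<^sup>2 + 2 * (\<tau>\<^sup>2 * indicator (ball c r) z)"
      proof (cases "z \<in> ball c r")
        case True
        have "norm (\<sigma> z *\<^sub>R d) \<le> norm (V z) + norm (V z - \<sigma> z *\<^sub>R d)"
          using norm_triangle_ineq4[of "V z" "V z - \<sigma> z *\<^sub>R d"] by simp
        then have "norm (\<sigma> z *\<^sub>R d) \<le> norm (V z) + \<tau>" using errV[of z] \<tau> by linarith
        then have "(norm (\<sigma> z *\<^sub>R d))\<^sup>2 \<le> (norm (V z) + \<tau>)\<^sup>2" by (intro power_mono) auto
        also have "\<dots> \<le> 2 * (norm (V z))\<^sup>2 + 2 * \<tau>\<^sup>2"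
          using sum_squares_bound[of "norm (V z)" \<tau>] by (simp add: power2_sum)
        finally show ?thesis using True by (simp add: power_mult_distrib mult.commute)
      next
        case False
        then have "\<sigma> z = 0" using P(4)[of z] by (simp add: dist_commute)
        then show ?thesis using False by simp
      qed
    qed
    also have "\<dots> = 2 * ((LINT z|lborel. (norm (V z))\<^sup>2) + \<tau>\<^sup>2 * ?B)"
      using i1 iB by simp
    finally have a: "(norm d)\<^sup>2 * (LINT z|lborel. (\<sigma> z)\<^sup>2) \<le> 2 * ((LINT z|lborel. (norm (V z))\<^sup>2) + \<tau>\<^sup>2 * ?B)" .
    \<comment> \<open>Origin of 512: 16 from the squared amplitude bound, 16 from the mass of the
      cut-off wave, 2 from \<open>(a + b)^2 \<le> 2 a^2 + 2 b^2\<close>.\<close>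
    have "(1 - (norm v)\<^sup>2)\<^sup>2 \<le> (4 * ?N * norm d)\<^sup>2" using dl nv2 by (intro power_mono) auto
    then have "?B * (1 - (norm v)\<^sup>2)\<^sup>2 \<le> ?B * (16 * ?N\<^sup>2 * (norm d)\<^sup>2)"
      by (intro mult_left_mono) (auto simp: power_mult_distrib)
    also have "\<dots> = 256 * ?N\<^sup>2 * ?K * ((norm d)\<^sup>2 * (?B / (16 * ?K)))" by simp
    also have "\<dots> \<le> 256 * ?N\<^sup>2 * ?K * ((norm d)\<^sup>2 * (LINT z|lborel. (\<sigma> z)\<^sup>2))"
      using \<sigma>(3) by (intro mult_left_mono) auto
    also have "\<dots> \<le> 256 * ?N\<^sup>2 * ?K * (2 * ((LINT z|lborel. (norm (V z))\<^sup>2) + \<tau>\<^sup>2 * ?B))"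
      using a by (intro mult_left_mono) auto
    also have "256 * ?N\<^sup>2 * ?K * (2 * X) = 512 * ?N\<^sup>2 * ?K * X" for X by simp
    finally show "?B * (1 - (norm v)\<^sup>2)\<^sup>2
      \<le> 512 * ?N\<^sup>2 * ?K * ((LINT z|lborel. (norm (V z))\<^sup>2) + \<tau>\<^sup>2 * ?B)" .
  qed
qed

section \<open>Adding oscillations to a subsolution\<close>

text \<open>Vitali covers \<open>\<Omega>\<close> up to a null set by countably many disjoint balls,
  and continuity of the measure from below leaves a finite subfamily missing at most
  \<open>\<tau>\<close>. Finiteness keeps sums of local waves continuous and weakly
  divergence-free.\<close>

lemma Vitali_finite_balls:
  fixes \<Omega> :: "'a::euclidean_space set"
  assumes "open \<Omega>" "bounded \<Omega>" "\<delta> > 0" "\<tau> > 0"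
  obtains F :: "('a \<times> real) set" where "finite F"
    "\<forall>i\<in>F. 0 < snd i \<and> snd i < \<delta> \<and> ball (fst i) (snd i) \<subseteq> \<Omega>"
    "disjoint_family_on (\<lambda>i. ball (fst i) (snd i)) F"
    "measure lborel \<Omega> \<le> (\<Sum>i\<in>F. measure lborel (ball (fst i) (snd i))) + \<tau>"
proof -
  let ?B = "\<lambda>i. ball (fst i) (snd i) :: 'a set"
  define K where "K = {i::'a \<times> real. 0 < snd i \<and> snd i < \<delta> \<and> ?B i \<subseteq> \<Omega>}"
  have cov: "\<exists>i. i \<in> K \<and> x \<in> ?B i \<and> snd i < d" if x: "x \<in> \<Omega>" and d: "0 < d" for x d
  proof -
    obtain e where e: "e > 0" "ball x e \<subseteq> \<Omega>" using assms(1) x open_contains_ball by blast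
    define r where "r = min e (min d \<delta>) / 2"
    have r: "0 < r" "r < \<delta>" "r < d" "r \<le> e" using e d assms(3) by (auto simp: r_def)
    then have "ball x r \<subseteq> \<Omega>" using e(2) subset_ball[of r e x] by blast
    then show ?thesis using r by (intro exI[of _ "(x, r)"]) (auto simp: K_def)
  qed
  obtain C where C: "countable C" "C \<subseteq> K" "pairwise (\<lambda>i j. disjnt (?B i) (?B j)) C"
     "negligible (\<Omega> - (\<Union>i\<in>C. ?B i))"
    by (rule Vitali_covering_theorem_balls[of \<Omega> K fst snd, OF cov])
  define U where "U = (\<Union>i\<in>C. ?B i)"
  have oU: "open U" by (auto simp: U_def)
  have UO: "U \<subseteq> \<Omega>" using C(2) by (auto simp: U_def K_def)
  have fin: "emeasure lborel S \<noteq> \<infinity>" if "S \<subseteq> \<Omega>" for S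
    using emeasure_bounded_finite[OF bounded_subset[OF assms(2) that]] by auto
  have "measure lborel \<Omega> = measure lborel U"
  proof (rule measure_eq_AE)
    have "\<Omega> - U \<in> null_sets lborel"
      using C(4) oU assms(1) unfolding U_def[symmetric]
      by (auto simp: negligible_iff_null_sets null_sets_def)
    from AE_not_in[OF this] show "AE x in lborel. x \<in> \<Omega> \<longleftrightarrow> x \<in> U" by eventually_elim (use UO in auto)
  qed (use oU assms(1) in auto)
  define N where "N n = {i\<in>C. to_nat_on C i < n}" for n
  have finN: "finite (N n)" for n
  proof -
    have "inj_on (to_nat_on C) (N n)" using inj_on_to_nat_on[OF C(1)] by (rule inj_on_subset) (auto simp: N_def)
    moreover have "to_nat_on C ` N n \<subseteq> {..<n}" by (auto simp: N_def)
    ultimately show ?thesis using finite_subset finite_imageD by (metis finite_lessThan)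
  qed
  have "(\<lambda>n. measure lborel (\<Union>i\<in>N n. ?B i)) \<longlonglongrightarrow> measure lborel (\<Union>n. \<Union>i\<in>N n. ?B i)"
  proof (rule Lim_measure_incseq)
    show "range (\<lambda>n. \<Union>i\<in>N n. ?B i) \<subseteq> sets lborel" by (auto intro!: borel_open)
    show "incseq (\<lambda>n. \<Union>i\<in>N n. ?B i)" by (auto simp: incseq_def N_def)
    show "emeasure lborel (\<Union>n. \<Union>i\<in>N n. ?B i) \<noteq> \<infinity>" by (rule fin) (use C(2) in \<open>auto simp: N_def K_def\<close>)
  qed
  also have "(\<Union>n. \<Union>i\<in>N n. ?B i) = U"
  proof -
    have "\<exists>n. i \<in> N n" if "i \<in> C" for i using that by (intro exI[of _ "Suc (to_nat_on C i)"]) (simp add: N_def)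
    then have "(\<Union>n. N n) = C" by (auto simp: N_def)
    then show ?thesis unfolding U_def by (metis UN_UN_flatten)
  qed
  finally have "\<forall>\<^sub>F n in sequentially. measure lborel (\<Union>i\<in>N n. ?B i) > measure lborel U - \<tau>"
    using assms(4) by (intro order_tendstoD) auto
  then obtain n where n: "measure lborel (\<Union>i\<in>N n. ?B i) > measure lborel U - \<tau>"
    using eventually_happens'[OF sequentially_bot] by blast
  have dj: "disjoint_family_on ?B (N n)"
    using C(3) by (auto simp: disjoint_family_on_def pairwise_def disjnt_def N_def)
  have "measure lborel (\<Union>i\<in>N n. ?B i) = (\<Sum>i\<in>N n. measure lborel (?B i))"
    using emeasure_lborel_ball_finite by (intro measure_finite_Union finN dj) (auto simp: less_top[symmetric])
  then have "measure lborel \<Omega> \<le> (\<Sum>i\<in>N n. measure lborel (?B i)) + \<tau>"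
    using n \<open>measure lborel \<Omega> = measure lborel U\<close> by simp
  moreover have "\<forall>i\<in>N n. 0 < snd i \<and> snd i < \<delta> \<and> ?B i \<subseteq> \<Omega>"
  proof -
    have "N n \<subseteq> K" using C(2) by (auto simp: N_def)
    then show ?thesis unfolding K_def by blast
  qed
  ultimately show ?thesis using that[of "N n"] finN dj by blast
qed

section \<open>Subsolutions and one stage of the construction\<close>

lemma weak_divfree_sum:
  assumes "finite F" "\<And>i. i \<in> F \<Longrightarrow> weak_divfree (G i)" "\<And>i. i \<in> F \<Longrightarrow> Cc (G i)"
  shows "weak_divfree (\<lambda>z. \<Sum>i\<in>F. G i z) \<and> Cc (\<lambda>z. \<Sum>i\<in>F. G i z)"
  using assms
proof (induction F)
  case empty
  show ?case by (simp add: weak_divfree_zero Cc_def)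
next
  case (insert i F)
  then show ?case using weak_divfree_add[of "G i" "\<lambda>z. \<Sum>i\<in>F. G i z"] Cc_add[of "G i" "\<lambda>z. \<Sum>i\<in>F. G i z"] by simp
qed

text \<open>The gap is bounded below uniformly in \<open>z\<close>, also outside
  \<open>\<Omega>\<close>, so uniformly small errors cannot destroy it; the constant is existential
  because it may shrink at each stage. The divergence conditions hold on all of space-time, so
  nothing has to be checked at the boundary of \<open>\<Omega>\<close>.\<close>

definition subsolution ::
    "((real^'n) \<times> real) set \<Rightarrow> ((real^'n) \<times> real \<Rightarrow> real^'n) \<Rightarrow> ((real^'n) \<times> real \<Rightarrow> real^'n^'n) \<Rightarrow> bool" where
  "subsolution \<Omega> v s \<longleftrightarrow> continuous_on UNIV v \<and> continuous_on UNIV s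
     \<and> (\<forall>z. z \<notin> \<Omega> \<longrightarrow> v z = 0 \<and> s z = 0) \<and> (\<forall>z. symmetric (s z))
     \<and> weak_divfree (\<lambda>z. (v z, 0)) \<and> (\<forall>i. weak_divfree (\<lambda>z. (s z $ i, v z $ i)))
     \<and> (\<exists>\<gamma>>0. \<forall>z x. gap (v z) (s z) x \<ge> \<gamma> * (x \<bullet> x))"

lemma subsolutionD:
  assumes "subsolution \<Omega> v s"
  shows "continuous_on UNIV v" "continuous_on UNIV s" "z \<notin> \<Omega> \<Longrightarrow> v z = 0" "z \<notin> \<Omega> \<Longrightarrow> s z = 0"
    "symmetric (s z)" "weak_divfree (\<lambda>z. (v z, 0))" "weak_divfree (\<lambda>z. (s z $ i, v z $ i))"
  using assms unfolding subsolution_def by blast+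

lemma subsolution_zero: "subsolution \<Omega> (\<lambda>_. 0) (\<lambda>_. 0)"
  for \<Omega> :: "((real^'n) \<times> real) set"
proof -
  have "gap (0::real^'n) 0 x \<ge> (1 / real CARD('n)) * (x \<bullet> x)" for x
    by (simp add: gap_def trace_def)
  then have "\<exists>\<gamma>>0. \<forall>x. gap (0::real^'n) 0 x \<ge> \<gamma> * (x \<bullet> x)"
    by (intro exI[of _ "1 / real CARD('n)"]) simp
  then show ?thesis
    using weak_divfree_zero[where 'a = "(real^'n) \<times> real"] by (simp add: subsolution_def symmetric_def zero_prod_def)
qed

lemma subsolution_gap_nonneg:
  assumes "subsolution \<Omega> v s" shows "gap (v z) (s z) x \<ge> 0"
proof -
  obtain \<gamma> where "\<gamma> > 0" "\<And>z x. gap (v z) (s z) x \<ge> \<gamma> * (x \<bullet> x)"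
    using assms by (auto simp: subsolution_def)
  then show ?thesis by (meson inner_ge_zero less_imp_le mult_nonneg_nonneg order_trans)
qed

lemma subsolution_norm_le: "subsolution \<Omega> v s \<Longrightarrow> norm (v z) \<le> 1"
  by (rule gap_norm_le[OF subsolution_gap_nonneg])

lemma subsolution_Cc:
  assumes "subsolution \<Omega> v s" "bounded \<Omega>"
  shows "Cc v" "Cc s" "Cc (\<lambda>z. (v z, 0::real))" "Cc (\<lambda>z. (s z $ i, v z $ i))"
  using assms unfolding subsolution_def
  by (auto intro!: Cc_bounded_support[OF _ assms(2)] continuous_intros simp: zero_prod_def)


text \<open>Constant of the last estimate of \<open>building_block\<close>. It depends on the
  dimension only, hence does not deteriorate with \<open>\<gamma>\<close> along the
  iteration.\<close>

definition gain_const :: "'n::finite itself \<Rightarrow> real" where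
  "gain_const _ = 512 * (real CARD('n))\<^sup>2 * 2 ^ DIM((real^'n) \<times> real)"

lemma gain_const_pos: "gain_const TYPE('n::finite) > 0"
  by (simp add: gain_const_def)

lemma sum_disjoint_support:
  fixes V :: "'i \<Rightarrow> 'a \<Rightarrow> 'b::real_vector"
  assumes "finite F" "disjoint_family_on B F" "\<And>i z. i \<in> F \<Longrightarrow> z \<notin> B i \<Longrightarrow> V i z = 0" "j \<in> F" "z \<in> B j"
  shows "(\<Sum>i\<in>F. V i z) = V j z"
proof -
  have "V i z = 0" if "i \<in> F - {j}" for i
  proof -
    have "z \<notin> B i" using assms(2,4,5) that unfolding disjoint_family_on_def by blast
    then show ?thesis using assms(3) that by blast
  qed
  then show ?thesis using assms(1,4) by (simp add: sum.remove)
qed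

lemma lborel_integral_indicator_ball:
  "integrable lborel (indicat_real (ball c r))" "(LINT z|lborel. indicat_real (ball c r) z) = measure lborel (ball c r)"
  for c :: "'a::euclidean_space"
  using emeasure_lborel_ball_finite[of c r] by (auto simp: infinity_ennreal_def)

lemma subsolution_step:
  fixes \<Omega> :: "((real^'n) \<times> real) set"
  assumes n: "CARD('n) \<ge> 2" and \<Omega>: "open \<Omega>" "bounded \<Omega>" and sub: "subsolution \<Omega> v s"
    and H: "finite H" "\<And>h. h \<in> H \<Longrightarrow> Cc h" and \<tau>: "\<tau> > 0"
  obtains v' s' where "subsolution \<Omega> v' s'"
    "\<And>h. h \<in> H \<Longrightarrow> \<bar>LINT z|lborel. h z \<bullet> (v' z - v z)\<bar> \<le> \<tau>"
    "\<And>z. \<bar>trace (s' z) - trace (s z)\<bar> \<le> \<tau>"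
    "(LINT z|lborel. indicator \<Omega> z * (1 - (norm (v z))\<^sup>2)\<^sup>2)
       \<le> 2 * gain_const TYPE('n) * (LINT z|lborel. (norm (v' z - v z))\<^sup>2) + \<tau>"
proof -
  let ?K = "gain_const TYPE('n)"
  define A where "A = measure lborel \<Omega>"
  have A0: "A \<ge> 0" by (simp add: A_def)
  have K0: "?K > 0" by (rule gain_const_pos)
  obtain \<gamma> where \<gamma>: "\<gamma> > 0" "\<And>z x. gap (v z) (s z) x \<ge> \<gamma> * (x \<bullet> x)"
    using sub by (auto simp: subsolution_def)
  \<comment> \<open>Collects \<open>2 * ?K * A + 8 * A + 1\<close> from the gain estimate and
    \<open>2 * A\<close> from the orthogonality estimate, so that \<open>t * M \<le> \<tau>\<close>
    serves both.\<close>
  define M where "M = 2 * ?K * A + 10 * A + 1"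
  have M: "M \<ge> 1" using A0 K0 by (simp add: M_def)
  \<comment> \<open>The bound \<open>\<gamma> / 100\<close> keeps the drop \<open>16 * t\<close> of
    the form below 3/16 of \<open>\<gamma>\<close>, which turns 7/16 into 1/4.\<close>
  define t where "t = min (min 1 (\<gamma> / 100)) (\<tau> / M)"
  have t: "t > 0" "t \<le> 1" "t \<le> \<gamma> / 100" "t \<le> \<tau> / M"
  proof -
    show "t > 0" unfolding t_def using \<gamma>(1) \<tau> M by simp
    show "t \<le> 1" "t \<le> \<gamma> / 100" "t \<le> \<tau> / M" unfolding t_def by linarith+
  qed
  have tM: "t * M \<le> \<tau>" using t(4) M by (simp add: field_simps)
  have tt: "t \<le> \<tau>"
  proof -
    have "t * 1 \<le> t * M" using t M by (intro mult_left_mono) auto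
    then show ?thesis using tM by simp
  qed
  have cv: "continuous_on UNIV v" "continuous_on UNIV s" using subsolutionD[OF sub] by blast+
  have uc: "\<exists>d>0. \<forall>x y. dist x y < d \<longrightarrow> dist (f x) (f y) < t" if "Cc f" for f :: "(real^'n) \<times> real \<Rightarrow> 'c::euclidean_space"
    using Cc_uniformly_continuous[OF that t(1)] .
  obtain \<delta>1 where \<delta>1: "\<delta>1 > 0" "\<And>x y. dist x y < \<delta>1 \<Longrightarrow> dist (v x) (v y) < t"
    using uc[OF subsolution_Cc(1)[OF sub \<Omega>(2)]] by blast
  obtain \<delta>2 where \<delta>2: "\<delta>2 > 0" "\<And>x y. dist x y < \<delta>2 \<Longrightarrow> dist (s x) (s y) < t"
    using Cc_uniformly_continuous[OF subsolution_Cc(2)[OF sub \<Omega>(2)] t(1)] by blast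
  have "\<exists>\<delta>>0. \<forall>h\<in>H. \<forall>x y. dist x y < \<delta> \<longrightarrow> dist (h x) (h y) < t"
    using H
  proof (induction H)
    case (insert h H)
    then obtain a where a: "a > 0" "\<forall>h\<in>H. \<forall>x y. dist x y < a \<longrightarrow> dist (h x) (h y) < t" by auto
    obtain b where b: "b > 0" "\<forall>x y. dist x y < b \<longrightarrow> dist (h x) (h y) < t"
      using uc[of h] insert by auto
    show ?case using a b by (intro exI[of _ "min a b"]) auto
  qed (auto intro: exI[of _ 1])
  then obtain \<delta>3 where \<delta>3: "\<delta>3 > 0" "\<And>h x y. h \<in> H \<Longrightarrow> dist x y < \<delta>3 \<Longrightarrow> dist (h x) (h y) < t" by blast
  define \<delta> where "\<delta> = min \<delta>1 (min \<delta>2 \<delta>3)"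
  have \<delta>: "\<delta> > 0" using \<delta>1 \<delta>2 \<delta>3 by (simp add: \<delta>_def)
  obtain F :: "(((real^'n) \<times> real) \<times> real) set" where F: "finite F"
    "\<forall>i\<in>F. 0 < snd i \<and> snd i < \<delta> \<and> ball (fst i) (snd i) \<subseteq> \<Omega>"
    "disjoint_family_on (\<lambda>i. ball (fst i) (snd i)) F"
    "A \<le> (\<Sum>i\<in>F. measure lborel (ball (fst i) (snd i))) + t"
    unfolding A_def by (rule Vitali_finite_balls[OF \<Omega> \<delta> t(1)])
  let ?B = "\<lambda>i::((real^'n) \<times> real) \<times> real. ball (fst i) (snd i)"
  let ?m = "\<lambda>i. measure lborel (?B i)"
  have r: "snd i > 0" "snd i < \<delta>" "?B i \<subseteq> \<Omega>" if "i \<in> F" for i using F(2) that by blast+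
  \<comment> \<open>Bundles the conclusions of \<open>building_block\<close> for the state frozen at
    the centre, so that a single choice over \<open>F\<close> yields all waves.\<close>
  define good where "good i V S \<longleftrightarrow> continuous_on UNIV V \<and> continuous_on UNIV S
    \<and> (\<forall>z. z \<notin> ?B i \<longrightarrow> V z = 0 \<and> S z = 0) \<and> (\<forall>z. symmetric (S z))
    \<and> weak_divfree (\<lambda>z. (V z, 0)) \<and> (\<forall>k. weak_divfree (\<lambda>z. (S z $ k, V z $ k)))
    \<and> (\<forall>a. (LINT z|lborel. a \<bullet> V z) = 0) \<and> (\<forall>z. \<bar>trace (S z)\<bar> \<le> t) \<and> (\<forall>z. norm (V z) \<le> 2)
    \<and> (\<forall>z. \<exists>v' s'. norm (v (fst i) + V z - v') \<le> t \<and> norm (s (fst i) + S z - s') \<le> t \<and> norm v' \<le> 2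
        \<and> (\<forall>x. gap v' s' x \<ge> (7/16) * \<gamma> * (x \<bullet> x)))
    \<and> ?m i * (1 - (norm (v (fst i)))\<^sup>2)\<^sup>2 \<le> ?K * ((LINT z|lborel. (norm (V z))\<^sup>2) + t\<^sup>2 * ?m i)"
    for i :: "((real^'n) \<times> real) \<times> real" and V :: "(real^'n) \<times> real \<Rightarrow> real^'n" and S :: "(real^'n) \<times> real \<Rightarrow> real^'n^'n"
  have ex: "\<exists>V S. good i V S" if "i \<in> F" for i
  proof -
    have sy: "symmetric (s (fst i))" using subsolutionD[OF sub] by blast
    show ?thesis
      apply (rule building_block[OF n sy \<gamma>(1) \<gamma>(2) r(1)[OF that] t(1) t(2), where c = "fst i"])
      subgoal for V S unfolding good_def gain_const_def
        by (rule exI[of _ V], rule exI[of _ S]) (intro conjI allI impI; simp add: dist_commute not_less)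
      done
  qed
  then obtain V S where VS: "\<And>i. i \<in> F \<Longrightarrow> good i (V i) (S i)" by metis
  have supp: "V i z = 0" "S i z = 0" if "i \<in> F" "z \<notin> ?B i" for i z
    using VS[OF that(1)] that(2) unfolding good_def by blast+
  have cVS: "continuous_on UNIV (V i)" "continuous_on UNIV (S i)" if "i \<in> F" for i
    using VS[OF that] unfolding good_def by blast+
  have nV: "norm (V i z) \<le> 2" if "i \<in> F" for i z using VS[OF that] unfolding good_def by blast
  have bB: "bounded (?B i)" for i by simp
  have CcV: "Cc (V i)" "Cc (\<lambda>z. (V i z, 0::real))" "Cc (\<lambda>z. (S i z $ k, V i z $ k))" "Cc (\<lambda>z. (norm (V i z))\<^sup>2)" if "i \<in> F" for i k
    using supp[OF that] cVS[OF that]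
    by (auto intro!: Cc_bounded_support[OF _ bB[of i]] continuous_intros simp: zero_prod_def)
  define W where "W z = (\<Sum>i\<in>F. V i z)" for z
  define T where "T z = (\<Sum>i\<in>F. S i z)" for z
  define v' where "v' z = v z + W z" for z
  define s' where "s' z = s z + T z" for z
  have on: "W z = V i z" "T z = S i z" if "i \<in> F" "z \<in> ?B i" for i z
    unfolding W_def T_def using sum_disjoint_support[OF F(1,3) _ that] supp by blast+
  have off: "W z = 0" "T z = 0" if "\<And>i. i \<in> F \<Longrightarrow> z \<notin> ?B i" for z
    unfolding W_def T_def using that supp by (auto intro: sum.neutral)
  have mB: "(\<Sum>i\<in>F. ?m i) \<le> A"
  proof -
    have "(\<Sum>i\<in>F. ?m i) = measure lborel (\<Union>i\<in>F. ?B i)"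
      using emeasure_lborel_ball_finite by (intro measure_finite_Union[symmetric] F) (auto simp: less_top[symmetric])
    also have "\<dots> \<le> A" unfolding A_def
      using r(3) \<Omega> emeasure_bounded_finite[OF \<Omega>(2)] by (intro measure_mono_fmeasurable) (auto simp: fmeasurable_def intro!: borel_open)
    finally show ?thesis .
  qed
  have gap': "gap (v' z) (s' z) x \<ge> (\<gamma> / 4) * (x \<bullet> x)" for z x
  proof (cases "\<exists>i\<in>F. z \<in> ?B i")
    case True
    then obtain i where i: "i \<in> F" "z \<in> ?B i" by blast
    obtain u q where u: "norm (v (fst i) + V i z - u) \<le> t" "norm (s (fst i) + S i z - q) \<le> t" "norm u \<le> 2"
        "\<And>x. gap u q x \<ge> (7/16) * \<gamma> * (x \<bullet> x)"
      using VS[OF i(1)] unfolding good_def by blast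
    have dz: "dist z (fst i) < \<delta>" using i r[OF i(1)] by (simp add: dist_commute)
    have "norm (v' z - u) \<le> norm (v z - v (fst i)) + norm (v (fst i) + V i z - u)"
      using norm_triangle_ineq[of "v z - v (fst i)" "v (fst i) + V i z - u"] by (simp add: v'_def on[OF i] algebra_simps)
    also have "\<dots> \<le> 2 * t" using \<delta>1(2)[of z "fst i"] dz u by (simp add: \<delta>_def dist_norm)
    finally have a: "norm (v' z - u) \<le> 2 * t" .
    have "norm (s' z - q) \<le> norm (s z - s (fst i)) + norm (s (fst i) + S i z - q)"
      using norm_triangle_ineq[of "s z - s (fst i)" "s (fst i) + S i z - q"] by (simp add: s'_def on[OF i] algebra_simps)
    also have "\<dots> \<le> 2 * t" using \<delta>2(2)[of z "fst i"] dz u by (simp add: \<delta>_def dist_norm)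
    finally have b: "norm (s' z - q) \<le> 2 * t" .
    have "norm (v' z) \<le> norm u + norm (v' z - u)" by (rule norm_triangle_sub)
    then have "norm (v' z) \<le> 4" using a u t by linarith
    then have "norm (v' z - u) * (norm u + norm (v' z)) + 2 * norm (s' z - q) \<le> (2 * t) * (2 + 4) + 2 * (2 * t)"
      using a b u t by (intro add_mono mult_mono) auto
    also have "\<dots> \<le> (3/16) * \<gamma>" using t(3) \<gamma>(1) by simp
    finally have "(norm (v' z - u) * (norm u + norm (v' z)) + 2 * norm (s' z - q)) * (x \<bullet> x) \<le> (3/16) * \<gamma> * (x \<bullet> x)"
      by (intro mult_right_mono) auto
    then show ?thesis using gap_lipschitz[of u q x "v' z" "s' z"] u(4)[of x] by linarith
  next
    case False
    then have "v' z = v z" "s' z = s z" using off[of z] by (simp_all add: v'_def s'_def)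
    moreover have "(\<gamma> / 4) * (x \<bullet> x) \<le> \<gamma> * (x \<bullet> x)" using \<gamma>(1) by (intro mult_right_mono) auto
    ultimately show ?thesis using \<gamma>(2)[of x z] by simp
  qed
  have sub': "subsolution \<Omega> v' s'"
    unfolding subsolution_def
  proof (intro conjI allI impI)
    show "continuous_on UNIV v'" "continuous_on UNIV s'"
      unfolding v'_def s'_def W_def T_def using cv cVS by (auto intro!: continuous_intros)
    show "v' z = 0" "s' z = 0" if "z \<notin> \<Omega>" for z
    proof -
      have "\<And>i. i \<in> F \<Longrightarrow> z \<notin> ?B i" using r(3) that by blast
      from off[OF this] show "v' z = 0" "s' z = 0" using subsolutionD(3,4)[OF sub that] by (simp_all add: v'_def s'_def)
    qed
    show "symmetric (s' z)" for z
    proof (cases "\<exists>i\<in>F. z \<in> ?B i")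
      case True
      then obtain i where i: "i \<in> F" "z \<in> ?B i" by blast
      have "symmetric (S i z)" using VS[OF i(1)] unfolding good_def by blast
      then show ?thesis using subsolutionD(5)[OF sub] by (simp add: s'_def on[OF i] symmetric_def)
    next
      case False
      then show ?thesis using off[of z] subsolutionD(5)[OF sub] by (simp add: s'_def)
    qed
    have "weak_divfree (\<lambda>z. \<Sum>i\<in>F. (V i z, 0::real)) \<and> Cc (\<lambda>z. \<Sum>i\<in>F. (V i z, 0::real))"
      using VS CcV by (intro weak_divfree_sum F(1)) (unfold good_def, blast+)
    then have "weak_divfree (\<lambda>z. (v z, 0) + (\<Sum>i\<in>F. (V i z, 0::real)))"
      using sub subsolution_Cc[OF sub \<Omega>(2)] by (intro weak_divfree_add subsolutionD[OF sub]) auto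
    then show "weak_divfree (\<lambda>z. (v' z, 0))"
      by (simp add: v'_def W_def sum_prod)
    show "weak_divfree (\<lambda>z. (s' z $ k, v' z $ k))" for k
    proof -
      have "weak_divfree (\<lambda>z. \<Sum>i\<in>F. (S i z $ k, V i z $ k)) \<and> Cc (\<lambda>z. \<Sum>i\<in>F. (S i z $ k, V i z $ k))"
        using VS CcV by (intro weak_divfree_sum F(1)) (unfold good_def, blast+)
      then have "weak_divfree (\<lambda>z. (s z $ k, v z $ k) + (\<Sum>i\<in>F. (S i z $ k, V i z $ k)))"
        using sub subsolution_Cc[OF sub \<Omega>(2)] by (intro weak_divfree_add subsolutionD[OF sub]) auto
      then show ?thesis by (simp add: v'_def s'_def W_def T_def sum_prod)
    qed
    show "\<exists>\<gamma>>0. \<forall>z x. gap (v' z) (s' z) x \<ge> \<gamma> * (x \<bullet> x)"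
      using gap' \<gamma>(1) by (intro exI[of _ "\<gamma> / 4"]) auto
  qed
  have orth: "\<bar>LINT z|lborel. h z \<bullet> (v' z - v z)\<bar> \<le> \<tau>" if h: "h \<in> H" for h
  proof -
    have hc: "continuous_on UNIV h" using H(2)[OF h] by (simp add: Cc_def)
    have i: "integrable lborel (\<lambda>z. h z \<bullet> V i z)" "integrable lborel (\<lambda>z. h (fst i) \<bullet> V i z)" if "i \<in> F" for i
      using supp[OF that] cVS[OF that] hc
      by (auto intro!: Cc_integrable Cc_bounded_support[OF _ bB[of i]] continuous_intros)
    have loc: "\<bar>LINT z|lborel. h z \<bullet> V i z\<bar> \<le> 2 * t * ?m i" if iF: "i \<in> F" for i
    proof -
      \<comment> \<open>Zero mean allows \<open>h z\<close> to be replaced by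
        \<open>h z - h (fst i)\<close>, which is at most \<open>t\<close> in norm on the
        ball.\<close>
      have "(LINT z|lborel. h (fst i) \<bullet> V i z) = 0" using VS[OF iF] unfolding good_def by blast
      then have "(LINT z|lborel. h z \<bullet> V i z) = (LINT z|lborel. h z \<bullet> V i z - h (fst i) \<bullet> V i z)"
        using i[OF iF] by simp
      also have "\<bar>\<dots>\<bar> \<le> (LINT z|lborel. \<bar>h z \<bullet> V i z - h (fst i) \<bullet> V i z\<bar>)" by (rule integral_abs_bound)
      also have "\<dots> \<le> (LINT z|lborel. 2 * t * indicator (?B i) z)"
      proof (intro integral_mono integrable_abs Bochner_Integration.integrable_diff i iF
          integrable_mult_right lborel_integral_indicator_ball(1))
        fix z
        show "\<bar>h z \<bullet> V i z - h (fst i) \<bullet> V i z\<bar> \<le> 2 * t * indicator (?B i) z"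
        proof (cases "z \<in> ?B i")
          case True
          then have "dist z (fst i) < \<delta>3" using r[OF iF] by (simp add: dist_commute \<delta>_def)
          then have "norm (h z - h (fst i)) \<le> t" using \<delta>3(2)[OF h, of z "fst i"] by (simp add: dist_norm)
          then have "norm (h z - h (fst i)) * norm (V i z) \<le> t * 2" using nV[OF iF] t by (intro mult_mono) auto
          then show ?thesis using Cauchy_Schwarz_ineq2[of "h z - h (fst i)" "V i z"] True
            by (simp add: inner_diff_left)
        qed (use supp[OF iF] in simp)
      qed
      also have "\<dots> = 2 * t * ?m i" using lborel_integral_indicator_ball by simp
      finally show ?thesis .
    qed
    have "(LINT z|lborel. h z \<bullet> (v' z - v z)) = (LINT z|lborel. (\<Sum>i\<in>F. h z \<bullet> V i z))"
      by (simp add: v'_def W_def inner_sum_right)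
    also have "\<dots> = (\<Sum>i\<in>F. LINT z|lborel. h z \<bullet> V i z)" using i(1) by simp
    also have "\<bar>\<dots>\<bar> \<le> (\<Sum>i\<in>F. 2 * t * ?m i)" using loc by (intro order_trans[OF sum_abs] sum_mono)
    also have "\<dots> = 2 * t * (\<Sum>i\<in>F. ?m i)" by (simp add: sum_distrib_left)
    also have "\<dots> \<le> 2 * t * A" using mB t by (intro mult_left_mono) auto
    also have "\<dots> = t * (2 * A)" by simp
    also have "\<dots> \<le> t * M" using t A0 K0 by (intro mult_left_mono) (auto simp: M_def)
    also have "\<dots> \<le> \<tau>" by (rule tM)
    finally show ?thesis .
  qed
  have tr: "\<bar>trace (s' z) - trace (s z)\<bar> \<le> \<tau>" for z
  proof (cases "\<exists>i\<in>F. z \<in> ?B i")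
    case True
    then obtain i where i: "i \<in> F" "z \<in> ?B i" by blast
    have "\<bar>trace (S i z)\<bar> \<le> t" using VS[OF i(1)] unfolding good_def by blast
    then show ?thesis using tt by (simp add: s'_def trace_add on[OF i])
  next
    case False
    then show ?thesis using off[of z] \<tau> by (simp add: s'_def)
  qed
  have gain: "(LINT z|lborel. indicator \<Omega> z * (1 - (norm (v z))\<^sup>2)\<^sup>2) \<le> 2 * ?K * (LINT z|lborel. (norm (v' z - v z))\<^sup>2) + \<tau>"
  proof -
    let ?g = "\<lambda>z. (1 - (norm (v z))\<^sup>2)\<^sup>2"
    \<comment> \<open>\<open>?b i\<close> dominates \<open>?g\<close> on the ball: twice the value
      at the centre plus twice \<open>(2 * t)^2 \<le> 4 * t\<close>. The indicator of
      \<open>\<Omega>\<close> minus \<open>?U\<close> is that of the uncovered part, where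
      \<open>?g \<le> 1\<close> suffices.\<close>
    let ?b = "\<lambda>i. 2 * ?g (fst i) + 8 * t"
    let ?U = "\<lambda>z. (\<Sum>i\<in>F. indicat_real (?B i) z)"
    have nv: "norm (v z) \<le> 1" for z by (rule subsolution_norm_le[OF sub])
    have g1: "?g z \<le> 1" for z using nv[of z] by (simp add: abs_square_le_1 power_le_one)
    have i\<Omega>: "integrable lborel (indicat_real \<Omega>)"
      using emeasure_bounded_finite[OF \<Omega>(2)] \<Omega>(1) by (intro integrable_real_indicator) (auto intro: borel_open)
    have iU: "integrable lborel ?U" by (intro Bochner_Integration.integrable_sum lborel_integral_indicator_ball)
    have "(LINT z|lborel. indicator \<Omega> z * ?g z) \<le> (LINT z|lborel. (\<Sum>i\<in>F. ?b i * indicator (?B i) z) + (indicator \<Omega> z - ?U z))"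
    proof (rule integral_mono)
      show "integrable lborel (\<lambda>z. indicator \<Omega> z * ?g z)"
      proof (rule Bochner_Integration.integrable_bound[OF i\<Omega>])
        show "(\<lambda>z. indicator \<Omega> z * ?g z) \<in> borel_measurable lborel"
        proof -
          have "\<Omega> \<in> sets borel" using \<Omega>(1) by (rule borel_open)
          moreover have "?g \<in> borel_measurable borel"
            using cv by (intro borel_measurable_continuous_onI continuous_intros)
          ultimately show ?thesis by simp
        qed
        show "AE z in lborel. norm (indicator \<Omega> z * ?g z) \<le> norm (indicat_real \<Omega> z)"
          using g1 by (intro AE_I2) (auto simp: indicator_def)
      qed
      show "integrable lborel (\<lambda>z. (\<Sum>i\<in>F. ?b i * indicator (?B i) z) + (indicator \<Omega> z - ?U z))"
        by (intro Bochner_Integration.integrable_add Bochner_Integration.integrable_diff i\<Omega> iU Bochner_Integration.integrable_sum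
            integrable_mult_right lborel_integral_indicator_ball)
      fix z
      show "indicator \<Omega> z * ?g z \<le> (\<Sum>i\<in>F. ?b i * indicator (?B i) z) + (indicator \<Omega> z - ?U z)"
      proof (cases "\<exists>i\<in>F. z \<in> ?B i")
        case True
        then obtain i where i: "i \<in> F" "z \<in> ?B i" by blast
        have "?U z = indicator (?B i) z"
          by (rule sum_disjoint_support[OF F(1,3) _ i]) auto
        moreover have "(\<Sum>i\<in>F. ?b i * indicator (?B i) z) = ?b i * indicator (?B i) z"
          by (rule sum_disjoint_support[OF F(1,3) _ i, of "\<lambda>i z. ?b i * indicator (?B i) z"]) auto
        moreover have "z \<in> \<Omega>" using i r(3) by blast
        moreover have "?g z \<le> ?b i"
        proof -
          let ?x = "norm (v z)" and ?y = "norm (v (fst i))"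
          have "dist z (fst i) < \<delta>1" using i r[OF i(1)] by (simp add: dist_commute \<delta>_def)
          then have "norm (v z - v (fst i)) \<le> t" using \<delta>1(2)[of z "fst i"] by (simp add: dist_norm)
          then have xy: "\<bar>?x - ?y\<bar> \<le> t" using norm_triangle_ineq3[of "v z" "v (fst i)"] by linarith
          have "\<bar>?x\<^sup>2 - ?y\<^sup>2\<bar> = \<bar>?x - ?y\<bar> * (?x + ?y)"
            by (simp add: power2_eq_square square_diff_square_factored abs_mult mult.commute)
          also have "\<dots> \<le> t * 2" using xy nv[of z] nv[of "fst i"] t by (intro mult_mono) auto
          finally have d: "\<bar>?x\<^sup>2 - ?y\<^sup>2\<bar> \<le> 2 * t" by simp
          have "(?x\<^sup>2 - ?y\<^sup>2)\<^sup>2 \<le> (2 * t)\<^sup>2" using d by (metis abs_ge_zero power2_abs power_mono)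
          also have "\<dots> \<le> 4 * t" using t by (simp add: power2_eq_square)
          finally have e: "(?x\<^sup>2 - ?y\<^sup>2)\<^sup>2 \<le> 4 * t" .
          have "?g z \<le> 2 * ?g (fst i) + 2 * (?x\<^sup>2 - ?y\<^sup>2)\<^sup>2"
            using zero_le_power2[of "(1 - ?y\<^sup>2) + (?x\<^sup>2 - ?y\<^sup>2)"] by (simp add: power2_eq_square algebra_simps)
          then show ?thesis using e by linarith
        qed
        ultimately show ?thesis using i(2) by simp
      next
        case False
        then have "?U z = 0" "(\<Sum>i\<in>F. ?b i * indicator (?B i) z) = 0" by (auto intro!: sum.neutral)
        then show ?thesis using g1[of z] by (simp add: indicator_def)
      qed
    qed
    also have "\<dots> = (\<Sum>i\<in>F. ?b i * ?m i) + (A - (\<Sum>i\<in>F. ?m i))"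
    proof -
      have i1: "integrable lborel (\<lambda>z. \<Sum>i\<in>F. ?b i * indicator (?B i) z)"
        by (intro Bochner_Integration.integrable_sum integrable_mult_right lborel_integral_indicator_ball)
      have "(LINT z|lborel. (\<Sum>i\<in>F. ?b i * indicator (?B i) z)) = (\<Sum>i\<in>F. LINT z|lborel. ?b i * indicator (?B i) z)"
        by (intro Bochner_Integration.integral_sum integrable_mult_right lborel_integral_indicator_ball)
      moreover have "(LINT z|lborel. ?U z) = (\<Sum>i\<in>F. LINT z|lborel. indicator (?B i) z)"
        by (intro Bochner_Integration.integral_sum lborel_integral_indicator_ball)
      ultimately show ?thesis
        unfolding Bochner_Integration.integral_add[OF i1 Bochner_Integration.integrable_diff[OF i\<Omega> iU]]
          Bochner_Integration.integral_diff[OF i\<Omega> iU]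
        by (simp add: A_def)
    qed
    also have "\<dots> \<le> (\<Sum>i\<in>F. ?b i * ?m i) + t" using F(4) by simp
    also have "(\<Sum>i\<in>F. ?b i * ?m i) \<le> (\<Sum>i\<in>F. 2 * ?K * (LINT z|lborel. (norm (V i z))\<^sup>2) + (2 * ?K + 8) * t * ?m i)"
    proof (rule sum_mono)
      fix i assume iF: "i \<in> F"
      have "?m i * ?g (fst i) \<le> ?K * ((LINT z|lborel. (norm (V i z))\<^sup>2) + t\<^sup>2 * ?m i)"
        using VS[OF iF] unfolding good_def by blast
      also have "\<dots> \<le> ?K * ((LINT z|lborel. (norm (V i z))\<^sup>2) + t * ?m i)"
        using K0 t by (intro mult_left_mono add_left_mono mult_right_mono) (auto simp: power2_eq_square)
      finally show "?b i * ?m i \<le> 2 * ?K * (LINT z|lborel. (norm (V i z))\<^sup>2) + (2 * ?K + 8) * t * ?m i"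
        by (simp add: algebra_simps)
    qed
    also have "\<dots> = 2 * ?K * (\<Sum>i\<in>F. LINT z|lborel. (norm (V i z))\<^sup>2) + (2 * ?K + 8) * t * (\<Sum>i\<in>F. ?m i)"
      by (simp add: sum.distrib sum_distrib_left)
    also have "(\<Sum>i\<in>F. LINT z|lborel. (norm (V i z))\<^sup>2) = (LINT z|lborel. (norm (v' z - v z))\<^sup>2)"
    proof -
      have "(norm (v' z - v z))\<^sup>2 = (\<Sum>i\<in>F. (norm (V i z))\<^sup>2)" for z
      proof (cases "\<exists>i\<in>F. z \<in> ?B i")
        case True
        then obtain i where i: "i \<in> F" "z \<in> ?B i" by blast
        have "(\<Sum>i\<in>F. (norm (V i z))\<^sup>2) = (norm (V i z))\<^sup>2"
          by (rule sum_disjoint_support[OF F(1,3) _ i, of "\<lambda>i z. (norm (V i z))\<^sup>2"]) (use supp in auto)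
        then show ?thesis by (simp add: v'_def on[OF i])
      next
        case False
        then show ?thesis using off[of z] supp by (auto simp: v'_def intro!: sum.neutral)
      qed
      then show ?thesis using CcV(4) by (simp add: Bochner_Integration.integral_sum Cc_integrable)
    qed
    also have "2 * ?K * (LINT z|lborel. (norm (v' z - v z))\<^sup>2) + (2 * ?K + 8) * t * (\<Sum>i\<in>F. ?m i) + t
        \<le> 2 * ?K * (LINT z|lborel. (norm (v' z - v z))\<^sup>2) + (2 * ?K + 8) * t * A + t"
      using mB t K0 by (intro add_mono mult_left_mono order_refl) auto
    also have "\<dots> \<le> 2 * ?K * (LINT z|lborel. (norm (v' z - v z))\<^sup>2) + t * M"
      using t A0 by (simp add: M_def algebra_simps)
    also have "\<dots> \<le> 2 * ?K * (LINT z|lborel. (norm (v' z - v z))\<^sup>2) + \<tau>" using tM by simp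
    finally show ?thesis by simp
  qed
  show ?thesis by (rule that[OF sub' orth tr gain])
qed

text \<open>Dependent choice with tolerance \<open>(1/2) ^ k\<close>: summability controls both the
  accumulated failure of orthogonality and the drift of the trace.\<close>

lemma subsolution_sequence:
  fixes \<Omega> :: "((real^'n) \<times> real) set"
  assumes n: "CARD('n) \<ge> 2" and \<Omega>: "open \<Omega>" "bounded \<Omega>"
  obtains v :: "nat \<Rightarrow> (real^'n) \<times> real \<Rightarrow> real^'n" and s :: "nat \<Rightarrow> (real^'n) \<times> real \<Rightarrow> real^'n^'n"
  where "s 0 = (\<lambda>_. 0)" "\<And>k. subsolution \<Omega> (v k) (s k)"
    "\<And>j k::nat. j \<le> k \<Longrightarrow> \<bar>LINT z|lborel. v j z \<bullet> (v (Suc k) z - v k z)\<bar> \<le> (1/2) ^ k"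
    "\<And>(k::nat) z. \<bar>trace (s (Suc k) z) - trace (s k z)\<bar> \<le> (1/2) ^ k"
    "\<And>k. (LINT z|lborel. indicator \<Omega> z * (1 - (norm (v k z))\<^sup>2)\<^sup>2)
       \<le> 2 * gain_const TYPE('n) * (LINT z|lborel. (norm (v (Suc k) z - v k z))\<^sup>2) + (1/2) ^ k"
proof -
  \<comment> \<open>The third component collects all earlier velocities, to which the next perturbation has to be almost orthogonal.\<close>
  define ok where "ok X \<longleftrightarrow> (case X of (v, s, H) \<Rightarrow> subsolution \<Omega> v s \<and> finite H \<and> (\<forall>h\<in>H. Cc h) \<and> v \<in> H)"
    for X :: "((real^'n) \<times> real \<Rightarrow> real^'n) \<times> ((real^'n) \<times> real \<Rightarrow> real^'n^'n) \<times> ((real^'n) \<times> real \<Rightarrow> real^'n) set"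
  define nx where "nx k X Y \<longleftrightarrow> (case X of (v, s, H) \<Rightarrow> case Y of (v', s', H') \<Rightarrow> H \<subseteq> H'
      \<and> (\<forall>h\<in>H. \<bar>LINT z|lborel. h z \<bullet> (v' z - v z)\<bar> \<le> (1/2) ^ k)
      \<and> (\<forall>z. \<bar>trace (s' z) - trace (s z)\<bar> \<le> (1/2) ^ k)
      \<and> (LINT z|lborel. indicator \<Omega> z * (1 - (norm (v z))\<^sup>2)\<^sup>2)
          \<le> 2 * gain_const TYPE('n) * (LINT z|lborel. (norm (v' z - v z))\<^sup>2) + (1/2) ^ k)"
    for k :: nat and X Y :: "((real^'n) \<times> real \<Rightarrow> real^'n) \<times> ((real^'n) \<times> real \<Rightarrow> real^'n^'n) \<times> ((real^'n) \<times> real \<Rightarrow> real^'n) set"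
  have "\<exists>f. \<forall>k. (ok (f k) \<and> (k = 0 \<longrightarrow> fst (snd (f k)) = (\<lambda>_. 0))) \<and> nx k (f k) (f (Suc k))"
  proof (rule dependent_nat_choice)
    have "Cc (\<lambda>_::(real^'n) \<times> real. 0::real^'n)" by (simp add: Cc_def)
    then have "ok (\<lambda>_. 0, \<lambda>_. 0, {\<lambda>_. 0})" by (simp add: ok_def subsolution_zero)
    then show "\<exists>X. ok X \<and> (0 = (0::nat) \<longrightarrow> fst (snd X) = (\<lambda>_. 0))" by fastforce
  next
    fix X and k :: nat assume "ok X \<and> (k = 0 \<longrightarrow> fst (snd X) = (\<lambda>_. 0))"
    then obtain v s H where X: "X = (v, s, H)" "subsolution \<Omega> v s" "finite H" "\<And>h. h \<in> H \<Longrightarrow> Cc h" "v \<in> H"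
      unfolding ok_def by (cases X) auto
    obtain v' s' where st: "subsolution \<Omega> v' s'" "\<forall>h\<in>H. \<bar>LINT z|lborel. h z \<bullet> (v' z - v z)\<bar> \<le> (1/2) ^ k"
      "\<forall>z. \<bar>trace (s' z) - trace (s z)\<bar> \<le> (1/2) ^ k"
      "(LINT z|lborel. indicator \<Omega> z * (1 - (norm (v z))\<^sup>2)\<^sup>2)
          \<le> 2 * gain_const TYPE('n) * (LINT z|lborel. (norm (v' z - v z))\<^sup>2) + (1/2) ^ k"
    proof (rule subsolution_step[OF n \<Omega> X(2,3,4), of "(1/2) ^ k"])
      show "(0::real) < (1/2) ^ k" by simp
    qed (assumption | blast)+
    have "Cc v'" by (rule subsolution_Cc(1)[OF st(1) \<Omega>(2)])
    then have "ok (v', s', insert v' H)" using st(1) X(3,4) by (auto simp: ok_def)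
    moreover have "nx k X (v', s', insert v' H)" using st X(1) by (auto simp: nx_def)
    ultimately show "\<exists>Y. (ok Y \<and> (Suc k = 0 \<longrightarrow> fst (snd Y) = (\<lambda>_. 0))) \<and> nx k X Y" by blast
  qed
  then obtain f where f: "\<And>k. ok (f k)" "fst (snd (f 0)) = (\<lambda>_. 0)" "\<And>k. nx k (f k) (f (Suc k))" by blast
  define v where "v k = fst (f k)" for k
  define s where "s k = fst (snd (f k))" for k
  define H where "H k = snd (snd (f k))" for k
  have fe: "f k = (v k, s k, H k)" for k by (simp add: v_def s_def H_def)
  have okk: "subsolution \<Omega> (v k) (s k)" "v k \<in> H k" for k using f(1)[of k] by (auto simp: ok_def fe)
  have nxk: "H k \<subseteq> H (Suc k)" "\<forall>h\<in>H k. \<bar>LINT z|lborel. h z \<bullet> (v (Suc k) z - v k z)\<bar> \<le> (1/2) ^ k"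
      "\<forall>z. \<bar>trace (s (Suc k) z) - trace (s k z)\<bar> \<le> (1/2) ^ k"
      "(LINT z|lborel. indicator \<Omega> z * (1 - (norm (v k z))\<^sup>2)\<^sup>2)
          \<le> 2 * gain_const TYPE('n) * (LINT z|lborel. (norm (v (Suc k) z - v k z))\<^sup>2) + (1/2) ^ k" for k
    using f(3)[of k] unfolding nx_def fe by auto
  have "H j \<subseteq> H k" if "j \<le> k" for j k using that nxk(1) by (rule lift_Suc_mono_le[rotated]) 
  then have vH: "v j \<in> H k" if "j \<le> k" for j k using okk(2) that by blast
  show ?thesis
    by (rule that[of s v]) (use okk nxk vH f(2) in \<open>auto simp: s_def[of 0]\<close>)
qed

section \<open>Passage to the limit\<close>

lemma integrable_inner_Cc: "Cc f \<Longrightarrow> Cc g \<Longrightarrow> integrable lborel (\<lambda>z. f z \<bullet> g z)"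
proof (rule Cc_integrable)
  assume "Cc f" "Cc g"
  then obtain R where "\<And>z. norm z > R \<Longrightarrow> f z = 0" by (auto simp: Cc_def)
  then show "Cc (\<lambda>z. f z \<bullet> g z)" using \<open>Cc f\<close> \<open>Cc g\<close>
    by (auto simp: Cc_def intro!: continuous_intros exI[of _ R])
qed

text \<open>Pythagoras with summable errors. By telescoping, the pairing of \<open>v k\<close> with
  a later \<open>v m\<close> is close to the energy \<open>a k\<close>, so the squared distance is
  close to \<open>a m - a k\<close>. The energies are bounded and almost increasing, hence
  convergent.\<close>

lemma almost_orthogonal_L2_Cauchy:
  fixes v :: "nat \<Rightarrow> 'a::euclidean_space \<Rightarrow> 'b::euclidean_space"
  assumes Cc: "\<And>k. Cc (v k)" and bd: "\<And>k. (LINT z|lborel. (norm (v k z))\<^sup>2) \<le> A"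
    and orth: "\<And>j k. j \<le> k \<Longrightarrow> \<bar>LINT z|lborel. v j z \<bullet> (v (Suc k) z - v k z)\<bar> \<le> (1/2) ^ k"
  shows "(\<lambda>k. LINT z|lborel. (norm (v (Suc k) z - v k z))\<^sup>2) \<longlonglongrightarrow> 0"
    and "\<And>e. e > 0 \<Longrightarrow> \<exists>N. \<forall>i\<ge>N. \<forall>j\<ge>N. (LINT z|lborel. (norm (v i z - v j z))\<^sup>2) < e"
proof -
  let ?p = "\<lambda>j k. LINT z|lborel. v j z \<bullet> v k z"
  define a where "a k = (LINT z|lborel. (norm (v k z))\<^sup>2)" for k
  have i: "integrable lborel (\<lambda>z. v j z \<bullet> v k z)" for j k by (intro integrable_inner_Cc Cc)
  have a: "a k = ?p k k" for k by (simp add: a_def power2_norm_eq_inner)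
  have sym: "?p j k = ?p k j" for j k by (simp add: inner_commute)
  have dist: "(LINT z|lborel. (norm (v m z - v k z))\<^sup>2) = a m - 2 * ?p k m + a k" for m k
  proof -
    have "(norm (v m z - v k z))\<^sup>2 = v m z \<bullet> v m z - 2 * (v k z \<bullet> v m z) + v k z \<bullet> v k z" for z
      by (simp add: power2_norm_eq_inner inner_diff_left inner_diff_right inner_commute)
    then show ?thesis using i by (simp add: a)
  qed
  have orth': "\<bar>?p j (Suc k) - ?p j k\<bar> \<le> (1/2) ^ k" if "j \<le> k" for j k
    using orth[OF that] i by (simp add: inner_diff_right)
  \<comment> \<open>The bound is the geometric sum of the errors from \<open>k\<close> to
    \<open>k + m - 1\<close>, in the closed form in which the induction closes.\<close>
  have tele: "\<bar>?p k (k + m) - a k\<bar> \<le> 2 * (1/2) ^ k - 2 * (1/2) ^ (k + m)" for k m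
  proof (induction m)
    case (Suc m)
    then show ?case using orth'[of k "k + m"] by simp
  qed (simp add: a)
  \<comment> \<open>One step loses at most \<open>2 * (1/2) ^ k\<close> of energy, exactly the
    amount by which \<open>4 * (1/2) ^ k\<close> decreases in that step.\<close>
  have "incseq (\<lambda>k. a k - 4 * (1/2) ^ k)"
  proof (rule incseq_SucI)
    fix k
    have "0 \<le> (LINT z|lborel. (norm (v (Suc k) z - v k z))\<^sup>2)" by simp
    then show "a k - 4 * (1/2) ^ k \<le> a (Suc k) - 4 * (1/2) ^ Suc k"
      using orth'[of k k] unfolding dist by (simp add: a)
  qed
  moreover have "a k - 4 * (1/2) ^ k \<le> A" for k using bd[of k] unfolding a_def[symmetric]
    by (smt (verit) zero_le_power divide_nonneg_nonneg)
  ultimately obtain L where "(\<lambda>k. a k - 4 * (1/2) ^ k) \<longlonglongrightarrow> L"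
    using incseq_convergent[of "\<lambda>k. a k - 4 * (1/2) ^ k" A] by blast
  moreover have p0: "(\<lambda>k. c * (1/2::real) ^ k) \<longlonglongrightarrow> 0" for c
    by (intro tendsto_mult_right_zero LIMSEQ_power_zero) simp
  ultimately have "(\<lambda>k. (a k - 4 * (1/2) ^ k) + 4 * (1/2) ^ k) \<longlonglongrightarrow> L + 0" by (intro tendsto_add)
  then have aL: "a \<longlonglongrightarrow> L" by simp
  have "(\<lambda>k. a (Suc k) - a k + 2 * (1/2) ^ k) \<longlonglongrightarrow> L - L + 0"
    by (intro tendsto_add tendsto_diff LIMSEQ_Suc aL p0)
  then have up: "(\<lambda>k. a (Suc k) - a k + 2 * (1/2) ^ k) \<longlonglongrightarrow> 0" by simp
  show "(\<lambda>k. LINT z|lborel. (norm (v (Suc k) z - v k z))\<^sup>2) \<longlonglongrightarrow> 0"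
  proof (rule tendsto_sandwich[OF always_eventually always_eventually tendsto_const up])
    show "\<forall>k. 0 \<le> (LINT z|lborel. (norm (v (Suc k) z - v k z))\<^sup>2)" by simp
    show "\<forall>k. (LINT z|lborel. (norm (v (Suc k) z - v k z))\<^sup>2) \<le> a (Suc k) - a k + 2 * (1/2) ^ k"
    proof
      fix k show "(LINT z|lborel. (norm (v (Suc k) z - v k z))\<^sup>2) \<le> a (Suc k) - a k + 2 * (1/2) ^ k"
        using orth'[of k k] unfolding dist by (simp add: a)
    qed
  qed
  fix e :: real assume e: "e > 0"
  have "Cauchy a" using aL by (rule LIMSEQ_imp_Cauchy)
  then obtain N1 where N1: "\<And>i j. i \<ge> N1 \<Longrightarrow> j \<ge> N1 \<Longrightarrow> \<bar>a i - a j\<bar> < e/2"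
    using e unfolding Cauchy_def dist_real_def by (metis half_gt_zero)
  have "\<forall>\<^sub>F k in sequentially. 4 * (1/2) ^ k < e/2" by (rule order_tendstoD(2)[OF p0[of 4]]) (use e in simp)
  then obtain N2 where N2: "\<And>k. k \<ge> N2 \<Longrightarrow> 4 * (1/2) ^ k < e/2" by (auto simp: eventually_sequentially)
  have main: "(LINT z|lborel. (norm (v m z - v k z))\<^sup>2) < e" if "k \<ge> max N1 N2" "m \<ge> k" for k m
  proof -
    have "\<bar>?p k m - a k\<bar> \<le> 2 * (1/2) ^ k - 2 * (1/2) ^ m" using tele[of k "m - k"] that by simp
    then have "\<bar>?p k m - a k\<bar> \<le> 2 * (1/2) ^ k" by (smt (verit) zero_le_power divide_nonneg_nonneg)
    then show ?thesis using N1[of m k] N2[of k] that unfolding dist by linarith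
  qed
  show "\<exists>N. \<forall>i\<ge>N. \<forall>j\<ge>N. (LINT z|lborel. (norm (v i z - v j z))\<^sup>2) < e"
  proof (intro exI allI impI)
    fix i j assume ij: "i \<ge> max N1 N2" "j \<ge> max N1 N2"
    show "(LINT z|lborel. (norm (v i z - v j z))\<^sup>2) < e"
      using main[of j i] main[of i j] ij by (cases "i \<ge> j") (auto simp: norm_minus_commute)
  qed
qed

text \<open>On a set of finite measure \<open>x \<le> t + x^2 / t\<close> turns the L2 Cauchy
  property into the L1 one, and an L1 Cauchy sequence has an almost everywhere Cauchy
  subsequence.\<close>

lemma L2_Cauchy_AE_convergent_subseq:
  fixes v :: "nat \<Rightarrow> 'a::euclidean_space \<Rightarrow> 'b::euclidean_space"
  assumes \<Omega>: "open \<Omega>" "bounded \<Omega>" and c: "\<And>k. continuous_on UNIV (v k)" and z: "\<And>k z. z \<notin> \<Omega> \<Longrightarrow> v k z = 0"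
    and L2: "\<And>e. e > 0 \<Longrightarrow> \<exists>N. \<forall>i\<ge>N. \<forall>j\<ge>N. (LINT z|lborel. (norm (v i z - v j z))\<^sup>2) < e"
  obtains r where "strict_mono r" "AE z in lborel. (\<lambda>j. v (r j) z) \<longlonglongrightarrow> lim (\<lambda>j. v (r j) z)"
proof -
  define A where "A = measure lborel \<Omega>"
  have i\<Omega>: "integrable lborel (indicat_real \<Omega>)"
    using emeasure_bounded_finite[OF \<Omega>(2)] \<Omega>(1) by (intro integrable_real_indicator) (auto intro: borel_open)
  have Cc: "Cc (\<lambda>z. v i z - v j z)" for i j
    by (rule Cc_bounded_support[OF _ \<Omega>(2)]) (use c z in \<open>auto intro!: continuous_intros\<close>)
  have Ccv: "Cc (v i)" for i by (rule Cc_bounded_support[OF c \<Omega>(2) z])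
  have "\<exists>N. \<forall>i\<ge>N. \<forall>j\<ge>N. (LINT z|lborel. norm (v i z - v j z)) < e" if e: "e > 0" for e
  proof -
    \<comment> \<open>After integration both terms of \<open>t + x^2 / t\<close> are below
      \<open>e/2\<close>; the summand 1 in \<open>A + 1\<close> keeps the denominator
      positive.\<close>
    define t where "t = e / (2 * (A + 1))"
    have A0: "A \<ge> 0" by (simp add: A_def)
    have t: "t > 0" "t * A < e / 2" using e A0 by (auto simp: t_def field_simps)
    obtain N where N: "\<And>i j. i \<ge> N \<Longrightarrow> j \<ge> N \<Longrightarrow> (LINT z|lborel. (norm (v i z - v j z))\<^sup>2) < t * (e / 2)"
      using L2[of "t * (e/2)"] t e by auto
    have "(LINT z|lborel. norm (v i z - v j z)) < e" if "i \<ge> N" "j \<ge> N" for i j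
    proof -
      have i2: "integrable lborel (\<lambda>z. (norm (v i z - v j z))\<^sup>2)"
        unfolding power2_norm_eq_inner by (intro integrable_inner_Cc Cc)
      have "(LINT z|lborel. norm (v i z - v j z)) \<le> (LINT z|lborel. t * indicator \<Omega> z + (1/t) * (norm (v i z - v j z))\<^sup>2)"
      proof (rule integral_mono)
        show "integrable lborel (\<lambda>z. norm (v i z - v j z))" by (intro integrable_norm Cc_integrable Cc)
        show "integrable lborel (\<lambda>z. t * indicator \<Omega> z + (1/t) * (norm (v i z - v j z))\<^sup>2)"
          by (intro Bochner_Integration.integrable_add integrable_mult_right i\<Omega> i2)
        fix y
        let ?x = "norm (v i y - v j y)"
        show "?x \<le> t * indicator \<Omega> y + (1/t) * ?x\<^sup>2"
        proof (cases "y \<in> \<Omega>")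
          case True
          have "0 \<le> (t - ?x)\<^sup>2 + t * ?x" using t by simp
          then have "t * ?x \<le> t * t + ?x\<^sup>2" by (simp add: power2_eq_square algebra_simps)
          then show ?thesis using True t(1) by (simp add: field_simps)
        qed (simp add: z)
      qed
      also have "\<dots> = t * A + (1/t) * (LINT z|lborel. (norm (v i z - v j z))\<^sup>2)"
        using i\<Omega> i2 by (simp add: A_def)
      also have "\<dots> < e/2 + (1/t) * (t * (e/2))"
        using t N[OF that] by (intro add_strict_mono mult_strict_left_mono) auto
      also have "\<dots> = e" using t by simp
      finally show ?thesis .
    qed
    then show ?thesis by blast
  qed
  then obtain r where r: "strict_mono r" "AE x in lborel. Cauchy (\<lambda>i. v (r i) x)"
    using cauchy_L1_AE_cauchy_subseq[of lborel v, OF Cc_integrable[OF Ccv]] by blast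
  have "AE z in lborel. (\<lambda>j. v (r j) z) \<longlonglongrightarrow> lim (\<lambda>j. v (r j) z)"
    using r(2) by eventually_elim (simp add: Cauchy_convergent convergent_LIMSEQ_iff[symmetric])
  then show ?thesis using that r(1) by blast
qed

text \<open>The condition is linear in the field, so bounded almost everywhere convergence suffices,
  dominated by the compactly supported derivatives of the test function. Quadratic terms enter
  later, when the limit of \<open>s\<close> is identified.\<close>

lemma weak_divfree_limit:
  fixes F :: "nat \<Rightarrow> 'a::euclidean_space \<Rightarrow> 'a"
  assumes F: "\<And>k. weak_divfree (F k)" "\<And>k. F k \<in> borel_measurable borel" "\<And>k z. norm (F k z) \<le> C"
    and G: "G \<in> borel_measurable borel" and lim: "AE z in lborel. (\<lambda>k. F k z) \<longlonglongrightarrow> G z"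
  shows "weak_divfree G"
  unfolding weak_divfree_def
proof (intro allI impI)
  fix \<phi> :: "'a \<Rightarrow> real" assume t: "test_function \<phi>"
  let ?D = "\<lambda>z. frechet_derivative \<phi> (at z)"
  note C1 = test_function_C1c[OF t]
  have ex: "?D z h = (\<Sum>b\<in>Basis. (h \<bullet> b) * ?D z b)" for z h by (rule frechet_apply_sum[OF C1])
  have Cb: "Cc (\<lambda>z. ?D z b)" for b by (rule C1c_deriv_Cc[OF C1])
  have [measurable]: "(\<lambda>z. ?D z b) \<in> borel_measurable borel" for b by (rule Cc_measurable[OF Cb])
  note F(2)[measurable] G[measurable]
  have m: "(\<lambda>z. ?D z (H z)) \<in> borel_measurable lborel" if [measurable]: "H \<in> borel_measurable borel" for H
  proof -
    have "(\<lambda>z. \<Sum>b\<in>Basis. (H z \<bullet> b) * ?D z b) \<in> borel_measurable lborel" by measurable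
    also have "(\<lambda>z. \<Sum>b\<in>Basis. (H z \<bullet> b) * ?D z b) = (\<lambda>z. ?D z (H z))" by (rule ext, rule ex[symmetric])
    finally show ?thesis .
  qed
  have "(\<lambda>k. LINT z|lborel. ?D z (F k z)) \<longlonglongrightarrow> (LINT z|lborel. ?D z (G z))"
  proof (rule integral_dominated_convergence[where w = "\<lambda>z. \<Sum>b\<in>Basis. C * \<bar>?D z b\<bar>"])
    show "integrable lborel (\<lambda>z. \<Sum>b\<in>Basis. C * \<bar>?D z b\<bar>)"
      by (intro Bochner_Integration.integrable_sum integrable_mult_right integrable_abs Cc_integrable Cb)
    show "AE z in lborel. (\<lambda>k. ?D z (F k z)) \<longlonglongrightarrow> ?D z (G z)"
      using lim
    proof eventually_elim
      case (elim z)
      have "(\<lambda>k. \<Sum>b\<in>Basis. (F k z \<bullet> b) * ?D z b) \<longlonglongrightarrow> (\<Sum>b\<in>Basis. (G z \<bullet> b) * ?D z b)"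
        by (intro tendsto_intros elim)
      then show ?case unfolding ex[symmetric] .
    qed
    show "AE z in lborel. norm (?D z (F k z)) \<le> (\<Sum>b\<in>Basis. C * \<bar>?D z b\<bar>)" for k
    proof (rule AE_I2)
      fix z
      have "norm (?D z (F k z)) = \<bar>\<Sum>b\<in>Basis. (F k z \<bullet> b) * ?D z b\<bar>" unfolding ex[symmetric] by simp
      also have "\<dots> \<le> (\<Sum>b\<in>Basis. C * \<bar>?D z b\<bar>)"
      proof (intro order_trans[OF sum_abs] sum_mono)
        fix b :: 'a assume "b \<in> Basis"
        then have "\<bar>F k z \<bullet> b\<bar> \<le> C" using Basis_le_norm[of b "F k z"] F(3)[of k z] by linarith
        then show "\<bar>F k z \<bullet> b * ?D z b\<bar> \<le> C * \<bar>?D z b\<bar>" by (simp add: abs_mult mult_right_mono)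
      qed
      finally show "norm (?D z (F k z)) \<le> (\<Sum>b\<in>Basis. C * \<bar>?D z b\<bar>)" .
    qed
  qed (use m F(2) G in auto)
  moreover have "(LINT z|lborel. ?D z (F k z)) = 0" for k using F(1) t by (simp add: weak_divfree_def)
  ultimately show "(LINT z|lborel. ?D z (G z)) = 0" by (simp add: LIMSEQ_const_iff)
qed

lemma integrable_bounded_mult_Cc:
  fixes f :: "'a::euclidean_space \<Rightarrow> real"
  assumes "f \<in> borel_measurable borel" "AE z in lborel. \<bar>f z\<bar> \<le> C" "Cc g"
  shows "integrable lborel (\<lambda>z. f z * g z)"
proof (rule Bochner_Integration.integrable_bound)
  show "integrable lborel (\<lambda>z. C * g z)" by (intro integrable_mult_right Cc_integrable assms)
  show "(\<lambda>z. f z * g z) \<in> borel_measurable lborel" using assms(1) Cc_measurable[OF assms(3)] by simp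
  show "AE z in lborel. norm (f z * g z) \<le> norm (C * g z)"
    using assms(2) by eventually_elim (auto simp: abs_mult intro!: mult_right_mono)
qed

text \<open>Linearity of the derivative splits the space-time direction into coordinate directions;
  boundedness of \<open>v\<close> and \<open>p\<close> makes each resulting term integrable, so the
  integral splits as well.\<close>

lemma euler_distributionalI:
  fixes v :: "(real^'n) \<times> real \<Rightarrow> real^'n" and p :: "(real^'n) \<times> real \<Rightarrow> real"
  assumes v: "v \<in> borel_measurable borel" "AE z in lborel. norm (v z) \<le> 1"
    and p: "p \<in> borel_measurable borel" "AE z in lborel. \<bar>p z\<bar> \<le> C"
    and div: "weak_divfree (\<lambda>z. (v z, 0))"
    and mom: "\<And>i. weak_divfree (\<lambda>z. (v z $ i *\<^sub>R v z + p z *\<^sub>R axis i 1, v z $ i))"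
  shows "euler_distributional v p"
  unfolding euler_distributional_def
proof (intro allI impI conjI)
  fix \<phi> :: "(real^'n) \<times> real \<Rightarrow> real" assume t: "test_function \<phi>"
  let ?D = "\<lambda>z. frechet_derivative \<phi> (at z)"
  note C1 = test_function_C1c[OF t]
  have l: "linear (?D z)" for z by (rule C1c_linear[OF C1])
  have Cb: "Cc (\<lambda>z. ?D z b)" for b by (rule C1c_deriv_Cc[OF C1])
  have vm[measurable]: "(\<lambda>z. v z $ i) \<in> borel_measurable borel" for i
    using borel_measurable_inner[OF v(1) borel_measurable_const[of "axis i 1"]] by (simp add: inner_axis)
  have vb: "AE z in lborel. \<bar>v z $ i\<bar> \<le> 1" for i
    using v(2) by eventually_elim (meson component_le_norm_cart order_trans)
  have vvb: "AE z in lborel. \<bar>v z $ i * v z $ j\<bar> \<le> 1" for i j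
    using vb[of i] vb[of j] by eventually_elim (auto simp: abs_mult intro: mult_le_one)
  have i1: "integrable lborel (\<lambda>z. v z $ i * ?D z b)" for i b
    by (rule integrable_bounded_mult_Cc[OF vm vb Cb])
  have i2: "integrable lborel (\<lambda>z. v z $ i * v z $ j * ?D z b)" for i j b
    by (rule integrable_bounded_mult_Cc[OF _ vvb Cb]) measurable
  have i3: "integrable lborel (\<lambda>z. p z * ?D z b)" for b
    by (rule integrable_bounded_mult_Cc[OF p Cb])
  have sp: "?D z (w, 0) = (\<Sum>j\<in>UNIV. w $ j * ?D z (axis j 1, 0))" for z and w :: "real^'n"
  proof -
    have "(w, 0::real) = (\<Sum>j\<in>UNIV. (w $ j) *\<^sub>R (axis j 1, 0))"
      using basis_expansion[of w] by (simp add: sum_prod scalar_mult_eq_scaleR)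
    then have "?D z (w, 0) = ?D z (\<Sum>j\<in>UNIV. (w $ j) *\<^sub>R (axis j 1, 0))" by (rule arg_cong)
    then show ?thesis by (simp only: linear_sum[OF l] linear_scale[OF l] real_scaleR_def)
  qed
  show "(\<Sum>j\<in>UNIV. D_x j (distr_of (\<lambda>z. v z $ j)) \<phi>) = 0"
  proof -
    have "0 = (LINT z|lborel. ?D z (v z, 0))" using div t by (simp add: weak_divfree_def)
    also have "(\<lambda>z. ?D z (v z, 0)) = (\<lambda>z. \<Sum>j\<in>UNIV. v z $ j * ?D z (axis j 1, 0))" by (rule ext, rule sp)
    also have "(LINT z|lborel. (\<Sum>j\<in>UNIV. v z $ j * ?D z (axis j 1, 0))) = (\<Sum>j\<in>UNIV. LINT z|lborel. v z $ j * ?D z (axis j 1, 0))"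
      by (rule Bochner_Integration.integral_sum) (rule i1)
    finally show ?thesis by (simp add: D_x_def distr_deriv_def distr_of_def sum_negf)
  qed
  fix i
  have eq: "?D z (v z $ i *\<^sub>R v z + p z *\<^sub>R axis i 1, v z $ i)
      = v z $ i * ?D z (0, 1) + (\<Sum>j\<in>UNIV. v z $ i * v z $ j * ?D z (axis j 1, 0)) + p z * ?D z (axis i 1, 0)" for z
  proof -
    have "(v z $ i *\<^sub>R v z + p z *\<^sub>R axis i 1, v z $ i)
        = (v z $ i) *\<^sub>R (0, 1) + (v z $ i) *\<^sub>R (v z, 0) + p z *\<^sub>R (axis i 1, 0)"
      by simp
    then show ?thesis
      by (simp only: linear_add[OF l] linear_scale[OF l] sp[of z "v z"] real_scaleR_def sum_distrib_left mult.assoc)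
  qed
  have "(LINT z|lborel. ?D z (v z $ i *\<^sub>R v z + p z *\<^sub>R axis i 1, v z $ i)) = 0"
    using mom[of i] t unfolding weak_divfree_def by blast
  then have "(LINT z|lborel. v z $ i * ?D z (0, 1) + (\<Sum>j\<in>UNIV. v z $ i * v z $ j * ?D z (axis j 1, 0)) + p z * ?D z (axis i 1, 0)) = 0"
    unfolding eq .
  then have "(LINT z|lborel. v z $ i * ?D z (0, 1)) + (\<Sum>j\<in>UNIV. LINT z|lborel. v z $ i * v z $ j * ?D z (axis j 1, 0))
      + (LINT z|lborel. p z * ?D z (axis i 1, 0)) = 0"
    using i1 i2 i3 by simp
  then show "D_t (distr_of (\<lambda>z. v z $ i)) \<phi> + (\<Sum>j\<in>UNIV. D_x j (distr_of (\<lambda>z. v z $ i * v z $ j)) \<phi>) + D_x i (distr_of p) \<phi> = 0"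
    by (simp add: D_x_def D_t_def distr_deriv_def distr_of_def sum_negf)
qed

lemma subsolution_gap_row:
  assumes "subsolution \<Omega> v s"
  shows "(norm (gap_row (v z) (s z) i))\<^sup>2 \<le> 1 - (norm (v z))\<^sup>2"
proof -
  obtain \<gamma> where \<gamma>: "\<gamma> > 0" "\<And>z x. gap (v z) (s z) x \<ge> \<gamma> * (x \<bullet> x)"
    using assms unfolding subsolution_def by blast
  show ?thesis by (rule gap_row_norm_le[OF subsolutionD(5)[OF assms] \<gamma>])
qed

lemma Euler_solution_unit_speed:
  fixes \<Omega> :: "((real^'n) \<times> real) set"
  assumes n: "CARD('n) \<ge> 2" and \<Omega>: "open \<Omega>" "bounded \<Omega>"
  obtains v :: "(real^'n) \<times> real \<Rightarrow> real^'n" and p :: "(real^'n) \<times> real \<Rightarrow> real"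
  where "v \<in> borel_measurable borel" "p \<in> borel_measurable borel"
    "\<And>z. z \<notin> \<Omega> \<Longrightarrow> v z = 0" "\<And>z. z \<notin> \<Omega> \<Longrightarrow> p z = 0"
    "AE z in lborel. norm (v z) = indicator \<Omega> z" "AE z in lborel. \<bar>p z\<bar> \<le> 3"
    "euler_distributional v p"
proof -
  let ?N = "real CARD('n)"
  have N: "?N \<ge> 2" "1 / ?N \<le> 1" using n by auto
  obtain w :: "nat \<Rightarrow> (real^'n) \<times> real \<Rightarrow> real^'n" and s :: "nat \<Rightarrow> (real^'n) \<times> real \<Rightarrow> real^'n^'n"
    where s0: "s 0 = (\<lambda>_. 0)" and sub: "\<And>k. subsolution \<Omega> (w k) (s k)"
    and orth: "\<And>j k::nat. j \<le> k \<Longrightarrow> \<bar>LINT z|lborel. w j z \<bullet> (w (Suc k) z - w k z)\<bar> \<le> (1/2) ^ k"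
    and tr: "\<And>(k::nat) z. \<bar>trace (s (Suc k) z) - trace (s k z)\<bar> \<le> (1/2) ^ k"
    and gain: "\<And>k. (LINT z|lborel. indicator \<Omega> z * (1 - (norm (w k z))\<^sup>2)\<^sup>2)
       \<le> 2 * gain_const TYPE('n) * (LINT z|lborel. (norm (w (Suc k) z - w k z))\<^sup>2) + (1/2) ^ k"
    apply (rule subsolution_sequence[OF n \<Omega>])
    subgoal for w s by (rule that[of s w]) assumption+
    done
  have cw: "continuous_on UNIV (w k)" "continuous_on UNIV (s k)" for k using subsolutionD[OF sub] by blast+
  have zw: "w k z = 0" "s k z = 0" if "z \<notin> \<Omega>" for k z using subsolutionD(3,4)[OF sub that] by blast+
  have nw: "norm (w k z) \<le> 1" for k z by (rule subsolution_norm_le[OF sub])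
  have Ccw: "Cc (w k)" for k by (rule subsolution_Cc(1)[OF sub \<Omega>(2)])
  have i\<Omega>: "integrable lborel (indicat_real \<Omega>)"
    using emeasure_bounded_finite[OF \<Omega>(2)] \<Omega>(1) by (intro integrable_real_indicator) (auto intro: borel_open)
  have \<Omega>m[measurable]: "\<Omega> \<in> sets borel" using \<Omega>(1) by (rule borel_open)
  have wm[measurable]: "w k \<in> borel_measurable borel" for k by (rule borel_measurable_continuous_onI[OF cw(1)])
  have bd: "(LINT z|lborel. (norm (w k z))\<^sup>2) \<le> measure lborel \<Omega>" for k
  proof -
    have "(LINT z|lborel. (norm (w k z))\<^sup>2) \<le> (LINT z|lborel. indicator \<Omega> z)"
    proof (rule integral_mono[OF _ i\<Omega>])
      show "integrable lborel (\<lambda>z. (norm (w k z))\<^sup>2)"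
        unfolding power2_norm_eq_inner by (intro integrable_inner_Cc Ccw)
      show "(norm (w k z))\<^sup>2 \<le> indicator \<Omega> z" for z
        using nw[of k z] zw[of z k] by (cases "z \<in> \<Omega>") (auto simp: abs_square_le_1)
    qed
    then show ?thesis by simp
  qed
  note L2 = almost_orthogonal_L2_Cauchy[OF Ccw bd orth]
  obtain r where r: "strict_mono r" and AEc: "AE z in lborel. (\<lambda>j. w (r j) z) \<longlonglongrightarrow> lim (\<lambda>j. w (r j) z)"
    by (rule L2_Cauchy_AE_convergent_subseq[OF \<Omega> cw(1) zw(1) L2(2)])
  define v where "v z = lim (\<lambda>j. w (r j) z)" for z
  have AEv: "AE z in lborel. (\<lambda>j. w (r j) z) \<longlonglongrightarrow> v z" using AEc by (simp add: v_def)
  have vm[measurable]: "v \<in> borel_measurable borel" unfolding v_def by measurable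
  \<comment> \<open>Outside \<open>\<Omega>\<close> the sequence is constantly zero, so
    \<open>lim\<close> gives 0 at every such point and not only almost everywhere.\<close>
  have v0: "v z = 0" if "z \<notin> \<Omega>" for z using zw(1)[OF that] by (simp add: v_def lim_const)
  define q where "q k z = trace (s k z) / ?N" for k z
  define qq where "qq z = lim (\<lambda>k. q k z)" for z
  have dq: "\<bar>q (Suc k) z - q k z\<bar> \<le> (1/2) ^ k" for k z
  proof -
    have "\<bar>q (Suc k) z - q k z\<bar> = \<bar>trace (s (Suc k) z) - trace (s k z)\<bar> / ?N"
      by (simp add: q_def diff_divide_distrib[symmetric] abs_divide)
    also have "\<dots> \<le> \<bar>trace (s (Suc k) z) - trace (s k z)\<bar> / 1" using N by (intro divide_left_mono) auto
    also have "\<dots> \<le> (1/2) ^ k" using tr[of k z] by simp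
    finally show ?thesis .
  qed
  have q0: "q 0 z = 0" for z by (simp add: q_def s0 trace_def)
  \<comment> \<open>A telescoping sum starting from \<open>q 0 = 0\<close> with terms at most
    \<open>(1/2) ^ k\<close>: it converges at every point, and the bound 2 below is the geometric
    series.\<close>
  have qlim: "(\<lambda>k. q k z) \<longlonglongrightarrow> qq z" for z
  proof -
    have "summable (\<lambda>k. q (Suc k) z - q k z)"
      by (rule summable_comparison_test'[of "\<lambda>k. (1/2) ^ k" 0]) (use dq in auto)
    then have "convergent (\<lambda>m. \<Sum>k<m. q (Suc k) z - q k z)" by (simp add: summable_iff_convergent)
    then have "convergent (\<lambda>m. q m z)" by (simp add: sum_lessThan_telescope[of "\<lambda>k. q k z"] q0)
    then show ?thesis by (simp add: qq_def convergent_LIMSEQ_iff)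
  qed
  have qb: "\<bar>q k z\<bar> \<le> 2" for k z
  proof -
    have "\<bar>q k z\<bar> \<le> 2 - 2 * (1/2) ^ k"
    proof (induction k)
      case (Suc k)
      then show ?case using dq[of k z] by simp
    qed (simp add: q0)
    also have "\<dots> \<le> 2" by simp
    finally show ?thesis .
  qed
  have qqb: "\<bar>qq z\<bar> \<le> 2" for z
    by (rule LIMSEQ_le_const2[OF tendsto_rabs[OF qlim]]) (use qb in auto)
  have qm[measurable]: "q k \<in> borel_measurable borel" for k
    unfolding q_def trace_def using cw(2)[of k]
    by (intro borel_measurable_continuous_onI continuous_intros) auto
  have qqm[measurable]: "qq \<in> borel_measurable borel" unfolding qq_def by measurable
  \<comment> \<open>Inside \<open>\<Omega>\<close> this is \<open>(tr s - 1) / n\<close> in the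
    limit. Outside, \<open>s\<close> and \<open>v\<close> vanish, so the indicator is needed for the
    limit of \<open>s $ i\<close> to be the Euler flux on the whole of space-time.\<close>
  define p where "p z = qq z - indicator \<Omega> z / ?N" for z
  have pm: "p \<in> borel_measurable borel" unfolding p_def by measurable
  have p0: "p z = 0" if "z \<notin> \<Omega>" for z
  proof -
    have "q k z = 0" for k using zw(2)[OF that] by (simp add: q_def trace_def)
    then show ?thesis using that by (simp add: p_def qq_def lim_const)
  qed
  have pb: "\<bar>p z\<bar> \<le> 3" for z
  proof -
    have "0 \<le> indicator \<Omega> z / ?N" "indicator \<Omega> z / ?N \<le> 1" using N by (simp_all add: indicator_def)
    then show ?thesis unfolding p_def using qqb[of z] by linarith
  qed
  have unit: "AE z in lborel. norm (v z) = indicator \<Omega> z"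
  proof -
    let ?g = "\<lambda>u z. indicator \<Omega> z * (1 - (norm (u z :: real^'n))\<^sup>2)\<^sup>2 :: real"
    have gb: "norm (?g (w k) z) \<le> indicator \<Omega> z" for k z
      using nw[of k z] by (auto simp: indicator_def abs_square_le_1 power_le_one)
    have gm: "?g u \<in> borel_measurable lborel" if [measurable]: "u \<in> borel_measurable borel" for u
      by measurable
    have "(\<lambda>j. LINT z|lborel. ?g (w (r j)) z) \<longlonglongrightarrow> (LINT z|lborel. ?g v z)"
    proof (rule integral_dominated_convergence[where w = "indicat_real \<Omega>"])
      show "AE z in lborel. (\<lambda>j. ?g (w (r j)) z) \<longlonglongrightarrow> ?g v z"
        using AEv by eventually_elim (intro tendsto_intros)
      show "AE z in lborel. norm (?g (w (r j)) z) \<le> indicator \<Omega> z" for j by (intro AE_I2 gb)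
    qed (intro gm wm vm i\<Omega>)+
    \<comment> \<open>The gain estimate bounds the defect by the energy of the next increment, which
      tends to 0; so the limit along \<open>r\<close> has no defect.\<close>
    moreover have "(\<lambda>j. LINT z|lborel. ?g (w (r j)) z) \<longlonglongrightarrow> 0"
    proof -
      have "(\<lambda>k. 2 * gain_const TYPE('n) * (LINT z|lborel. (norm (w (Suc k) z - w k z))\<^sup>2) + (1/2) ^ k) \<longlonglongrightarrow> 2 * gain_const TYPE('n) * 0 + 0"
        by (intro tendsto_add tendsto_mult L2(1) tendsto_const LIMSEQ_power_zero) auto
      then have up: "(\<lambda>k. 2 * gain_const TYPE('n) * (LINT z|lborel. (norm (w (Suc k) z - w k z))\<^sup>2) + (1/2) ^ k) \<longlonglongrightarrow> 0"
        by simp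
      have "(\<lambda>k. LINT z|lborel. ?g (w k) z) \<longlonglongrightarrow> 0"
      proof (rule tendsto_sandwich[OF always_eventually always_eventually tendsto_const up])
        show "\<forall>k. 0 \<le> (LINT z|lborel. ?g (w k) z)" by (intro allI Bochner_Integration.integral_nonneg) simp
      qed (intro allI gain)
      from LIMSEQ_subseq_LIMSEQ[OF this r] show ?thesis by (simp only: o_def)
    qed
    ultimately have z: "(LINT z|lborel. ?g v z) = 0" by (rule LIMSEQ_unique)
    have nv: "AE z in lborel. norm (v z) \<le> 1"
      using AEv
    proof eventually_elim
      case (elim z)
      show ?case by (rule LIMSEQ_le_const2[OF tendsto_norm[OF elim]]) (intro exI allI impI nw)
    qed
    have "integrable lborel (?g v)"
    proof (rule Bochner_Integration.integrable_bound[OF i\<Omega>])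
      show "AE z in lborel. norm (?g v z) \<le> norm (indicat_real \<Omega> z)"
        using nv by eventually_elim (auto simp: indicator_def abs_square_le_1 power_le_one)
    qed (intro gm vm)
    from integral_nonneg_eq_0_iff_AE[OF this] z have "AE z in lborel. ?g v z = 0" by simp
    then show ?thesis
    proof eventually_elim
      case (elim z)
      show ?case
      proof (cases "z \<in> \<Omega>")
        case True
        then have "(norm (v z))\<^sup>2 = 1" using elim by simp
        then show ?thesis using True norm_ge_zero[of "v z"] by (auto simp: power2_eq_1_iff simp del: norm_ge_zero)
      qed (simp add: v0)
    qed
  qed
  \<comment> \<open>The rows of the form have norm at most the square root of
    \<open>1 - |w|^2\<close> and tend to 0, while \<open>w\<close> and \<open>q\<close> converge.
    Solving the definition of \<open>gap_row\<close> for \<open>s $ i\<close> gives its pointwise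
    limit.\<close>
  have row: "AE z in lborel. (\<lambda>j. s (r j) z $ i) \<longlonglongrightarrow> v z $ i *\<^sub>R v z + p z *\<^sub>R axis i 1" for i
    using AEv unit
  proof eventually_elim
    case (elim z)
    show ?case
    proof (cases "z \<in> \<Omega>")
      case False
      then show ?thesis using zw(2)[OF False] v0[OF False] p0[OF False] by simp
    next
      case True
      let ?w = "\<lambda>j. gap_row (w (r j) z) (s (r j) z) i"
      have "(\<lambda>j. 1 - (norm (w (r j) z))\<^sup>2) \<longlonglongrightarrow> 1 - (norm (v z))\<^sup>2" by (intro tendsto_intros elim(1))
      then have up: "(\<lambda>j. 1 - (norm (w (r j) z))\<^sup>2) \<longlonglongrightarrow> 0" using elim(2) True by simp
      have "(\<lambda>j. (norm (?w j))\<^sup>2) \<longlonglongrightarrow> 0"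
        by (rule tendsto_sandwich[OF always_eventually always_eventually tendsto_const up])
          (intro allI zero_le_power2, intro allI subsolution_gap_row[OF sub])
      then have "(\<lambda>j. sqrt ((norm (?w j))\<^sup>2)) \<longlonglongrightarrow> sqrt 0" by (rule tendsto_real_sqrt)
      then have w0: "?w \<longlonglongrightarrow> 0" by (simp add: tendsto_norm_zero_iff)
      have ql: "(\<lambda>j. q (r j) z) \<longlonglongrightarrow> qq z" using LIMSEQ_subseq_LIMSEQ[OF qlim r] by (simp add: o_def)
      have "(\<lambda>j. ?w j + (w (r j) z $ i) *\<^sub>R w (r j) z + (q (r j) z - 1 / ?N) *\<^sub>R axis i 1)
          \<longlonglongrightarrow> 0 + (v z $ i) *\<^sub>R v z + (qq z - 1 / ?N) *\<^sub>R axis i 1"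
        by (intro tendsto_intros w0 ql elim(1))
      moreover have "s (r j) z $ i = ?w j + (w (r j) z $ i) *\<^sub>R w (r j) z + (q (r j) z - 1 / ?N) *\<^sub>R axis i 1" for j
        by (simp add: gap_row_def q_def diff_divide_distrib algebra_simps)
      ultimately show ?thesis using True by (simp add: p_def)
    qed
  qed
  \<comment> \<open>The same decomposition bounds \<open>s\<close> uniformly: 1 for the row, 1 for
    the product, 3 for the scalar part. This dominates the momentum fields in the limit.\<close>
  have sb: "norm (s k z $ i) \<le> 6" for k z i
  proof -
    have "(norm (gap_row (w k z) (s k z) i))\<^sup>2 \<le> 1 - (norm (w k z))\<^sup>2" by (rule subsolution_gap_row[OF sub])
    then have "(norm (gap_row (w k z) (s k z) i))\<^sup>2 \<le> 1" using zero_le_power2[of "norm (w k z)"] by linarith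
    then have a: "norm (gap_row (w k z) (s k z) i) \<le> 1" by (simp add: abs_square_le_1)
    have "\<bar>w k z $ i\<bar> \<le> 1" using component_le_norm_cart[of "w k z" i] nw[of k z] by linarith
    then have b: "norm ((w k z $ i) *\<^sub>R w k z) \<le> 1" using nw[of k z] by (simp add: mult_le_one)
    have c: "norm ((q k z - 1 / ?N) *\<^sub>R (axis i 1 :: real^'n)) \<le> 3"
    proof -
      have "0 \<le> 1 / ?N" by simp
      then have "\<bar>q k z - 1 / ?N\<bar> \<le> 3" using qb[of k z] N(2) by linarith
      then show ?thesis by (simp add: norm_axis_1)
    qed
    have eq: "s k z $ i = gap_row (w k z) (s k z) i + ((w k z $ i) *\<^sub>R w k z + (q k z - 1 / ?N) *\<^sub>R axis i 1)"
      by (simp add: gap_row_def q_def diff_divide_distrib algebra_simps)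
    show ?thesis unfolding eq
      by (rule norm_triangle_le, rule order_trans[OF add_left_mono[OF norm_triangle_ineq]]) (use a b c in linarith)
  qed
  have vi[measurable]: "(\<lambda>z. v z $ i) \<in> borel_measurable borel" for i
    using borel_measurable_inner[OF vm borel_measurable_const[of "axis i 1"]] by (simp add: inner_axis)
  have div: "weak_divfree (\<lambda>z. (v z, 0))"
  proof (rule weak_divfree_limit[where F = "\<lambda>j z. (w (r j) z, 0)" and C = 1])
    show "weak_divfree (\<lambda>z. (w (r k) z, 0))" for k using subsolutionD[OF sub] by blast
    show "(\<lambda>z. (w (r k) z, 0::real)) \<in> borel_measurable borel" for k
      by (intro borel_measurable_continuous_onI continuous_intros cw)
    show "norm (w (r k) z, 0::real) \<le> 1" for k z using nw by (simp add: norm_Pair)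
    show "(\<lambda>z. (v z, 0::real)) \<in> borel_measurable borel" by (intro borel_measurable_Pair) auto
    show "AE z in lborel. (\<lambda>j. (w (r j) z, 0::real)) \<longlonglongrightarrow> (v z, 0)"
      using AEv by eventually_elim (intro tendsto_intros)
  qed
  have mom: "weak_divfree (\<lambda>z. (v z $ i *\<^sub>R v z + p z *\<^sub>R axis i 1, v z $ i))" for i
  proof (rule weak_divfree_limit[where F = "\<lambda>j z. (s (r j) z $ i, w (r j) z $ i)" and C = 7])
    show "weak_divfree (\<lambda>z. (s (r k) z $ i, w (r k) z $ i))" for k using subsolutionD[OF sub] by blast
    show "(\<lambda>z. (s (r k) z $ i, w (r k) z $ i)) \<in> borel_measurable borel" for k
      by (intro borel_measurable_continuous_onI continuous_intros cw)
    show "norm (s (r k) z $ i, w (r k) z $ i) \<le> 7" for k z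
      using norm_Pair_le[of "s (r k) z $ i" "w (r k) z $ i"] sb[of "r k" z i] component_le_norm_cart[of "w (r k) z" i] nw[of "r k" z]
      by simp
    show "(\<lambda>z. (v z $ i *\<^sub>R v z + p z *\<^sub>R axis i 1, v z $ i)) \<in> borel_measurable borel"
      using pm by (intro borel_measurable_Pair borel_measurable_add borel_measurable_scaleR vi vm) auto
    show "AE z in lborel. (\<lambda>j. (s (r j) z $ i, w (r j) z $ i)) \<longlonglongrightarrow> (v z $ i *\<^sub>R v z + p z *\<^sub>R axis i 1, v z $ i)"
      using AEv row[of i] by eventually_elim (intro tendsto_intros)
  qed
  have "AE z in lborel. norm (v z) \<le> 1" using unit by eventually_elim (auto simp: indicator_def)
  from euler_distributionalI[OF vm this pm AE_I2 div mom] pb have eu: "euler_distributional v p" by blast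
  show ?thesis by (rule that[OF vm pm v0 p0 unit AE_I2 eu]) (assumption | rule pb)+
qed

section \<open>Compact supports and the energy of time slices\<close>

lemma compact_ess_supp:
  fixes f :: "'a::euclidean_space \<Rightarrow> 'b::euclidean_space"
  assumes "bounded \<Omega>" "\<And>z. z \<notin> \<Omega> \<Longrightarrow> f z = 0" shows "compact (ess_supp f)"
proof -
  have "closed (ess_supp f)" unfolding ess_supp_def by (intro closed_Compl open_Union) auto
  moreover have "ess_supp f \<subseteq> closure \<Omega>"
  proof -
    have "f z = 0" if "z \<in> - closure \<Omega>" for z using that assms(2) closure_subset by blast
    then have "- closure \<Omega> \<in> {U. open U \<and> (AE z in lborel. z \<in> U \<longrightarrow> f z = 0)}" by auto
    then show ?thesis unfolding ess_supp_def by blast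
  qed
  ultimately show ?thesis using assms(1) bounded_closure bounded_subset compact_eq_bounded_closed by metis
qed

theorem theorem1p2:
  assumes "CARD('n::finite) \<ge> 2"
  shows "\<exists>(v :: (real^'n) \<times> real \<Rightarrow> real^'n) (p :: (real^'n) \<times> real \<Rightarrow> real).
           Linfty v \<and> Linfty p \<and> euler_distributional v p
         \<and> \<not> (AE z in lborel. v z = 0)
         \<and> compact (ess_supp v) \<and> compact (ess_supp p)
         \<and> (AE t in lborel. -1 < t \<and> t < 1 \<longrightarrow>
              integrable lborel (\<lambda>x. (norm (v (x, t)))\<^sup>2) \<and>
              (LINT x|lborel. (norm (v (x, t)))\<^sup>2) = 1)
         \<and> (AE z in lborel. \<bar>snd z\<bar> > 1 \<longrightarrow> v z = 0)"
proof -
  \<comment> \<open>A box of volume 1: as \<open>norm v\<close> is 1 almost everywhere on the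
    cylinder over it, almost every slice with \<open>|t| < 1\<close> has energy equal to this
    volume.\<close>
  define Q where "Q = box (0::real^'n) One"
  define \<Omega> where "\<Omega> = Q \<times> {-1<..<1::real}"
  have \<Omega>: "open \<Omega>" "bounded \<Omega>"
    unfolding \<Omega>_def Q_def by (simp_all add: open_Times open_box bounded_Times)
  have Qe: "emeasure lborel Q = 1" by (simp add: Q_def)
  then have Qm: "measure lborel Q = 1" by (simp add: measure_def)
  have iQ: "integrable lborel (indicat_real Q)"
    using Qe by (intro integrable_real_indicator) (auto simp: Q_def)
  obtain v :: "(real^'n) \<times> real \<Rightarrow> real^'n" and p :: "(real^'n) \<times> real \<Rightarrow> real"
    where v[measurable]: "v \<in> borel_measurable borel" and p: "p \<in> borel_measurable borel"
      and v0: "\<And>z. z \<notin> \<Omega> \<Longrightarrow> v z = 0" and p0: "\<And>z. z \<notin> \<Omega> \<Longrightarrow> p z = 0"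
      and unit: "AE z in lborel. norm (v z) = indicator \<Omega> z" and pb: "AE z in lborel. \<bar>p z\<bar> \<le> 3"
      and eu: "euler_distributional v p"
    apply (rule Euler_solution_unit_speed[OF assms \<Omega>])
    subgoal for v p by (rule that[of v p]) assumption+
    done
  have [measurable]: "\<Omega> \<in> sets borel" using \<Omega>(1) by (rule borel_open)
  have "AE z in lborel. norm (v z) \<le> 1" using unit by eventually_elim (auto simp: indicator_def)
  then have L1: "Linfty v" using v by (auto simp: Linfty_def)
  have L2: "Linfty p" using p pb by (auto simp: Linfty_def)
  \<comment> \<open>Fubini for null sets yields the statement with \<open>x\<close> as the outer
    variable; exchanging the quantifiers requires measurability of the set where the equality
    holds.\<close>
  have AEt: "AE t in lborel. AE x in lborel. norm (v (x, t)) = indicator \<Omega> (x, t)"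
  proof -
    have "AE z in lborel \<Otimes>\<^sub>M lborel. norm (v z) = indicator \<Omega> z" using unit unfolding lborel_prod .
    then have "AE x in lborel. AE t in lborel. norm (v (x, t)) = indicator \<Omega> (x, t)"
      by (rule lborel_pair.AE_pair)
    moreover have "{z \<in> space (lborel \<Otimes>\<^sub>M lborel). norm (v (fst z, snd z)) = indicator \<Omega> (fst z, snd z)} \<in> sets (lborel \<Otimes>\<^sub>M lborel)"
      unfolding lborel_prod by simp
    ultimately show ?thesis using lborel_pair.AE_commute[of "\<lambda>x t. norm (v (x, t)) = indicator \<Omega> (x, t)"] by blast
  qed
  have slice: "AE t in lborel. -1 < t \<and> t < 1 \<longrightarrow>
              integrable lborel (\<lambda>x. (norm (v (x, t)))\<^sup>2) \<and> (LINT x|lborel. (norm (v (x, t)))\<^sup>2) = 1"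
    using AEt
  proof eventually_elim
    case (elim t)
    show ?case
    proof
      assume t: "-1 < t \<and> t < 1"
      have eq: "AE x in lborel. indicat_real Q x = (norm (v (x, t)))\<^sup>2"
        using elim by eventually_elim (use t in \<open>auto simp: \<Omega>_def indicator_def\<close>)
      have m: "(\<lambda>x. (norm (v (x, t)))\<^sup>2) \<in> borel_measurable lborel" by measurable
      have Qb: "indicat_real Q \<in> borel_measurable lborel" by (simp add: Q_def)
      have "integrable lborel (\<lambda>x. (norm (v (x, t)))\<^sup>2)"
        using iQ integrable_cong_AE[OF Qb m eq] by blast
      moreover have "(LINT x|lborel. (norm (v (x, t)))\<^sup>2) = 1"
        using integral_cong_AE[OF Qb m eq] Qm by simp
      ultimately show "integrable lborel (\<lambda>x. (norm (v (x, t)))\<^sup>2) \<and> (LINT x|lborel. (norm (v (x, t)))\<^sup>2) = 1" ..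
    qed
  qed
  have nz: "\<not> (AE z in lborel. v z = 0)"
  proof
    assume "AE z in lborel. v z = 0"
    with unit have "AE z in lborel. z \<notin> \<Omega>" by eventually_elim (auto simp: indicator_def)
    then have "emeasure lborel \<Omega> = 0" by (subst (asm) AE_iff_measurable[of \<Omega>]) auto
    moreover have "emeasure lborel \<Omega> = emeasure lborel Q * emeasure lborel {-1<..<1::real}"
      unfolding \<Omega>_def lborel_prod[symmetric] by (intro lborel.emeasure_pair_measure_Times) (auto simp: Q_def)
    ultimately show False using Qe by simp
  qed
  have out: "AE z in lborel. \<bar>snd z\<bar> > 1 \<longrightarrow> v z = 0"
    by (intro AE_I2 impI v0) (auto simp: \<Omega>_def)
  show ?thesis
    by (intro exI[of _ v] exI[of _ p] conjI L1 L2 eu nz slice out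
        compact_ess_supp[of \<Omega> v, OF \<Omega>(2) v0] compact_ess_supp[of \<Omega> p, OF \<Omega>(2) p0])
qed

end
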